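(* Let $\varphi:\mathbb{R}\to[0,\infty)$ be a strongly convex function satisfying the $\Delta_2$-condition, and let $\Lambda\subset\mathbb{D}$ be a Blaschke sequence. The following assertions are equivalent: (a) $\Lambda$ is a free interpolating sequence for $\mathcal{H}_\Phi$, where $\Phi=\varphi\circ\log$. (b) There exists a positive measurable function $w\in L^\varphi(\mathbb{T})$ such that $\varphi_\Lambda\le P[w]$ on $\Lambda$, i.e. $\log\frac{1}{|B_\lambda(\lambda)|}\le P[w](\lambda)$ for all $\lambda\in\Lambda$. (c) The trace space is given by $$\mathcal{H}_\Phi|\Lambda=l_\Phi:=\{(a_\lambda)_{\lambda\in\Lambda}:\ \exists\, 0\le w\in L^\varphi(\mathbb{T}) \text{ with } \log^+|a_\lambda|\le P[w](\lambda)\ \text{for all }\lambda\in\Lambda\}.$$ If moreover $\varphi$ satisfies the $\nabla_2$-condition, then (a), (b), (c) are also equivalent to: (d) There exists a constant $C>0$ such that for any sequence of non-negative numbers $(c_\lambda)_{\lambda\in\Lambda}$, $$\sum_{\lambda\in\Lambda}c_\lambda\log\frac{1}{|B_\lambda(\lambda)|}\le C\Big\|\sum_{\lambda\in\Lambda}c_\lambda P_\lambda\Big\|_{(L^\varphi)^*}.$$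
   Context: A function $\varphi:\mathbb{R}\to[0,\infty)$ is strongly convex if it is convex, nondecreasing, $\lim_{t\to\infty}\varphi(t)/t=\infty$, and there are constants $M,K\ge0$, $t_0\in\mathbb{R}$ with $\varphi(t+2)\le M\varphi(t)+K$ for $t\ge t_0$. The $\Delta_2$-condition means: there are $c\ge1$ and $t_0$ such that $\varphi(a+b)\le c(\varphi(a)+\varphi(b))$ for all $a,b\ge t_0$. The $\nabla_2$-condition means: there are $d>1$, $t_0>0$ with $2\varphi(t)\le \frac1d\varphi(dt)$ for $t\ge t_0$. The Smirnov class $N^+$ is the class of holomorphic $f$ on $\mathbb{D}$ with $\lim_{r\to1}\frac1{2\pi}\int_0^{2\pi}\log^+|f(re^{i\theta})|d\theta=\frac1{2\pi}\int_0^{2\pi}\log^+|f(e^{i\theta})|d\theta$ (boundary values are nontangential limits). The Hardy-Orlicz class is $\mathcal{H}_\Phi=\{f\in N^+:\int_{\mathbb{T}}\varphi(\log|f(\zeta)|)\,dm(\zeta)<\infty\}$, $m$ normalized Lebesgue measure on $\mathbb{T}$. $L^\varphi(\mathbb{T})$ is the Orlicz space of measurable $u$ with $\varphi\circ|u|\in L^1(\mathbb{T})$; for topological purposes $\varphi$ is modified on an interval $[0,t_0]$ to a convex function on $[0,\infty)$ vanishing at $0$, $L^\varphi$ is given the Banach norm $\|u\|_\varphi=\inf\{t>0:\int\varphi(|u|/t)dm\le t\}$ (this does not change $L^\varphi$ as a set), and $(L^\varphi)^*$ denotes its dual with the dual norm. A sequence space $l$ is ideal if $(\omega_n a_n)\in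 l$ whenever $(a_n)\in l$ and $(\omega_n)\in\ell^\infty$. A sequence $\Lambda$ is free interpolating for a space $X$ of holomorphic functions on $\mathbb{D}$ if the trace $X|\Lambda=\{(f(\lambda))_{\lambda\in\Lambda}:f\in X\}$ is ideal. For $\lambda\in\mathbb{D}$, $b_\lambda(z)=\frac{|\lambda|}{\lambda}\frac{\lambda-z}{1-\bar\lambda z}$ (with $b_0(z)=z$); for a Blaschke sequence $\Lambda$ (i.e. $\sum(1-|\lambda|^2)<\infty$), $B_\Lambda=\prod_{\lambda\in\Lambda}b_\lambda$ and $B_\lambda=B_{\Lambda\setminus\{\lambda\}}$. $\varphi_\Lambda(z)=\log|B_\lambda(\lambda)|^{-1}$ if $z=\lambda\in\Lambda$ and $0$ otherwise. $P_\lambda(\zeta)=\frac{1-|\lambda|^2}{|\zeta-\lambda|^2}$ is the Poisson kernel and $P[w](z)=\int_{\mathbb{T}}P_z(\zeta)w(\zeta)dm(\zeta)$. *)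

theory Defs
  imports "HOL-Analysis.Analysis"
begin

definition strongly_convex :: "(real \<Rightarrow> real) \<Rightarrow> bool" where
  "strongly_convex \<phi> \<longleftrightarrow>
     (\<forall>t. 0 \<le> \<phi> t) \<and> convex_on UNIV \<phi> \<and> mono \<phi> \<and>
     filterlim (\<lambda>t. \<phi> t / t) at_top at_top \<and>
     (\<exists>M K t0. M \<ge> 0 \<and> K \<ge> 0 \<and> (\<forall>t\<ge>t0. \<phi> (t + 2) \<le> M * \<phi> t + K))"

definition Delta2 :: "(real \<Rightarrow> real) \<Rightarrow> bool" where
  "Delta2 \<phi> \<longleftrightarrow> (\<exists>c\<ge>1. \<exists>t0. \<forall>a b. a \<ge> t0 \<longrightarrow> b \<ge> t0 \<longrightarrow> \<phi> (a + b) \<le> c * (\<phi> a + \<phi> b))"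

definition Nabla2 :: "(real \<Rightarrow> real) \<Rightarrow> bool" where
  "Nabla2 \<phi> \<longleftrightarrow> (\<exists>d>1. \<exists>t0>0. \<forall>t\<ge>t0. 2 * \<phi> t \<le> \<phi> (d * t) / d)"

definition circ_mean :: "(complex \<Rightarrow> real) \<Rightarrow> real" where
  "circ_mean g = (LINT \<theta>:{0..2*pi}|lborel. g (cis \<theta>)) / (2 * pi)"

definition circ_integrable :: "(complex \<Rightarrow> real) \<Rightarrow> bool" where
  "circ_integrable g \<longleftrightarrow> set_integrable lborel {0..2*pi} (\<lambda>\<theta>. g (cis \<theta>))"

definition circ_measurable :: "(complex \<Rightarrow> real) \<Rightarrow> bool" where
  "circ_measurable g \<longleftrightarrow> set_borel_measurable lborel {0..2*pi} (\<lambda>\<theta>. g (cis \<theta>))"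

definition circ_nn_mean :: "(complex \<Rightarrow> ennreal) \<Rightarrow> ennreal" where
  "circ_nn_mean g = ennreal (1 / (2 * pi)) * (\<integral>\<^sup>+ \<theta>\<in>{0..2*pi}. g (cis \<theta>) \<partial>lborel)"

definition logplus :: "real \<Rightarrow> real" where
  "logplus x = max 0 (ln x)"

definition stolz :: "real \<Rightarrow> complex \<Rightarrow> complex set" where
  "stolz \<alpha> \<zeta> = {z \<in> ball 0 1. norm (z - \<zeta>) < \<alpha> * (1 - norm z)}"

definition has_nt_limit :: "(complex \<Rightarrow> complex) \<Rightarrow> complex \<Rightarrow> complex \<Rightarrow> bool" where
  "has_nt_limit f \<zeta> L \<longleftrightarrow> (\<forall>\<alpha>>1. (f \<longlongrightarrow> L) (at \<zeta> within stolz \<alpha> \<zeta>))"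

definition bv :: "(complex \<Rightarrow> complex) \<Rightarrow> complex \<Rightarrow> complex" where
  "bv f \<zeta> = (if \<exists>L. has_nt_limit f \<zeta> L then (SOME L. has_nt_limit f \<zeta> L) else 0)"

definition smirnov :: "(complex \<Rightarrow> complex) set" where
  "smirnov = {f. f holomorphic_on ball 0 1 \<and>
      circ_integrable (\<lambda>\<zeta>. logplus (norm (bv f \<zeta>))) \<and>
      ((\<lambda>r. circ_mean (\<lambda>\<zeta>. logplus (norm (f (of_real r * \<zeta>)))))
         \<longlongrightarrow> circ_mean (\<lambda>\<zeta>. logplus (norm (bv f \<zeta>)))) (at_left 1)}"

definition hardy_orlicz :: "(real \<Rightarrow> real) \<Rightarrow> (complex \<Rightarrow> complex) set" where
  "hardy_orlicz \<phi> = {f \<in> smirnov. circ_integrable (\<lambda>\<zeta>. \<phi> (ln (norm (bv f \<zeta>))))}"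

definition in_Lphi :: "(real \<Rightarrow> real) \<Rightarrow> (complex \<Rightarrow> real) \<Rightarrow> bool" where
  "in_Lphi \<phi> u \<longleftrightarrow> circ_measurable u \<and> circ_integrable (\<lambda>\<zeta>. \<phi> \<bar>u \<zeta>\<bar>)"

text \<open>An admissible modification psi of phi on some [0,t0] (Young function used for the norm).\<close>
definition orlicz_modification :: "(real \<Rightarrow> real) \<Rightarrow> (real \<Rightarrow> real) \<Rightarrow> bool" where
  "orlicz_modification \<phi> \<psi> \<longleftrightarrow>
     (\<exists>t0\<ge>0. convex_on {0..} \<psi> \<and> \<psi> 0 = 0 \<and> (\<forall>t\<ge>0. 0 \<le> \<psi> t) \<and> (\<forall>t\<ge>t0. \<psi> t = \<phi> t))"

definition orlicz_norm :: "(real \<Rightarrow> real) \<Rightarrow> (complex \<Rightarrow> real) \<Rightarrow> real" where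
  "orlicz_norm \<psi> u = Inf {t. t > 0 \<and> circ_nn_mean (\<lambda>\<zeta>. ennreal (\<psi> (\<bar>u \<zeta>\<bar> / t))) \<le> ennreal t}"

text \<open>Norm in the dual (L^phi)^* of the functional u |-> int g u dm, for a nonnegative
  (possibly infinite-valued) g; value infinity when the functional is unbounded.\<close>
definition dual_norm_pos :: "(real \<Rightarrow> real) \<Rightarrow> (real \<Rightarrow> real) \<Rightarrow> (complex \<Rightarrow> ennreal) \<Rightarrow> ennreal" where
  "dual_norm_pos \<phi> \<psi> g =
     (SUP u \<in> {u. in_Lphi \<phi> u \<and> orlicz_norm \<psi> u \<le> 1}.
        circ_nn_mean (\<lambda>\<zeta>. g \<zeta> * ennreal \<bar>u \<zeta>\<bar>))"

definition blaschke_factor :: "complex \<Rightarrow> complex \<Rightarrow> complex" where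
  "blaschke_factor a z =
     (if a = 0 then z else (of_real (norm a) / a) * ((a - z) / (1 - cnj a * z)))"

definition blaschke_seq :: "complex set \<Rightarrow> bool" where
  "blaschke_seq \<Lambda> \<longleftrightarrow> \<Lambda> \<subseteq> ball 0 1 \<and> (\<lambda>\<mu>. 1 - (norm \<mu>)\<^sup>2) summable_on \<Lambda>"

definition blaschke_prod :: "complex set \<Rightarrow> complex \<Rightarrow> complex" where
  "blaschke_prod \<Lambda> z = Lim (finite_subsets_at_top \<Lambda>) (\<lambda>F. \<Prod>\<mu>\<in>F. blaschke_factor \<mu> z)"

definition phi_Lambda :: "complex set \<Rightarrow> complex \<Rightarrow> real" where
  "phi_Lambda \<Lambda> z = (if z \<in> \<Lambda> then ln (1 / norm (blaschke_prod (\<Lambda> - {z}) z)) else 0)"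

definition poisson :: "complex \<Rightarrow> complex \<Rightarrow> real" where
  "poisson z \<zeta> = (1 - (norm z)\<^sup>2) / (norm (\<zeta> - z))\<^sup>2"

definition poisson_int :: "(complex \<Rightarrow> real) \<Rightarrow> complex \<Rightarrow> real" where
  "poisson_int w z = circ_mean (\<lambda>\<zeta>. poisson z \<zeta> * w \<zeta>)"

text \<open>Sequences indexed by Lambda are represented as functions vanishing outside Lambda.\<close>
definition ideal_on :: "complex set \<Rightarrow> (complex \<Rightarrow> complex) set \<Rightarrow> bool" where
  "ideal_on \<Lambda> l \<longleftrightarrow>
     (\<forall>a\<in>l. \<forall>\<omega>::complex \<Rightarrow> complex. bounded (\<omega> ` \<Lambda>) \<longrightarrow>
        (\<lambda>z. if z \<in> \<Lambda> then \<omega> z * a z else 0) \<in> l)"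

definition trace_on :: "(complex \<Rightarrow> complex) set \<Rightarrow> complex set \<Rightarrow> (complex \<Rightarrow> complex) set" where
  "trace_on X \<Lambda> = {(\<lambda>z. if z \<in> \<Lambda> then f z else 0) | f. f \<in> X}"

definition free_interpolating :: "(complex \<Rightarrow> complex) set \<Rightarrow> complex set \<Rightarrow> bool" where
  "free_interpolating X \<Lambda> \<longleftrightarrow> ideal_on \<Lambda> (trace_on X \<Lambda>)"

definition l_Phi :: "(real \<Rightarrow> real) \<Rightarrow> complex set \<Rightarrow> (complex \<Rightarrow> complex) set" where
  "l_Phi \<phi> \<Lambda> = {a. (\<forall>z. z \<notin> \<Lambda> \<longrightarrow> a z = 0) \<and>
     (\<exists>w. (\<forall>\<zeta>\<in>sphere 0 1. 0 \<le> w \<zeta>) \<and> in_Lphi \<phi> w \<and>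
          (\<forall>x\<in>\<Lambda>. logplus (norm (a x)) \<le> poisson_int w x))}"

end

theory Submission
  imports Defs "HOL-Complex_Analysis.Complex_Analysis" "HOL-Probability.Probability_Measure"
begin

text \<open>
  Write \<open>k(\<lambda>,\<mu>) = - log |b\<^sub>\<mu>(\<lambda>)|\<close>, so that \<open>\<phi>\<^sub>\<Lambda>(\<lambda>)\<close> is the sum of \<open>k(\<lambda>,\<mu>)\<close> over \<open>\<mu> \<noteq> \<lambda>\<close>.

  From (b) to (c): multiplying by an outer function \<open>exp (H[w])\<close> reduces the problem to bounded interpolation
  of values at most \<open>|B\<^sub>\<lambda>(\<lambda>)|\<^sup>5\<close>, which P. Jones' explicit series solves. The product belongs to the
  Hardy--Orlicz class by Fatou's theorem for bounded functions, Jensen's inequality for \<open>\<phi>\<close>, and uniform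
  integrability.

  From (a) to (b): freeness provides \<open>f\<^sub>S\<close> with \<open>f\<^sub>S = 1\<close> on \<open>S\<close> and \<open>f\<^sub>S = 0\<close> on \<open>\<Lambda> - S\<close> for every
  \<open>S \<subseteq> \<Lambda>\<close>; dividing out zeros majorises the sum of \<open>k(\<lambda>,\<mu>)\<close> over \<open>\<mu> \<in> \<Lambda> - S\<close> by a Poisson integral
  at each \<open>\<lambda> \<in> S\<close>. A Baire category argument on the power set of \<open>\<Lambda>\<close> makes the Orlicz bounds uniform on a cylinder,
  and averaging over all \<open>S\<close> in that cylinder recovers a quarter of the full sum. The limits exist because
  balls of the Orlicz class are compact for the Poisson integrals, by a Komlos-type argument.

  The dual condition (d) is the multiplier rule for minimising the defect of the majorisation over an
  Orlicz ball.
\<close>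

section \<open>Normalised arc length and the Poisson kernel\<close>

text \<open>Three points shape the proof. (1) \<open>bv\<close> is a genuine nontangential limit or
  the default 0, and \<open>smirnov\<close> demands convergence of means. The interpolating function
  is therefore treated as a quotient \<open>f0 / exp (- herglotz w)\<close> of bounded functions, so
  that Fatou's theorem is needed for bounded functions only; it is derived from the almost
  everywhere differentiability of the Lipschitz boundary function of a primitive. (2) Limits of
  weights must remain functions: sequences bounded in mean may concentrate on a null set. All limits
  are taken in balls for the modular \<open>\<integral> \<rho>(w)\<close>, where superlinear growth
  gives uniform integrability. Only lower bounds for Poisson integrals are passed to the limit;
  these survive convex combinations. (3) Constant factors are free, because the doubling condition
  makes the Orlicz class a vector space: the fifth power in the interpolation costs a weight
  \<open>5 * w\<close>, and the averaging costs a factor 4, since a given ordered pair has its first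
  point in a random set and its second outside it with probability 1/4.\<close>

definition circ :: "real measure" where
  "circ = density (restrict_space lborel {0..2*pi}) (\<lambda>_. ennreal (1 / (2 * pi)))"

lemma space_circ [simp]: "space circ = {0..2*pi}"
  by (simp add: circ_def space_restrict_space)

lemma sets_circ [measurable_cong]: "sets circ = sets (restrict_space lborel {0..2*pi})"
  by (simp add: circ_def)

lemma borel_measurable_circI: "f \<in> borel_measurable borel \<Longrightarrow> f \<in> borel_measurable circ"
  by (simp add: measurable_cong_sets[OF sets_circ refl] measurable_restrict_space1)

lemma borel_measurable_circ_continuous:
  "continuous_on {0..2*pi} f \<Longrightarrow> f \<in> borel_measurable circ"
  by (metis borel_measurable_continuous_on_restrict measurable_cong_sets sets_circ
      sets_restrict_space_cong sets_lborel)

interpretation circ: prob_space circ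
proof
  have "emeasure circ (space circ) = (\<integral>\<^sup>+t. 1 \<partial>circ)" by simp
  also have "\<dots> = ennreal (1 / (2 * pi)) * emeasure lborel {0..2*pi}"
    unfolding circ_def
    by (subst nn_integral_density) (auto simp: emeasure_restrict_space)
  also have "\<dots> = ennreal (1 / (2*pi) * (2*pi))"
    by (subst ennreal_mult) auto
  finally show "emeasure circ (space circ) = 1" by simp
qed

text \<open>Holds for every \<open>g\<close>: without integrability both integrals have the default
  value 0.\<close>

lemma circ_integral_eq:
  fixes g :: "real \<Rightarrow> 'a::{banach, second_countable_topology}"
  shows "(\<integral>t. g t \<partial>circ) = (1 / (2*pi)) *\<^sub>R (LINT t:{0..2*pi}|lborel. g t)"
proof -
  have "(\<integral>t. g t \<partial>circ) = (\<integral>t. (1 / (2*pi)) *\<^sub>R g t \<partial>restrict_space lborel {0..2*pi})"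
  proof (cases "g \<in> borel_measurable (restrict_space lborel {0..2*pi})")
    case True
    then show ?thesis unfolding circ_def by (subst integral_density) auto
  next
    case False
    then have "g \<notin> borel_measurable circ" by (simp add: measurable_cong_sets[OF sets_circ refl])
    then have 1: "(\<integral>t. g t \<partial>circ) = 0"
      using borel_measurable_integrable not_integrable_integral_eq by blast
    have "\<not> integrable (restrict_space lborel {0..2*pi}) g"
      using False borel_measurable_integrable by blast
    then show ?thesis by (simp add: 1 not_integrable_integral_eq)
  qed
  then show ?thesis
    by (simp add: integral_restrict_space set_lebesgue_integral_def)
qed

lemma circ_integrable_eq:
  fixes g :: "real \<Rightarrow> 'a::{banach, second_countable_topology}"
  shows "integrable circ g \<longleftrightarrow> set_integrable lborel {0..2*pi} g"
proof (cases "g \<in> borel_measurable (restrict_space lborel {0..2*pi})")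
  case True
  then have "integrable circ g \<longleftrightarrow> integrable (restrict_space lborel {0..2*pi}) (\<lambda>t. (1 / (2*pi)) *\<^sub>R g t)"
    unfolding circ_def by (subst integrable_density) auto
  also have "\<dots> \<longleftrightarrow> integrable (restrict_space lborel {0..2*pi}) g"
    using integrable_scaleR_right[of "2*pi" "restrict_space lborel {0..2*pi}" "\<lambda>t. (1 / (2*pi)) *\<^sub>R g t"]
    by auto
  finally show ?thesis
    by (simp add: integrable_restrict_space set_integrable_def)
next
  case False
  then have "\<not> integrable circ g"
    by (metis borel_measurable_integrable measurable_cong_sets sets_circ)
  moreover have "\<not> integrable (restrict_space lborel {0..2*pi}) g"
    using False borel_measurable_integrable by blast
  ultimately show ?thesis by (simp add: integrable_restrict_space set_integrable_def)
qed

lemma circ_mean_eq: "circ_mean g = (\<integral>t. g (cis t) \<partial>circ)"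
  by (simp add: circ_mean_def circ_integral_eq)

lemma circ_integrable_iff: "circ_integrable g \<longleftrightarrow> integrable circ (\<lambda>t. g (cis t))"
  by (simp add: circ_integrable_def circ_integrable_eq)

lemma circ_measurable_iff: "circ_measurable g \<longleftrightarrow> (\<lambda>t. g (cis t)) \<in> borel_measurable circ"
  by (simp add: circ_measurable_def set_borel_measurable_def measurable_cong_sets[OF sets_circ refl]
      borel_measurable_restrict_space_iff)

lemma circ_nn_mean_eq:
  assumes "(\<lambda>t. g (cis t)) \<in> borel_measurable circ"
  shows "circ_nn_mean g = (\<integral>\<^sup>+t. g (cis t) \<partial>circ)"
proof -
  have m: "(\<lambda>t. g (cis t)) \<in> borel_measurable (restrict_space lborel {0..2*pi})"
    using assms by (simp add: measurable_cong_sets[OF sets_circ refl])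
  have "(\<integral>\<^sup>+t. g (cis t) \<partial>circ) = (\<integral>\<^sup>+t. ennreal (1/(2*pi)) * g (cis t) \<partial>restrict_space lborel {0..2*pi})"
    unfolding circ_def using m by (subst nn_integral_density) auto
  also have "\<dots> = ennreal (1/(2*pi)) * (\<integral>\<^sup>+t. g (cis t) \<partial>restrict_space lborel {0..2*pi})"
    using m by (rule nn_integral_cmult)
  finally show ?thesis by (simp add: circ_nn_mean_def nn_integral_restrict_space)
qed

lemma AE_circI: "AE t in lborel. P t \<Longrightarrow> AE t in circ. P t"
  unfolding circ_def by (subst AE_density) (auto simp: AE_restrict_space_iff)

section \<open>Cauchy's formulas as averages over the circle\<close>

lemma integrable_circ_continuous:
  fixes f :: "real \<Rightarrow> 'a::euclidean_space"
  shows "continuous_on {0..2*pi} f \<Longrightarrow> integrable circ f"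
  unfolding circ_integrable_eq set_integrable_def
  by (rule borel_integrable_compact) auto

text \<open>On the circle \<open>dz = \<i> * cis t dt\<close>, so a contour integral divided by
  \<open>2 * pi * \<i>\<close> is an average against \<open>cis t\<close>.\<close>

lemma contour_integral_eq_circ:
  assumes "(h has_contour_integral I) (circlepath 0 1)" "continuous_on (sphere 0 1) h"
  shows "(\<integral>t. h (cis t) * cis t \<partial>circ) = I / (2 * pi * \<i>)"
proof -
  have cont: "continuous_on {0..2*pi} (\<lambda>t. h (cis t) * cis t)"
    by (intro continuous_intros continuous_on_compose2[OF assms(2)]) auto
  have "((\<lambda>t. h (cis t) * \<i> * cis t) has_integral I) {0..2*pi}"
    using assms(1) unfolding circlepath_def
    by (subst (asm) has_contour_integral_part_circlepath_iff) auto
  then have "((\<lambda>t. (h (cis t) * \<i> * cis t) * (1 / \<i>)) has_integral I * (1 / \<i>)) {0..2*pi}"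
    by (rule has_integral_mult_left)
  then have "((\<lambda>t. h (cis t) * cis t) has_integral I / \<i>) {0..2*pi}"
    by (simp add: field_simps)
  moreover have "set_integrable lborel {0..2*pi} (\<lambda>t. h (cis t) * cis t)"
    using integrable_circ_continuous[OF cont] by (simp add: circ_integrable_eq)
  ultimately have "(LINT t:{0..2*pi}|lborel. h (cis t) * cis t) = I / \<i>"
    by (metis integral_unique set_borel_integral_eq_integral(2))
  then show ?thesis
    unfolding circ_integral_eq by (simp add: scaleR_conv_of_real field_simps)
qed

lemma circ_Cauchy_formula:
  assumes "continuous_on (cball 0 1) f" "f holomorphic_on ball 0 1" "norm w < 1"
  shows "(\<integral>t. f (cis t) / (cis t - w) * cis t \<partial>circ) = f w"
proof -
  have "((\<lambda>u. f u / (u - w)) has_contour_integral (2 * of_real pi * \<i> * f w)) (circlepath 0 1)"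
    using assms by (intro Cauchy_integral_circlepath) auto
  moreover have "continuous_on (sphere 0 1) (\<lambda>u. f u / (u - w))"
    using assms(3) by (intro continuous_intros continuous_on_subset[OF assms(1)]) auto
  ultimately show ?thesis
    by (subst contour_integral_eq_circ) auto
qed

lemma circ_Cauchy_theorem:
  assumes "continuous_on (cball 0 1) f" "f holomorphic_on ball 0 1"
  shows "(\<integral>t. f (cis t) * cis t \<partial>circ) = 0"
proof -
  \<comment> \<open>Cauchy's formula at 0 for \<open>u \<mapsto> f u * u\<close>, which vanishes
    there.\<close>
  have "(\<integral>t. (f (cis t) * cis t) / (cis t - 0) * cis t \<partial>circ) = f 0 * 0"
    using assms by (intro circ_Cauchy_formula[where f = "\<lambda>u. f u * u"])
      (auto intro!: continuous_intros holomorphic_intros)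
  then show ?thesis by simp
qed

lemma circ_Cauchy_derivative:
  assumes "continuous_on (cball 0 1) f" "f holomorphic_on ball 0 1" "norm w < 1"
  shows "(\<integral>t. f (cis t) / (cis t - w)\<^sup>2 * cis t \<partial>circ) = deriv f w"
proof -
  have w: "w \<in> ball 0 1" using assms by auto
  note C = Cauchy_derivative_integral_circlepath[OF assms(1,2) w]
  have "continuous_on (sphere 0 1) (\<lambda>u. f u / (u - w)\<^sup>2)"
    using assms(3) by (intro continuous_intros continuous_on_subset[OF assms(1)]) auto
  from contour_integral_eq_circ[OF has_contour_integral_integral[OF C(1)] this]
  show ?thesis using DERIV_imp_deriv[OF C(2)] by simp
qed

section \<open>The Poisson kernel and the Herglotz transform\<close>

lemma norm_diff_sphere_ge: "norm \<zeta> = 1 \<Longrightarrow> 1 - norm z \<le> norm (\<zeta> - z)" for \<zeta> z :: complex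
  using norm_triangle_ineq2[of \<zeta> z] by simp

lemma poisson_nonneg: "norm z < 1 \<Longrightarrow> 0 \<le> poisson z \<zeta>"
  by (simp add: poisson_def power_le_one)

lemma poisson_le:
  assumes "norm z < 1" "norm \<zeta> = 1"
  shows "poisson z \<zeta> \<le> (1 - (norm z)\<^sup>2) / (1 - norm z)\<^sup>2"
  unfolding poisson_def using assms norm_diff_sphere_ge[OF assms(2), of z]
  by (intro divide_left_mono power_mono mult_pos_pos) (auto simp: power_le_one)

lemma continuous_on_poisson_cis: "norm z < 1 \<Longrightarrow> continuous_on A (\<lambda>t. poisson z (cis t))"
  unfolding poisson_def by (intro continuous_intros) auto

lemma poisson_cis_measurable [measurable]:
  "norm z < 1 \<Longrightarrow> (\<lambda>t. poisson z (cis t)) \<in> borel_measurable circ"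
  by (intro borel_measurable_circ_continuous continuous_on_poisson_cis)

lemma poisson_eq_Re:
  assumes "norm \<zeta> = 1"
  shows "poisson z \<zeta> = Re ((\<zeta> + z) / (\<zeta> - z))"
proof -
  have "Re ((\<zeta> + z) / (\<zeta> - z)) = ((norm \<zeta>)\<^sup>2 - (norm z)\<^sup>2) / (norm (\<zeta> - z))\<^sup>2"
    unfolding Re_divide cmod_power2 by (simp add: algebra_simps power2_eq_square)
  then show ?thesis using assms by (simp add: poisson_def)
qed

text \<open>Lets the roles of the point on the circle of radius \<open>r\<close> and the boundary
  point be exchanged under a double integral.\<close>

lemma poisson_symmetric:
  assumes "norm \<zeta> = 1" "norm \<eta> = 1"
  shows "poisson (of_real r * \<zeta>) \<eta> = poisson (of_real r * \<eta>) \<zeta>"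
proof -
  have "(norm (\<eta> - of_real r * \<zeta>))\<^sup>2 = (norm \<eta>)\<^sup>2 + r\<^sup>2 * (norm \<zeta>)\<^sup>2 - 2 * r * (Re \<eta> * Re \<zeta> + Im \<eta> * Im \<zeta>)"
    and "(norm (\<zeta> - of_real r * \<eta>))\<^sup>2 = (norm \<zeta>)\<^sup>2 + r\<^sup>2 * (norm \<eta>)\<^sup>2 - 2 * r * (Re \<eta> * Re \<zeta> + Im \<eta> * Im \<zeta>)"
    unfolding cmod_power2 by (simp_all add: power2_eq_square algebra_simps)
  then show ?thesis using assms by (simp add: poisson_def norm_mult)
qed

text \<open>The holomorphic completion of the Poisson integral; \<open>exp (herglotz w z)\<close> is
  an outer function of modulus \<open>exp (poisson_int w z)\<close>.\<close>

definition herglotz :: "(complex \<Rightarrow> real) \<Rightarrow> complex \<Rightarrow> complex" where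
  "herglotz w z = (\<integral>t. of_real (w (cis t)) * ((cis t + z) / (cis t - z)) \<partial>circ)"

lemma integrable_circ_mult_bounded:
  fixes f :: "real \<Rightarrow> 'a::{real_normed_field, banach, second_countable_topology}"
  assumes "integrable circ f" "g \<in> borel_measurable circ" "\<And>t. t \<in> {0..2*pi} \<Longrightarrow> norm (g t) \<le> B"
  shows "integrable circ (\<lambda>t. f t * g t)"
proof (rule Bochner_Integration.integrable_bound)
  show "integrable circ (\<lambda>t. B * norm (f t))" using assms by auto
  show "(\<lambda>t. f t * g t) \<in> borel_measurable circ" using assms by auto
  show "AE t in circ. norm (f t * g t) \<le> norm (B * norm (f t))"
    using assms(3) by (intro AE_I2)
      (auto simp: norm_mult mult.commute[of "norm (f _)"] intro!: mult_right_mono order.trans[OF _ abs_ge_self])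
qed

lemma integrable_poisson_mult:
  assumes "norm z < 1" "circ_integrable w"
  shows "integrable circ (\<lambda>t. poisson z (cis t) * w (cis t))"
proof -
  have "integrable circ (\<lambda>t. w (cis t) * poisson z (cis t))"
    using assms poisson_nonneg[OF assms(1)] poisson_le[OF assms(1)]
    by (intro integrable_circ_mult_bounded[where B = "(1 - (norm z)\<^sup>2) / (1 - norm z)\<^sup>2"])
      (auto simp: circ_integrable_iff)
  then show ?thesis by (simp add: mult.commute)
qed

lemma integrable_herglotz:
  assumes "norm z < 1" "circ_integrable w"
  shows "integrable circ (\<lambda>t. of_real (w (cis t)) * ((cis t + z) / (cis t - z)))"
proof (rule integrable_circ_mult_bounded)
  show "integrable circ (\<lambda>t. complex_of_real (w (cis t)))"
    using assms by (simp add: circ_integrable_iff)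
  show "(\<lambda>t. (cis t + z) / (cis t - z)) \<in> borel_measurable circ"
    using assms(1) by (intro borel_measurable_circ_continuous continuous_intros) auto
  show "norm ((cis t + z) / (cis t - z)) \<le> 2 / (1 - norm z)" for t
    using norm_diff_sphere_ge[of "cis t" z] norm_triangle_ineq[of "cis t" z] assms(1)
    by (simp add: norm_divide) (intro frac_le, auto)
qed

lemma Re_herglotz:
  assumes "norm z < 1" "circ_integrable w"
  shows "Re (herglotz w z) = poisson_int w z"
proof -
  have "Re (herglotz w z) = (\<integral>t. Re (of_real (w (cis t)) * ((cis t + z) / (cis t - z))) \<partial>circ)"
    unfolding herglotz_def by (rule integral_Re[OF integrable_herglotz[OF assms], symmetric])
  also have "\<dots> = (\<integral>t. poisson z (cis t) * w (cis t) \<partial>circ)"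
    by (rule Bochner_Integration.integral_cong)
      (simp_all add: poisson_eq_Re mult.commute[of _ "w _"] del: times_divide_eq_right)
  finally show ?thesis by (simp add: poisson_int_def circ_mean_eq)
qed

text \<open>Real part of \<open>(\<zeta> + z) / (\<zeta> - z) = 2 * \<zeta> / (\<zeta> - z) -
  1\<close>, whose mean is \<open>2 - 1\<close> by Cauchy's formula for the constant 1.\<close>

lemma poisson_mean:
  assumes "norm z < 1"
  shows "(\<integral>t. poisson z (cis t) \<partial>circ) = 1"
proof -
  have 1: "(\<integral>t. 1 / (cis t - z) * cis t \<partial>circ) = 1"
    using circ_Cauchy_formula[of "\<lambda>_. 1" z] assms by auto
  have cont: "continuous_on {0..2*pi} (\<lambda>t. 1 / (cis t - z) * cis t)"
    using assms by (intro continuous_intros) auto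
  have "herglotz (\<lambda>_. 1) z = (\<integral>t. 2 * (1 / (cis t - z) * cis t) - 1 \<partial>circ)"
    unfolding herglotz_def
  proof (rule Bochner_Integration.integral_cong[OF refl])
    fix t
    have "cis t - z \<noteq> 0" using assms by auto
    then show "of_real 1 * ((cis t + z) / (cis t - z)) = 2 * (1 / (cis t - z) * cis t) - 1"
      by (simp add: field_simps)
  qed
  also have "\<dots> = 1"
    using integrable_circ_continuous[OF cont] 1
    by (subst Bochner_Integration.integral_diff)
      (auto simp: circ.prob_space[unfolded space_circ] simp del: times_divide_eq_right times_divide_eq_left)
  finally show ?thesis
    using Re_herglotz[of z "\<lambda>_. 1"] assms by (simp add: poisson_int_def circ_mean_eq circ_integrable_iff)
qed

lemma poisson_int_eq: "poisson_int w z = (\<integral>t. poisson z (cis t) * w (cis t) \<partial>circ)"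
  by (simp add: poisson_int_def circ_mean_eq)

lemma poisson_int_const: "norm z < 1 \<Longrightarrow> poisson_int (\<lambda>_. c) z = c"
  by (simp add: poisson_int_eq poisson_mean)

lemma poisson_int_add:
  assumes "norm z < 1" "circ_integrable u" "circ_integrable v"
  shows "poisson_int (\<lambda>\<zeta>. u \<zeta> + v \<zeta>) z = poisson_int u z + poisson_int v z"
  using integrable_poisson_mult[OF assms(1,2)] integrable_poisson_mult[OF assms(1,3)]
  by (simp add: poisson_int_eq distrib_left)

lemma poisson_int_cmult: "poisson_int (\<lambda>\<zeta>. c * u \<zeta>) z = c * poisson_int u z"
  by (simp add: poisson_int_eq mult.left_commute)

lemma poisson_int_mono:
  assumes "norm z < 1" "circ_integrable u" "circ_integrable v" "\<And>t. u (cis t) \<le> v (cis t)"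
  shows "poisson_int u z \<le> poisson_int v z"
  unfolding poisson_int_eq using assms poisson_nonneg[OF assms(1)]
  by (intro integral_mono integrable_poisson_mult mult_left_mono) auto

lemma poisson_int_nonneg:
  assumes "norm z < 1" "\<And>t. 0 \<le> u (cis t)"
  shows "0 \<le> poisson_int u z"
  unfolding poisson_int_eq using assms poisson_nonneg[OF assms(1)]
  by (intro integral_nonneg_AE AE_I2) auto

text \<open>The kernel difference at \<open>u\<close> and \<open>z\<close> is \<open>u - z\<close>
  times an explicit kernel \<open>K u\<close>. Its integral \<open>g u\<close> is the difference
  quotient, and dominated convergence makes it continuous at \<open>z\<close>, which is
  Caratheodory's form of differentiability.\<close>

lemma herglotz_holomorphic:
  assumes "circ_integrable w"
  shows "herglotz w holomorphic_on ball 0 1"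
proof -
  have int: "integrable circ (\<lambda>t. complex_of_real (w (cis t)))"
    using assms by (simp add: circ_integrable_iff)
  have "\<exists>D. (herglotz w has_field_derivative D) (at z)" if z: "z \<in> ball 0 1" for z
  proof -
    define K where "K = (\<lambda>u t. of_real (w (cis t)) * (2 * cis t / ((cis t - z) * (cis t - u))))"
    define g where "g = (\<lambda>u. \<integral>t. K u t \<partial>circ)"
    have nz: "norm z < 1" using z by simp
    \<comment> \<open>Half the distance from \<open>z\<close> to the circle, so every
      \<open>u\<close> in \<open>ball z d\<close> also keeps distance at least \<open>d\<close> from
      it.\<close>
    define d where "d = (1 - norm z) / 2"
    have d: "d > 0" "norm z + d < 1" using nz by (auto simp: d_def field_simps)
    have ne: "cis t - u \<noteq> 0" if "norm u < 1" for t u using that by auto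
    have gb: "norm (K u t) \<le> norm (w (cis t)) * (2 / (d * d))" if u: "u \<in> ball z d" for u t
    proof -
      have "norm u < norm z + d" using u norm_triangle_ineq2[of u z] by (auto simp: dist_norm norm_minus_commute)
      have "norm (cis t - u) \<ge> d"
        using norm_diff_sphere_ge[of "cis t" u] \<open>norm u < norm z + d\<close> d by (auto simp: d_def field_simps)
      moreover have "norm (cis t - z) \<ge> d"
        using norm_diff_sphere_ge[of "cis t" z] d by (auto simp: d_def field_simps)
      ultimately have "norm (2 * cis t / ((cis t - z) * (cis t - u))) \<le> 2 / (d * d)"
        using d by (simp add: norm_divide norm_mult) (intro frac_le mult_mono, auto)
      then show ?thesis unfolding K_def norm_mult by (intro mult_mono) auto
    qed
    have meas: "K u \<in> borel_measurable circ" if "norm u < 1" for u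
      unfolding K_def using that nz int
      by (intro borel_measurable_times[OF borel_measurable_integrable[OF int]] borel_measurable_circ_continuous continuous_intros)
        (use ne in auto)
    have nu: "norm u < 1" if "u \<in> ball z d" for u
      using that d norm_triangle_ineq2[of u z] by (auto simp: dist_norm norm_minus_commute)
    have cont: "isCont g z"
      unfolding isCont_def tendsto_at_iff_sequentially
    proof (intro allI impI)
      fix X :: "nat \<Rightarrow> complex" assume X: "\<forall>i. X i \<in> UNIV - {z}" "X \<longlonglongrightarrow> z"
      have "eventually (\<lambda>n. X n \<in> ball z d) sequentially"
        using X(2) d(1) by (auto dest!: tendstoD simp: dist_commute)
      then obtain N where N: "\<And>n. n \<ge> N \<Longrightarrow> X n \<in> ball z d" by (auto simp: eventually_sequentially)
      have "(\<lambda>n. g (X (n + N))) \<longlonglongrightarrow> g z"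
        unfolding g_def
      proof (rule integral_dominated_convergence[where w = "\<lambda>t. norm (w (cis t)) * (2 / (d*d))"])
        show "K z \<in> borel_measurable circ" using nz by (rule meas)
        show "K (X (n + N)) \<in> borel_measurable circ" for n using nu[OF N] by (intro meas) auto
        show "integrable circ (\<lambda>t. norm (w (cis t)) * (2 / (d * d)))"
          using assms by (simp add: circ_integrable_iff)
        show "AE t in circ. norm (K (X (n + N)) t) \<le> norm (w (cis t)) * (2 / (d * d))" for n
          using gb[OF N] by simp
        have "(\<lambda>n. K (X (n + N)) t) \<longlonglongrightarrow> K z t" for t
          unfolding K_def using ne[OF nz, of t] LIMSEQ_ignore_initial_segment[OF X(2), of N]
          by (intro tendsto_intros) auto
        then show "AE t in circ. (\<lambda>n. K (X (n + N)) t) \<longlonglongrightarrow> K z t" by simp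
      qed
      then show "((g \<circ> X) \<longlongrightarrow> g z) sequentially"
        unfolding comp_def by (rule LIMSEQ_offset)
    qed
    have eq: "herglotz w u - herglotz w z = g u * (u - z)" if u: "u \<in> ball z d" for u
    proof -
      have "herglotz w u - herglotz w z = (\<integral>t. of_real (w (cis t)) * ((cis t + u) / (cis t - u)) - of_real (w (cis t)) * ((cis t + z) / (cis t - z)) \<partial>circ)"
        unfolding herglotz_def using nu[OF u] nz assms
        by (intro Bochner_Integration.integral_diff[symmetric] integrable_herglotz) auto
      also have "\<dots> = (\<integral>t. K u t * (u - z) \<partial>circ)"
      proof (rule Bochner_Integration.integral_cong[OF refl])
        fix t
        have "cis t - u \<noteq> 0" "cis t - z \<noteq> 0" using ne nu[OF u] nz by auto
        then have "(cis t + u) / (cis t - u) - (cis t + z) / (cis t - z) = 2 * cis t / ((cis t - z) * (cis t - u)) * (u - z)"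
          by (simp add: field_simps)
        then show "of_real (w (cis t)) * ((cis t + u) / (cis t - u)) - of_real (w (cis t)) * ((cis t + z) / (cis t - z)) = K u t * (u - z)"
          unfolding K_def right_diff_distrib[symmetric] by (simp only: mult.assoc)
      qed
      finally show ?thesis by (simp add: g_def)
    qed
    \<comment> \<open>Caratheodory's identity is required for all \<open>u\<close>; outside the ball
      \<open>G\<close> is simply the difference quotient.\<close>
    define G where "G = (\<lambda>u. if u \<in> ball z d then g u else (herglotz w u - herglotz w z) / (u - z))"
    have "isCont G z"
    proof -
      have "eventually (\<lambda>u. G u = g u) (nhds z)"
        using eventually_nhds_in_open[of "ball z d" z] d by (auto elim!: eventually_mono simp: G_def)
      then show ?thesis using cont isCont_cong by blast
    qed
    moreover have "\<forall>u. herglotz w u - herglotz w z = G u * (u - z)"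
      using eq by (auto simp: G_def)
    ultimately have "DERIV (herglotz w) z :> G z"
      unfolding CARAT_DERIV by blast
    then show ?thesis by blast
  qed
  then show ?thesis
    by (auto simp: holomorphic_on_open field_differentiable_def)
qed

text \<open>Makes continuity visible: \<open>ln 0 = 0\<close> gives \<open>logplus 0 = 0\<close>,
  and \<open>max 1 x\<close> stays away from the singularity of the logarithm.\<close>

lemma logplus_eq: "0 \<le> x \<Longrightarrow> logplus x = ln (max 1 x)"
  by (cases "x < 1"; cases "x = 0") (auto simp: logplus_def max_def)

lemma logplus_nonneg [simp]: "0 \<le> logplus x"
  by (simp add: logplus_def)

lemma ln_le_logplus: "ln x \<le> logplus x"
  by (simp add: logplus_def)

lemma logplus_mono: "0 \<le> x \<Longrightarrow> x \<le> y \<Longrightarrow> logplus x \<le> logplus y"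
  by (auto simp: logplus_eq)

lemma logplus_mult_le: "0 \<le> x \<Longrightarrow> 0 \<le> y \<Longrightarrow> logplus (x * y) \<le> logplus x + logplus y"
  by (cases "x = 0 \<or> y = 0") (auto simp: logplus_def ln_mult)

lemma logplus_exp: "logplus (exp x) = max 0 x"
  by (simp add: logplus_def)

lemma continuous_on_logplus [continuous_intros]:
  fixes f :: "'a::topological_space \<Rightarrow> complex"
  assumes "continuous_on A f"
  shows "continuous_on A (\<lambda>x. logplus (norm (f x)))"
proof -
  have "continuous_on A (\<lambda>x. ln (max 1 (norm (f x))))"
    using assms by (intro continuous_intros) auto
  then show ?thesis by (simp add: logplus_eq)
qed

lemma tendsto_logplus_norm:
  fixes f :: "'a \<Rightarrow> complex"
  assumes "(f \<longlongrightarrow> L) F"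
  shows "((\<lambda>x. logplus (norm (f x))) \<longlongrightarrow> logplus (norm L)) F"
proof -
  have "((\<lambda>x. ln (max 1 (norm (f x)))) \<longlongrightarrow> ln (max 1 (norm L))) F"
    using assms by (intro tendsto_intros) auto
  then show ?thesis by (simp add: logplus_eq)
qed

lemma continuous_on_compose_cis:
  "continuous_on (sphere 0 1) f \<Longrightarrow> continuous_on A (\<lambda>t. f (cis t))"
  by (rule continuous_on_compose2[of "sphere 0 1" f]) (auto intro!: continuous_intros)

lemma circ_integrable_continuous:
  "continuous_on (sphere 0 1) v \<Longrightarrow> circ_integrable v"
  by (simp add: circ_integrable_iff integrable_circ_continuous continuous_on_compose_cis)

lemma poisson_mult_norm_sq: "norm z < 1 \<Longrightarrow> norm \<zeta> = 1 \<Longrightarrow> poisson z \<zeta> * (norm (\<zeta> - z))\<^sup>2 = 1 - (norm z)\<^sup>2"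
  using norm_diff_sphere_ge[of \<zeta> z] by (auto simp: poisson_def)

text \<open>A modulus of continuity of the form \<open>e + C * dist\<^sup>2\<close> suffices because
  \<open>poisson z \<zeta> * dist \<zeta> z ^ 2\<close> is the constant \<open>1 - norm z ^ 2\<close>.\<close>

lemma poisson_int_approx:
  fixes v :: "complex \<Rightarrow> real"
  assumes cont: "continuous_on (cball 0 1) v" and e: "e > 0"
  obtains d where "d > 0" "\<And>z. 1 - d < norm z \<Longrightarrow> norm z < 1 \<Longrightarrow> \<bar>poisson_int v z - v z\<bar> < e"
proof -
  have "bounded (v ` cball 0 1)"
    by (rule compact_imp_bounded[OF compact_continuous_image[OF cont]]) simp
  then obtain K where K: "K > 0" "\<And>z. z \<in> cball 0 1 \<Longrightarrow> \<bar>v z\<bar> \<le> K"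
    unfolding bounded_pos by auto
  obtain \<eta> where \<eta>: "\<eta> > 0" "\<And>x y. x \<in> cball 0 1 \<Longrightarrow> y \<in> cball 0 1 \<Longrightarrow> dist y x < \<eta> \<Longrightarrow> dist (v y) (v x) < e / 2"
    using compact_uniformly_continuous[OF cont] e unfolding uniformly_continuous_on_def
    by (metis compact_cball half_gt_zero)
  \<comment> \<open>With this \<open>C\<close> the quadratic term exceeds the trivial bound
    \<open>2 * K\<close> as soon as the distance is at least \<open>\<eta>\<close>.\<close>
  define C where "C = 2 * K / \<eta>\<^sup>2"
  have C: "C \<ge> 0" using K \<eta> by (auto simp: C_def)
  have mod: "\<bar>v y - v x\<bar> \<le> e / 2 + C * (norm (y - x))\<^sup>2" if "x \<in> cball 0 1" "y \<in> cball 0 1" for x y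
  proof (cases "norm (y - x) < \<eta>")
    case True
    then have "\<bar>v y - v x\<bar> < e / 2" using \<eta>(2)[OF that] by (simp add: dist_norm)
    moreover have "C * (norm (y - x))\<^sup>2 \<ge> 0" using C by simp
    ultimately show ?thesis by linarith
  next
    case False
    then have "\<eta>\<^sup>2 \<le> (norm (y - x))\<^sup>2" using \<eta> by (intro power_mono) auto
    then have "C * \<eta>\<^sup>2 \<le> C * (norm (y - x))\<^sup>2" using C by (intro mult_left_mono) auto
    moreover have "C * \<eta>\<^sup>2 = 2 * K" using \<eta> by (simp add: C_def)
    ultimately show ?thesis using K(2)[OF that(1)] K(2)[OF that(2)] e by linarith
  qed
  \<comment> \<open>Since \<open>1 - norm z ^ 2 \<le> 2 * (1 - norm z)\<close>, the quadratic term
    integrates to at most \<open>2 * C * d < e / 2\<close>.\<close>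
  define d where "d = e / (4 * (C + 1))"
  have d: "d > 0" "2 * C * d < e / 2" using e C by (auto simp: d_def field_simps)
  show ?thesis
  proof
    show "d > 0" by (rule d)
    fix z :: complex assume z: "1 - d < norm z" "norm z < 1"
    have iv: "circ_integrable v"
      by (intro circ_integrable_continuous continuous_on_subset[OF cont]) auto
    have ip: "integrable circ (\<lambda>t. poisson z (cis t))"
      using integrable_circ_continuous[OF continuous_on_poisson_cis[OF z(2)]] .
    have "poisson_int v z - v z = (\<integral>t. poisson z (cis t) * v (cis t) \<partial>circ) - (\<integral>t. poisson z (cis t) * v z \<partial>circ)"
      by (simp add: poisson_int_eq poisson_mean[OF z(2)])
    also have "\<dots> = (\<integral>t. poisson z (cis t) * (v (cis t) - v z) \<partial>circ)"
      using integrable_poisson_mult[OF z(2) iv] ip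
      by (subst Bochner_Integration.integral_diff[symmetric]) (auto simp: right_diff_distrib)
    finally have "\<bar>poisson_int v z - v z\<bar> \<le> (\<integral>t. \<bar>poisson z (cis t) * (v (cis t) - v z)\<bar> \<partial>circ)"
      using integral_abs_bound by simp
    also have "\<dots> \<le> (\<integral>t. poisson z (cis t) * (e / 2) + C * (1 - (norm z)\<^sup>2) \<partial>circ)"
    proof (rule integral_mono)
      have "integrable circ (\<lambda>t. poisson z (cis t) * (v (cis t) - v z))"
        using integrable_poisson_mult[OF z(2) iv] ip by (simp add: right_diff_distrib)
      then show "integrable circ (\<lambda>t. \<bar>poisson z (cis t) * (v (cis t) - v z)\<bar>)" by (rule integrable_abs)
      show "integrable circ (\<lambda>t. poisson z (cis t) * (e / 2) + C * (1 - (norm z)\<^sup>2))" using ip by simp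
      fix t
      have "\<bar>poisson z (cis t) * (v (cis t) - v z)\<bar> = poisson z (cis t) * \<bar>v (cis t) - v z\<bar>"
        using poisson_nonneg[OF z(2)] by (simp add: abs_mult)
      also have "\<dots> \<le> poisson z (cis t) * (e / 2 + C * (norm (cis t - z))\<^sup>2)"
        using poisson_nonneg[OF z(2)] z by (intro mult_left_mono mod) auto
      also have "\<dots> = poisson z (cis t) * (e / 2) + C * (poisson z (cis t) * (norm (cis t - z))\<^sup>2)"
        by (simp add: algebra_simps)
      finally show "\<bar>poisson z (cis t) * (v (cis t) - v z)\<bar> \<le> poisson z (cis t) * (e / 2) + C * (1 - (norm z)\<^sup>2)"
        using poisson_mult_norm_sq[OF z(2), of "cis t"] by simp
    qed
    also have "\<dots> = e / 2 + C * (1 - (norm z)\<^sup>2)"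
      using ip by (simp add: poisson_mean[OF z(2)] circ.prob_space[unfolded space_circ])
    also have "\<dots> \<le> e / 2 + C * (2 * d)"
    proof -
      have "1 - (norm z)\<^sup>2 = (1 - norm z) * (1 + norm z)" by (simp add: algebra_simps power2_eq_square)
      also have "\<dots> \<le> d * 2" using z by (intro mult_mono) auto
      finally show ?thesis using C by (intro add_left_mono mult_left_mono) auto
    qed
    finally show "\<bar>poisson_int v z - v z\<bar> < e" using d by (simp add: mult.commute mult.left_commute)
  qed
qed

text \<open>Subharmonicity of \<open>ln |h|\<close>, by the maximum principle for
  \<open>u = h (r z) * exp (- herglotz v z)\<close>: near the unit circle \<open>v\<close> and its
  Poisson integral almost agree, so \<open>|u|\<close> is nearly at most 1. With
  \<open>logplus\<close> in place of \<open>ln\<close> the datum \<open>v\<close> is continuous even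
  at zeros of \<open>h\<close>.\<close>

lemma ln_norm_le_poisson_int:
  assumes hol: "h holomorphic_on ball 0 1" and r: "0 < r" "r < 1" and z: "norm z < 1"
    and nz: "h (of_real r * z) \<noteq> 0"
  shows "ln (norm (h (of_real r * z))) \<le> poisson_int (\<lambda>\<zeta>. logplus (norm (h (of_real r * \<zeta>)))) z"
proof -
  have im: "of_real r * u \<in> ball 0 1" if "norm u \<le> 1" for u :: complex
  proof -
    have "norm (of_real r * u) \<le> r * 1" using r that unfolding norm_mult by (intro mult_mono) auto
    then show ?thesis using r by simp
  qed
  have conth: "continuous_on (cball 0 1) (\<lambda>u. h (of_real r * u))"
    by (rule continuous_on_compose2[OF holomorphic_on_imp_continuous_on[OF hol]])
      (auto intro!: continuous_intros im[unfolded mem_ball_0] simp: dist_norm)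
  have holh: "(\<lambda>u. h (of_real r * u)) holomorphic_on ball 0 1"
    using holomorphic_on_compose_gen[of "\<lambda>u. of_real r * u" "ball 0 1" h "ball 0 1"] im hol
    by (auto simp: comp_def image_subset_iff intro!: holomorphic_intros)
  define v where "v = (\<lambda>\<zeta>. logplus (norm (h (of_real r * \<zeta>))))"
  have contv: "continuous_on (cball 0 1) v"
    unfolding v_def by (intro continuous_intros conth)
  have iv: "circ_integrable v"
    by (intro circ_integrable_continuous continuous_on_subset[OF contv]) auto
  define u where "u = (\<lambda>z. h (of_real r * z) * exp (- herglotz v z))"
  have holu: "u holomorphic_on ball 0 1"
    unfolding u_def by (intro holomorphic_intros holh herglotz_holomorphic iv)
  have nu: "norm (u y) = norm (h (of_real r * y)) * exp (- poisson_int v y)" if "norm y < 1" for y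
    using Re_herglotz[OF that iv] by (simp add: u_def norm_mult)
  have "ln (norm (h (of_real r * z))) \<le> poisson_int v z + e" if e: "e > 0" for e
  proof -
    obtain d where d: "d > 0" "\<And>z. 1 - d < norm z \<Longrightarrow> norm z < 1 \<Longrightarrow> \<bar>poisson_int v z - v z\<bar> < e"
      using poisson_int_approx[OF contv e] by blast
    obtain s where s: "max (norm z) (1 - d) < s" "s < 1"
      using dense[of "max (norm z) (1 - d)" 1] z d by auto
    have s0: "0 < s" using s le_less_trans[OF norm_ge_zero[of z]] by auto
    have "norm (u z) \<le> exp e"
    proof (rule maximum_modulus_frontier[of u "cball 0 s"])
      show "u holomorphic_on interior (cball 0 s)"
        using s by (intro holomorphic_on_subset[OF holu]) auto
      show "continuous_on (closure (cball 0 s)) u"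
        using s by (intro holomorphic_on_imp_continuous_on holomorphic_on_subset[OF holu]) auto
      show "z \<in> cball 0 s" using s by auto
      show "bounded (cball (0::complex) s)" by simp
      fix y assume "y \<in> frontier (cball (0::complex) s)"
      then have y: "norm y = s" using s0 by (simp add: frontier_cball)
      have "norm (h (of_real r * y)) \<le> exp (v y)"
        by (simp add: v_def logplus_eq)
      then have "norm (u y) \<le> exp (v y) * exp (- poisson_int v y)"
        using y s by (subst nu) auto
      also have "\<dots> = exp (v y - poisson_int v y)" by (simp add: exp_diff exp_minus field_simps)
      also have "\<dots> \<le> exp e" using d(2)[of y] y s by auto
      finally show "norm (u y) \<le> exp e" .
    qed
    then have "norm (h (of_real r * z)) * exp (- poisson_int v z) \<le> exp e" using nu[OF z] by simp
    then have "ln (norm (h (of_real r * z)) * exp (- poisson_int v z)) \<le> e"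
      using nz by (metis exp_gt_zero ln_exp ln_le_cancel_iff mult_pos_pos zero_less_norm_iff)
    then show ?thesis using nz by (simp add: ln_mult)
  qed
  then show ?thesis unfolding v_def by (rule field_le_epsilon)
qed

section \<open>Nontangential boundary values\<close>

text \<open>The shift by 2 keeps \<open>radius 0 = 1 / 2\<close> positive. A fixed sequence of radii
  lets Fatou's lemma and dominated convergence apply.\<close>

definition radius :: "nat \<Rightarrow> real" where
  "radius n = 1 - 1 / (real n + 2)"

lemma radius_bounds: "0 < radius n" "radius n < 1"
  by (auto simp: radius_def field_simps)

lemma radius_tendsto: "radius \<longlonglongrightarrow> 1"
proof -
  have "(\<lambda>n. 1 - 1 / (real n + 2)) \<longlonglongrightarrow> 1 - 0"
    by (intro tendsto_intros) real_asymp
  then show ?thesis by (simp add: radius_def[abs_def])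
qed

text \<open>On a radius the distance to \<open>\<zeta>\<close> equals \<open>1 - r\<close>, so radii
  lie in every Stolz region with \<open>\<alpha> > 1\<close>.\<close>

lemma filterlim_radial_stolz:
  assumes \<zeta>: "norm \<zeta> = 1" and \<alpha>: "\<alpha> > 1" and r: "r \<longlonglongrightarrow> 1" "\<And>n. 0 < r n" "\<And>n. r n < 1"
  shows "filterlim (\<lambda>n. complex_of_real (r n) * \<zeta>) (at \<zeta> within stolz \<alpha> \<zeta>) sequentially"
proof -
  have st: "of_real (r n) * \<zeta> \<in> stolz \<alpha> \<zeta>" for n
  proof -
    have "of_real (r n) * \<zeta> - \<zeta> = of_real (r n - 1) * \<zeta>" by (simp add: algebra_simps)
    then have "norm (of_real (r n) * \<zeta> - \<zeta>) = 1 - r n"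
      using \<zeta> r(3)[of n] by (simp add: norm_mult del: of_real_diff)
    moreover have "norm (of_real (r n) * \<zeta>) = r n" using \<zeta> r(2)[of n] by (simp add: norm_mult)
    moreover have "1 - r n < \<alpha> * (1 - r n)" using \<alpha> r(3)[of n] by simp
    ultimately show ?thesis using r(3)[of n] by (simp add: stolz_def)
  qed
  have "of_real (r n) * \<zeta> \<noteq> \<zeta>" for n
  proof
    assume "of_real (r n) * \<zeta> = \<zeta>"
    then have "norm (of_real (r n) * \<zeta>) = norm \<zeta>" by (rule arg_cong)
    then show False using \<zeta> r(2,3)[of n] by (simp add: norm_mult)
  qed
  moreover have "(\<lambda>n. complex_of_real (r n) * \<zeta>) \<longlonglongrightarrow> of_real 1 * \<zeta>"
    using r(1) by (intro tendsto_intros)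
  ultimately show ?thesis
    unfolding filterlim_at using st by auto
qed

lemma has_nt_limit_radial:
  assumes "has_nt_limit f \<zeta> L" "norm \<zeta> = 1" "r \<longlonglongrightarrow> 1" "\<And>n. 0 < r n" "\<And>n. r n < 1"
  shows "(\<lambda>n. f (complex_of_real (r n) * \<zeta>)) \<longlonglongrightarrow> L"
  using assms(1) filterlim_radial_stolz[OF assms(2) _ assms(3-5), of 2]
  unfolding has_nt_limit_def by (metis filterlim_compose one_less_numeral_iff semiring_norm(76))

text \<open>The choice made in \<open>bv\<close> is harmless: every nontangential limit is also the
  radial limit, which is unique.\<close>

lemma bv_eq:
  assumes "has_nt_limit f \<zeta> L" "norm \<zeta> = 1"
  shows "bv f \<zeta> = L"
proof -
  have "has_nt_limit f \<zeta> (bv f \<zeta>)"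
    using assms(1) unfolding bv_def by (metis someI)
  from has_nt_limit_radial[OF this assms(2) radius_tendsto radius_bounds]
    has_nt_limit_radial[OF assms radius_tendsto radius_bounds]
  show ?thesis by (rule LIMSEQ_unique)
qed

text \<open>Scheffe's argument: \<open>|X - Y| = X + Y - 2 * min X Y\<close>, and the minimum is
  dominated by \<open>Y\<close>, so convergence of the means becomes convergence in mean. For fixed
  \<open>z\<close> the Poisson kernel is bounded, so the Poisson integrals follow.\<close>

lemma tendsto_poisson_int_smirnov:
  assumes f: "f \<in> smirnov" and z: "norm z < 1"
  shows "(\<lambda>n. poisson_int (\<lambda>\<zeta>. logplus (norm (f (of_real (radius n) * \<zeta>)))) z)
           \<longlonglongrightarrow> poisson_int (\<lambda>\<zeta>. logplus (norm (bv f \<zeta>))) z"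
proof -
  define X where "X = (\<lambda>n t. logplus (norm (f (of_real (radius n) * cis t))))"
  define Y where "Y = (\<lambda>t. logplus (norm (bv f (cis t))))"
  have hol: "f holomorphic_on ball 0 1" and iY: "integrable circ Y"
    and lim: "((\<lambda>r. circ_mean (\<lambda>\<zeta>. logplus (norm (f (of_real r * \<zeta>))))) \<longlongrightarrow> circ_mean (\<lambda>\<zeta>. logplus (norm (bv f \<zeta>)))) (at_left 1)"
    using f by (auto simp: smirnov_def circ_integrable_iff Y_def)
  have contX: "continuous_on {0..2*pi} (X n)" for n
    unfolding X_def using radius_bounds[of n]
    by (intro continuous_intros continuous_on_compose2[OF holomorphic_on_imp_continuous_on[OF hol]])
      (auto simp: norm_mult)
  have iX: "integrable circ (X n)" for n
    by (rule integrable_circ_continuous[OF contX])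
  have "filterlim radius (at_left 1) sequentially"
    unfolding filterlim_at using radius_bounds radius_tendsto by (auto simp: less_imp_neq)
  from filterlim_compose[OF lim this]
  have limX: "(\<lambda>n. \<integral>t. X n t \<partial>circ) \<longlonglongrightarrow> (\<integral>t. Y t \<partial>circ)"
    by (simp add: X_def Y_def circ_mean_eq)
  \<comment> \<open>Where no nontangential limit exists, the junk value \<open>bv f = 0\<close> gives \<open>Y = 0\<close>,
    so the minimum converges everywhere.\<close>
  have limmin: "(\<lambda>n. \<integral>t. min (X n t) (Y t) \<partial>circ) \<longlonglongrightarrow> (\<integral>t. Y t \<partial>circ)"
  proof (rule integral_dominated_convergence[where w = Y])
    show "Y \<in> borel_measurable circ" "integrable circ Y" using iY by auto
    show "(\<lambda>t. min (X n t) (Y t)) \<in> borel_measurable circ" for n using iX iY by auto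
    show "AE t in circ. norm (min (X n t) (Y t)) \<le> Y t" for n by (auto simp: X_def Y_def)
    have "(\<lambda>n. min (X n t) (Y t)) \<longlonglongrightarrow> Y t" for t
    proof (cases "\<exists>L. has_nt_limit f (cis t) L")
      case True
      then obtain L where L: "has_nt_limit f (cis t) L" by blast
      have "(\<lambda>n. X n t) \<longlonglongrightarrow> Y t"
        unfolding X_def Y_def bv_eq[OF L norm_cis]
        by (intro tendsto_logplus_norm has_nt_limit_radial[OF L] radius_tendsto radius_bounds) auto
      then have "(\<lambda>n. min (X n t) (Y t)) \<longlonglongrightarrow> min (Y t) (Y t)" by (intro tendsto_intros)
      then show ?thesis by simp
    next
      case False
      then have "bv f (cis t) = 0" unfolding bv_def by (rule if_not_P)
      then have "Y t = 0" by (simp add: Y_def logplus_def)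
      then show ?thesis by (simp add: X_def min_absorb2)
    qed
    then show "AE t in circ. (\<lambda>n. min (X n t) (Y t)) \<longlonglongrightarrow> Y t" by simp
  qed
  have imin: "integrable circ (\<lambda>t. min (X n t) (Y t))" for n using iX iY by auto
  have "(\<lambda>n. (\<integral>t. X n t \<partial>circ) + (\<integral>t. Y t \<partial>circ) - 2 * (\<integral>t. min (X n t) (Y t) \<partial>circ)) \<longlonglongrightarrow> (\<integral>t. Y t \<partial>circ) + (\<integral>t. Y t \<partial>circ) - 2 * (\<integral>t. Y t \<partial>circ)"
    by (intro tendsto_intros limX limmin)
  moreover have "(\<integral>t. \<bar>X n t - Y t\<bar> \<partial>circ) = (\<integral>t. X n t \<partial>circ) + (\<integral>t. Y t \<partial>circ) - 2 * (\<integral>t. min (X n t) (Y t) \<partial>circ)" for n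
  proof -
    have "(\<integral>t. \<bar>X n t - Y t\<bar> \<partial>circ) = (\<integral>t. (X n t + Y t) - 2 * min (X n t) (Y t) \<partial>circ)"
      by (rule Bochner_Integration.integral_cong) (auto simp: min_def)
    also have "\<dots> = (\<integral>t. X n t + Y t \<partial>circ) - (\<integral>t. 2 * min (X n t) (Y t) \<partial>circ)"
      using iX iY imin by (intro Bochner_Integration.integral_diff) auto
    finally show ?thesis using iX iY by simp
  qed
  ultimately have L1: "(\<lambda>n. \<integral>t. \<bar>X n t - Y t\<bar> \<partial>circ) \<longlonglongrightarrow> 0" by simp
  define B where "B = (1 - (norm z)\<^sup>2) / (1 - norm z)\<^sup>2"
  have ip: "integrable circ (\<lambda>t. poisson z (cis t) * X n t)" "integrable circ (\<lambda>t. poisson z (cis t) * Y t)" for n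
    using integrable_poisson_mult[OF z, of "\<lambda>\<zeta>. logplus (norm (f (of_real (radius n) * \<zeta>)))"]
      integrable_poisson_mult[OF z, of "\<lambda>\<zeta>. logplus (norm (bv f \<zeta>))"] iX[of n] iY
    by (auto simp: circ_integrable_iff X_def Y_def)
  have "(\<lambda>n. (\<integral>t. poisson z (cis t) * X n t \<partial>circ) - (\<integral>t. poisson z (cis t) * Y t \<partial>circ)) \<longlonglongrightarrow> 0"
  proof (rule Lim_null_comparison)
    show "(\<lambda>n. B * (\<integral>t. \<bar>X n t - Y t\<bar> \<partial>circ)) \<longlonglongrightarrow> 0"
      using tendsto_mult_left[OF L1, of B] by simp
    show "\<forall>\<^sub>F n in sequentially. norm ((\<integral>t. poisson z (cis t) * X n t \<partial>circ) - (\<integral>t. poisson z (cis t) * Y t \<partial>circ)) \<le> B * (\<integral>t. \<bar>X n t - Y t\<bar> \<partial>circ)"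
    proof (intro always_eventually allI)
      fix n
      have "(\<integral>t. poisson z (cis t) * X n t \<partial>circ) - (\<integral>t. poisson z (cis t) * Y t \<partial>circ) = (\<integral>t. poisson z (cis t) * X n t - poisson z (cis t) * Y t \<partial>circ)"
        using ip by simp
      also have "\<bar>\<dots>\<bar> \<le> (\<integral>t. \<bar>poisson z (cis t) * X n t - poisson z (cis t) * Y t\<bar> \<partial>circ)"
        by (rule integral_abs_bound)
      also have "\<dots> \<le> (\<integral>t. B * \<bar>X n t - Y t\<bar> \<partial>circ)"
      proof (rule integral_mono)
        show "integrable circ (\<lambda>t. \<bar>poisson z (cis t) * X n t - poisson z (cis t) * Y t\<bar>)" using ip by auto
        show "integrable circ (\<lambda>t. B * \<bar>X n t - Y t\<bar>)" using iX iY by auto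
        fix t
        have "\<bar>poisson z (cis t) * X n t - poisson z (cis t) * Y t\<bar> = poisson z (cis t) * \<bar>X n t - Y t\<bar>"
          using poisson_nonneg[OF z] by (simp add: abs_mult right_diff_distrib[symmetric])
        also have "\<dots> \<le> B * \<bar>X n t - Y t\<bar>"
          using poisson_le[OF z, of "cis t"] by (intro mult_right_mono) (auto simp: B_def)
        finally show "\<bar>poisson z (cis t) * X n t - poisson z (cis t) * Y t\<bar> \<le> B * \<bar>X n t - Y t\<bar>" .
      qed
      finally show "norm ((\<integral>t. poisson z (cis t) * X n t \<partial>circ) - (\<integral>t. poisson z (cis t) * Y t \<partial>circ)) \<le> B * (\<integral>t. \<bar>X n t - Y t\<bar> \<partial>circ)"
        by simp
    qed
  qed
  then show ?thesis
    by (simp add: LIM_zero_iff poisson_int_eq X_def Y_def)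
qed

section \<open>Blaschke factors\<close>

lemma blaschke_denom_nonzero:
  assumes "norm a < 1" "norm z \<le> 1"
  shows "1 - cnj a * z \<noteq> 0"
proof
  assume "1 - cnj a * z = 0"
  then have "norm (cnj a * z) = 1" by (metis eq_iff_diff_eq_0 norm_one)
  then have "norm a * norm z = 1" by (simp add: norm_mult)
  moreover have "norm a * norm z \<le> norm a * 1" using assms by (intro mult_left_mono) auto
  ultimately show False using assms by simp
qed

lemma norm_blaschke_factor: "norm (blaschke_factor a z) = norm (a - z) / norm (1 - cnj a * z)"
  by (auto simp: blaschke_factor_def norm_mult norm_divide)

lemma blaschke_norm_identity:
  "(norm (1 - cnj a * z))\<^sup>2 - (norm (a - z))\<^sup>2 = (1 - (norm a)\<^sup>2) * (1 - (norm z)\<^sup>2)"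
  unfolding cmod_power2 by (simp add: power2_eq_square algebra_simps)

lemma one_minus_norm_blaschke_sq:
  assumes "norm a < 1" "norm z \<le> 1"
  shows "1 - (norm (blaschke_factor a z))\<^sup>2 = (1 - (norm a)\<^sup>2) * (1 - (norm z)\<^sup>2) / (norm (1 - cnj a * z))\<^sup>2"
  using blaschke_denom_nonzero[OF assms] blaschke_norm_identity[of a z]
  by (simp add: norm_blaschke_factor power_divide field_simps)

lemma norm_blaschke_factor_le_1:
  assumes "norm a < 1" "norm z \<le> 1"
  shows "norm (blaschke_factor a z) \<le> 1"
proof -
  have "0 \<le> 1 - (norm (blaschke_factor a z))\<^sup>2"
    unfolding one_minus_norm_blaschke_sq[OF assms] using assms by (auto simp: power_le_one)
  then show ?thesis by (simp add: abs_square_le_1)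
qed

lemma norm_blaschke_factor_sphere:
  assumes "norm a < 1" "norm z = 1"
  shows "norm (blaschke_factor a z) = 1"
proof -
  have "1 - (norm (blaschke_factor a z))\<^sup>2 = 0"
    using one_minus_norm_blaschke_sq[of a z] assms by simp
  then show ?thesis by (simp add: power2_eq_1_iff) (metis norm_ge_zero not_one_le_zero neg_0_le_iff_le)
qed

lemma norm_blaschke_factor_commute: "norm (blaschke_factor a z) = norm (blaschke_factor z a)"
proof -
  have "cnj (1 - cnj a * z) = 1 - cnj z * a" by (simp add: mult.commute)
  then have "norm (1 - cnj a * z) = norm (1 - cnj z * a)" by (metis complex_mod_cnj)
  then show ?thesis by (simp add: norm_blaschke_factor norm_minus_commute)
qed

lemma blaschke_factor_eq_0_iff:
  assumes "norm a < 1" "norm z \<le> 1"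
  shows "blaschke_factor a z = 0 \<longleftrightarrow> z = a"
  using blaschke_denom_nonzero[OF assms] by (auto simp: blaschke_factor_def)

lemma blaschke_factor_continuous: "norm a < 1 \<Longrightarrow> continuous_on (cball 0 1) (blaschke_factor a)"
  using blaschke_denom_nonzero[of a] unfolding blaschke_factor_def[abs_def]
  by (cases "a = 0") (auto intro!: continuous_intros)

lemma blaschke_factor_holomorphic: "norm a < 1 \<Longrightarrow> blaschke_factor a holomorphic_on ball 0 1"
  using blaschke_denom_nonzero[of a] unfolding blaschke_factor_def[abs_def]
  by (cases "a = 0") (auto intro!: holomorphic_intros)

lemma divide_blaschke_factor:
  assumes hol: "g holomorphic_on ball 0 1" and a: "norm a < 1" "g a = 0"
  shows "\<exists>h. h holomorphic_on ball 0 1 \<and> (\<forall>z\<in>ball 0 1. g z = h z * blaschke_factor a z)"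
proof -
  define q where "q = (\<lambda>z. if z = a then deriv g a else (g z - g a) / (z - a))"
  have q: "q holomorphic_on ball 0 1"
    unfolding q_def by (rule pole_lemma_open[OF hol]) auto
  have gq: "g z = q z * (z - a)" for z using a by (simp add: q_def)
  \<comment> \<open>Cancels the unimodular constant \<open>|a| / a\<close> and the sign of
    \<open>a - z\<close> in the Blaschke factor.\<close>
  define c where "c = (if a = 0 then 1 else - (a / of_real (norm a)))"
  have "g z = (q z * (c * (if a = 0 then 1 else 1 - cnj a * z))) * blaschke_factor a z" if "z \<in> ball 0 1" for z
    using blaschke_denom_nonzero[of a z] a that
    by (auto simp: gq c_def blaschke_factor_def field_simps)
  moreover have "(\<lambda>z. q z * (c * (if a = 0 then 1 else 1 - cnj a * z))) holomorphic_on ball 0 1"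
    by (cases "a = 0") (auto intro!: holomorphic_intros q)
  ultimately show ?thesis by blast
qed

lemma divide_blaschke_prod:
  assumes "finite F" "F \<subseteq> ball 0 1" and hol: "f holomorphic_on ball 0 1" and "\<forall>\<mu>\<in>F. f \<mu> = 0"
  shows "\<exists>g. g holomorphic_on ball 0 1 \<and> (\<forall>z\<in>ball 0 1. f z = g z * (\<Prod>\<mu>\<in>F. blaschke_factor \<mu> z))"
  using assms(1,2,4)
proof (induction F)
  case empty
  then show ?case using hol by auto
next
  case (insert a F)
  then obtain g where g: "g holomorphic_on ball 0 1" "\<forall>z\<in>ball 0 1. f z = g z * (\<Prod>\<mu>\<in>F. blaschke_factor \<mu> z)"
    by auto
  \<comment> \<open>The factors of \<open>F\<close> vanish only at points of \<open>F\<close>, so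
    the zero of \<open>f\<close> at the new point \<open>a\<close> is inherited by the quotient
    \<open>g\<close>.\<close>
  have "(\<Prod>\<mu>\<in>F. blaschke_factor \<mu> a) \<noteq> 0"
  proof (subst prod_zero_iff[OF insert.hyps(1)], safe)
    fix b assume b: "b \<in> F" "blaschke_factor b a = 0"
    then have "a = b" using insert.prems by (subst (asm) blaschke_factor_eq_0_iff) auto
    then show False using b insert.hyps by simp
  qed
  then have "g a = 0" using g(2) insert.prems by auto
  moreover have "norm a < 1" using insert.prems by auto
  ultimately obtain h where "h holomorphic_on ball 0 1" "\<forall>z\<in>ball 0 1. g z = h z * blaschke_factor a z"
    using divide_blaschke_factor[OF g(1)] by blast
  then show ?case using g insert.hyps by (auto intro!: exI[of _ h])
qed

text \<open>The Green function of the disc, called \<open>k\<close> in the overview. On the diagonal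
  the convention \<open>ln 0 = 0\<close> gives the value 0 instead of infinity.\<close>

definition bk :: "complex \<Rightarrow> complex \<Rightarrow> real" where
  "bk z \<mu> = - ln (norm (blaschke_factor \<mu> z))"

lemma bk_nonneg: "norm z < 1 \<Longrightarrow> norm \<mu> < 1 \<Longrightarrow> 0 \<le> bk z \<mu>"
  using norm_blaschke_factor_le_1[of \<mu> z] by (cases "blaschke_factor \<mu> z = 0") (auto simp: bk_def)

lemma bk_commute: "bk z \<mu> = bk \<mu> z"
  by (simp add: bk_def norm_blaschke_factor_commute)

lemma sum_bk_eq:
  assumes "finite F" "F \<subseteq> ball 0 1" "norm z < 1" "z \<notin> F"
  shows "(\<Sum>\<mu>\<in>F. bk z \<mu>) = - ln (norm (\<Prod>\<mu>\<in>F. blaschke_factor \<mu> z))"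
proof -
  have "norm (blaschke_factor \<mu> z) > 0" if "\<mu> \<in> F" for \<mu>
    using assms that by (auto simp: blaschke_factor_eq_0_iff subset_iff)
  then show ?thesis
    using assms(1) by (simp add: bk_def prod_norm[symmetric] ln_prod sum_negf)
qed

text \<open>Jensen's inequality with zeros: the quotient \<open>g\<close> of \<open>f\<close> by the
  finite Blaschke product \<open>B\<close> has almost the same modulus as \<open>f\<close> near the
  circle, because \<open>|B|\<close> is uniformly continuous and equals 1 there. The bound for
  \<open>g\<close> at \<open>z\<close> then gains \<open>- ln |B z|\<close>, the sum of the
  \<open>bk z \<mu>\<close>.\<close>

lemma smirnov_zeros_bound:
  assumes f: "f \<in> smirnov" and F: "finite F" "F \<subseteq> ball 0 1" "\<forall>\<mu>\<in>F. f \<mu> = 0"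
    and z: "norm z < 1" "f z \<noteq> 0"
  shows "ln (norm (f z)) + (\<Sum>\<mu>\<in>F. bk z \<mu>) \<le> poisson_int (\<lambda>\<zeta>. logplus (norm (bv f \<zeta>))) z"
proof -
  have hol: "f holomorphic_on ball 0 1" using f by (simp add: smirnov_def)
  define B where "B = (\<lambda>z. \<Prod>\<mu>\<in>F. blaschke_factor \<mu> z)"
  obtain g where g: "g holomorphic_on ball 0 1" "\<And>z. z \<in> ball 0 1 \<Longrightarrow> f z = g z * B z"
    using divide_blaschke_prod[OF F(1,2) hol F(3)] unfolding B_def by blast
  have contB: "continuous_on (cball 0 1) (\<lambda>z. norm (B z))"
    unfolding B_def using F by (intro continuous_intros continuous_on_subset[OF blaschke_factor_continuous]) auto
  have B1: "norm (B \<zeta>) = 1" if "norm \<zeta> = 1" for \<zeta>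
    unfolding B_def prod_norm[symmetric] using that F(2)
    by (intro prod.neutral ballI norm_blaschke_factor_sphere) auto
  have gz: "g z \<noteq> 0" "B z \<noteq> 0" using g(2)[of z] z by auto
  have contg: "isCont g z"
    using g(1) z by (metis continuous_on_eq_continuous_at holomorphic_on_imp_continuous_on mem_ball_0 open_ball)
  \<comment> \<open>\<open>ln_norm_le_poisson_int\<close> bounds \<open>g\<close> at
    \<open>r * z\<close> through data on the circle of radius \<open>r\<close>; both sides are taken
    to the limit as \<open>r\<close> tends to 1.\<close>
  define Z where "Z = (\<lambda>n. of_real (radius n) * z)"
  have "Z \<longlonglongrightarrow> of_real 1 * z" unfolding Z_def by (intro tendsto_intros radius_tendsto)
  then have limg: "(\<lambda>n. g (Z n)) \<longlonglongrightarrow> g z" using contg isCont_tendsto_compose by force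
  then have limlng: "(\<lambda>n. ln (norm (g (Z n)))) \<longlonglongrightarrow> ln (norm (g z))"
    using gz by (intro tendsto_intros) auto
  have "ln (norm (g z)) \<le> poisson_int (\<lambda>\<zeta>. logplus (norm (bv f \<zeta>))) z + e" if e: "e > 0" for e
  proof -
    have "uniformly_continuous_on (cball 0 1) (\<lambda>z. norm (B z))"
      by (rule compact_uniformly_continuous[OF contB]) simp
    \<comment> \<open>A deviation of \<open>|B|\<close> from 1 below \<open>1 - exp (- e)\<close>
      costs at most \<open>e\<close> in the logarithm.\<close>
    moreover have pos: "1 - exp (- e) > 0" using e by simp
    ultimately obtain d where d: "d > 0" "\<And>x y. x \<in> cball 0 1 \<Longrightarrow> y \<in> cball 0 1 \<Longrightarrow> dist y x < d \<Longrightarrow> dist (norm (B y)) (norm (B x)) < 1 - exp (- e)"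
      unfolding uniformly_continuous_on_def by metis
    have "eventually (\<lambda>n. dist (radius n) 1 < d) sequentially"
      using tendstoD[OF radius_tendsto d(1)] .
    moreover have "eventually (\<lambda>n. g (Z n) \<noteq> 0) sequentially"
      using tendsto_imp_eventually_ne[OF limg gz(1)] .
    ultimately have ev: "eventually (\<lambda>n. ln (norm (g (Z n))) \<le> poisson_int (\<lambda>\<zeta>. logplus (norm (f (of_real (radius n) * \<zeta>)))) z + e) sequentially"
    proof eventually_elim
      case (elim n)
      note rn = radius_bounds[of n]
      have inb: "of_real (radius n) * cis t \<in> ball 0 1" for t using rn by (simp add: norm_mult)
      have intg: "circ_integrable (\<lambda>\<zeta>. logplus (norm (h (of_real (radius n) * \<zeta>))))" if "h holomorphic_on ball 0 1" for h
        using rn by (intro circ_integrable_continuous continuous_intros continuous_on_compose2[OF holomorphic_on_imp_continuous_on[OF that]])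
          (auto simp: norm_mult)
      have le: "logplus (norm (g (of_real (radius n) * cis t))) \<le> logplus (norm (f (of_real (radius n) * cis t))) + e" for t
      proof -
        let ?y = "of_real (radius n) * cis t"
        have "?y - cis t = of_real (radius n - 1) * cis t" by (simp add: algebra_simps)
        then have "dist ?y (cis t) = 1 - radius n" using rn by (simp add: dist_norm norm_mult del: of_real_diff)
        then have "dist (norm (B ?y)) (norm (B (cis t))) < 1 - exp (- e)"
          using elim(1) rn inb[of t] by (intro d(2)) (auto simp: dist_real_def)
        then have "norm (B ?y) > exp (- e)" using B1[of "cis t"] by (auto simp: dist_real_def)
        then have "norm (g ?y) * exp (- e) \<le> norm (f ?y)"
          unfolding g(2)[OF inb] norm_mult by (intro mult_left_mono) auto
        then have "norm (g ?y) \<le> norm (f ?y) * exp e" by (simp add: exp_minus field_simps)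
        then have "logplus (norm (g ?y)) \<le> logplus (norm (f ?y) * exp e)" by (intro logplus_mono) auto
        also have "\<dots> \<le> logplus (norm (f ?y)) + logplus (exp e)" by (intro logplus_mult_le) auto
        finally show ?thesis using e by (simp add: logplus_exp)
      qed
      have "ln (norm (g (Z n))) \<le> poisson_int (\<lambda>\<zeta>. logplus (norm (g (of_real (radius n) * \<zeta>)))) z"
        unfolding Z_def using elim(2) g(1) rn z(1) by (intro ln_norm_le_poisson_int) (auto simp: Z_def)
      also have "\<dots> \<le> poisson_int (\<lambda>\<zeta>. logplus (norm (f (of_real (radius n) * \<zeta>))) + e) z"
        using le intg[OF g(1)] intg[OF hol] z by (intro poisson_int_mono) (auto simp: circ_integrable_iff)
      also have "\<dots> = poisson_int (\<lambda>\<zeta>. logplus (norm (f (of_real (radius n) * \<zeta>)))) z + e"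
        using intg[OF hol] z by (subst poisson_int_add) (auto simp: circ_integrable_iff poisson_int_const)
      finally show ?case .
    qed
    show ?thesis
      by (rule tendsto_le[OF _ _ limlng ev])
        (auto intro!: tendsto_intros tendsto_poisson_int_smirnov f z)
  qed
  then have main: "ln (norm (g z)) \<le> poisson_int (\<lambda>\<zeta>. logplus (norm (bv f \<zeta>))) z"
    by (rule field_le_epsilon)
  have zF: "z \<notin> F" using F z by auto
  have "ln (norm (f z)) = ln (norm (g z)) + ln (norm (B z))"
    using g(2)[of z] gz z by (simp add: norm_mult ln_mult)
  then show ?thesis using main sum_bk_eq[OF F(1,2) z(1) zF] by (simp add: B_def)
qed

section \<open>Compactness of Orlicz balls\<close>

text \<open>Instantiated twice: by \<open>\<phi>\<close> itself, for the equivalence of (a), (b) and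
  (c), and by the modified Young function, for the dual condition.\<close>

locale superlinear_convex =
  fixes \<rho> :: "real \<Rightarrow> real"
  assumes cont: "continuous_on UNIV \<rho>"
    and conv: "convex_on {0..} \<rho>"
    and nonneg: "0 \<le> \<rho> t"
    and superlinear: "filterlim (\<lambda>t. \<rho> t / t) at_top at_top"
begin

lemma measurable [measurable]: "\<rho> \<in> borel_measurable borel"
  using cont by (rule borel_measurable_continuous_onI)

text \<open>The quantitative form of superlinearity behind uniform integrability: the part of
  \<open>t\<close> above the level \<open>T\<close> costs at most
  \<open>e * \<rho> t\<close>.\<close>

lemma linear_bound:
  assumes "e > 0"
  obtains T where "T > 0" "\<And>t. 0 \<le> t \<Longrightarrow> t \<le> min t T + e * \<rho> t"
proof -
  have "eventually (\<lambda>t. \<rho> t / t \<ge> 1 / e) at_top"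
    using superlinear by (simp add: filterlim_at_top)
  then obtain T where T: "\<And>t. t \<ge> T \<Longrightarrow> \<rho> t / t \<ge> 1 / e" by (auto simp: eventually_at_top_linorder)
  show ?thesis
  proof
    show "max T 1 > 0" by simp
    fix t :: real assume "0 \<le> t"
    show "t \<le> min t (max T 1) + e * \<rho> t"
    proof (cases "t \<le> max T 1")
      case True then show ?thesis using nonneg[of t] assms by simp
    next
      case False
      then have "\<rho> t / t \<ge> 1 / e" "t > 0" using T[of t] by auto
      then have "t \<le> e * \<rho> t" using assms by (simp add: field_simps)
      then show ?thesis using False by simp
    qed
  qed
qed

lemma integrable_of_integrable_Young:
  assumes "finite_measure M" "X \<in> borel_measurable M" "\<And>t. 0 \<le> X t" "integrable M (\<lambda>t. \<rho> (X t))"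
  shows "integrable M X"
proof -
  interpret finite_measure M by fact
  obtain T where T: "T > 0" "\<And>t. 0 \<le> t \<Longrightarrow> t \<le> min t T + 1 * \<rho> t"
    using linear_bound[of 1] by auto
  show ?thesis
  proof (rule Bochner_Integration.integrable_bound)
    show "integrable M (\<lambda>t. T + \<rho> (X t))" using assms(4) by simp
    show "AE t in M. norm (X t) \<le> norm (T + \<rho> (X t))"
      using T assms(3) nonneg by (intro AE_I2) (smt (verit) min.cobounded2 real_norm_def)
  qed fact
qed

text \<open>Fatou's lemma gives the first two claims. For the third, truncation at a level
  \<open>T\<close> changes each integral by at most \<open>B * \<delta> * K\<close>, uniformly in
  \<open>n\<close>, and the truncated integrals converge by dominated convergence. The weight
  \<open>h\<close> is meant to be a Poisson kernel or the constant 1.\<close>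

lemma convergence_of_bounded_Young:
  assumes M: "prob_space M" and X: "\<And>n. X n \<in> borel_measurable M" "\<And>n t. 0 \<le> X n t"
    and Y: "Y \<in> borel_measurable M" "\<And>t. 0 \<le> Y t"
    and lim: "AE t in M. (\<lambda>n. X n t) \<longlonglongrightarrow> Y t"
    and int: "\<And>n. integrable M (\<lambda>t. \<rho> (X n t))" "\<And>n. (\<integral>t. \<rho> (X n t) \<partial>M) \<le> K"
  shows "integrable M (\<lambda>t. \<rho> (Y t))" "(\<integral>t. \<rho> (Y t) \<partial>M) \<le> K"
    and "\<And>h B. h \<in> borel_measurable M \<Longrightarrow> (\<And>t. t \<in> space M \<Longrightarrow> 0 \<le> h t \<and> h t \<le> B) \<Longrightarrow>
      (\<lambda>n. \<integral>t. h t * X n t \<partial>M) \<longlonglongrightarrow> (\<integral>t. h t * Y t \<partial>M)"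
proof -
  interpret prob_space M by fact
  note [measurable] = X(1) Y(1)
  have K: "0 \<le> K"
    using int(2)[of 0] nonneg by (smt (verit) integral_nonneg_AE AE_I2)
  have "(\<integral>\<^sup>+t. ennreal (\<rho> (Y t)) \<partial>M) = (\<integral>\<^sup>+t. liminf (\<lambda>n. ennreal (\<rho> (X n t))) \<partial>M)"
  proof (rule nn_integral_cong_AE)
    show "AE t in M. ennreal (\<rho> (Y t)) = liminf (\<lambda>n. ennreal (\<rho> (X n t)))"
      using lim
    proof eventually_elim
      case (elim t)
      have "(\<lambda>n. \<rho> (X n t)) \<longlonglongrightarrow> \<rho> (Y t)"
        using elim cont by (metis continuous_on_eq_continuous_at isCont_tendsto_compose open_UNIV UNIV_I)
      then have "(\<lambda>n. ennreal (\<rho> (X n t))) \<longlonglongrightarrow> ennreal (\<rho> (Y t))" by (rule tendsto_ennrealI)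
      then show ?case by (intro lim_imp_Liminf[symmetric]) auto
    qed
  qed
  also have "\<dots> \<le> liminf (\<lambda>n. \<integral>\<^sup>+t. ennreal (\<rho> (X n t)) \<partial>M)"
    by (rule nn_integral_liminf) measurable
  also have "\<dots> \<le> ennreal K"
  proof (rule Liminf_le[OF sequentially_bot], rule always_eventually, rule allI)
    show "(\<integral>\<^sup>+t. ennreal (\<rho> (X n t)) \<partial>M) \<le> ennreal K" for n
      using int(2)[of n] nonneg by (subst nn_integral_eq_integral[OF int(1)]) (auto intro: ennreal_leI)
  qed
  finally have fat: "(\<integral>\<^sup>+t. ennreal (\<rho> (Y t)) \<partial>M) \<le> ennreal K" .
  show iY: "integrable M (\<lambda>t. \<rho> (Y t))"
    using fat nonneg by (intro integrableI_nonneg) (auto simp: order_le_less_trans)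
  show KY: "(\<integral>t. \<rho> (Y t) \<partial>M) \<le> K"
    using fat K by (subst (asm) nn_integral_eq_integral[OF iY]) (auto simp: nonneg)
  fix h :: "'a \<Rightarrow> real" and B
  assume h[measurable]: "h \<in> borel_measurable M" and B: "\<And>t. t \<in> space M \<Longrightarrow> 0 \<le> h t \<and> h t \<le> B"
  obtain t0 where "t0 \<in> space M" using not_empty by blast
  then have B0: "0 \<le> B" using B[of t0] by linarith
  have iXn: "integrable M (X n)" for n
    by (rule integrable_of_integrable_Young[OF finite_measure_axioms X int(1)])
  have iYn: "integrable M Y"
    by (rule integrable_of_integrable_Young[OF finite_measure_axioms Y iY])
  have ihm: "integrable M (\<lambda>t. h t * u t)" if "integrable M u" "\<And>t. 0 \<le> u t" for u
  proof (rule Bochner_Integration.integrable_bound[where f = "\<lambda>t. B * u t"])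
    show "integrable M (\<lambda>t. B * u t)" using that by simp
    show "(\<lambda>t. h t * u t) \<in> borel_measurable M" using that by simp
    show "AE t in M. norm (h t * u t) \<le> norm (B * u t)"
      using B that B0 by (intro AE_I2) (auto simp: abs_mult intro!: mult_right_mono)
  qed
  show "(\<lambda>n. \<integral>t. h t * X n t \<partial>M) \<longlonglongrightarrow> (\<integral>t. h t * Y t \<partial>M)"
  proof (rule LIMSEQ_I)
    fix e :: real assume e: "e > 0"
    \<comment> \<open>Keeps the truncation error below a third of \<open>e\<close>; the
      \<open>+ 1\<close> covers the case \<open>B * K = 0\<close>.\<close>
    define \<delta> where "\<delta> = e / (4 * (B * K + 1))"
    have \<delta>: "\<delta> > 0" "B * (\<delta> * K) < e / 3"
    proof -
      have BK: "B * K \<ge> 0" using B0 K by simp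
      then show "\<delta> > 0" using e by (simp add: \<delta>_def)
      have "B * (\<delta> * K) = e * (B * K / (4 * (B * K + 1)))" by (simp add: \<delta>_def)
      also have "\<dots> < e * (1/3)" using BK e by (intro mult_strict_left_mono) (auto simp: divide_simps)
      finally show "B * (\<delta> * K) < e / 3" by simp
    qed
    obtain T where T: "T > 0" "\<And>t. 0 \<le> t \<Longrightarrow> t \<le> min t T + \<delta> * \<rho> t"
      using linear_bound[OF \<delta>(1)] by blast
    have trunc: "(\<integral>t. h t * min (u t) T \<partial>M) \<le> (\<integral>t. h t * u t \<partial>M) \<and>
        (\<integral>t. h t * u t \<partial>M) \<le> (\<integral>t. h t * min (u t) T \<partial>M) + B * (\<delta> * K)"
      if u: "integrable M u" "\<And>t. 0 \<le> u t" "integrable M (\<lambda>t. \<rho> (u t))" "(\<integral>t. \<rho> (u t) \<partial>M) \<le> K" for u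
    proof
      have im: "integrable M (\<lambda>t. h t * min (u t) T)" using u T by (intro ihm) auto
      show "(\<integral>t. h t * min (u t) T \<partial>M) \<le> (\<integral>t. h t * u t \<partial>M)"
        using B u by (intro integral_mono im ihm mult_left_mono) auto
      have "(\<integral>t. h t * u t \<partial>M) \<le> (\<integral>t. h t * min (u t) T + B * (\<delta> * \<rho> (u t)) \<partial>M)"
      proof (rule integral_mono)
        show "integrable M (\<lambda>t. h t * u t)" using u by (intro ihm) auto
        show "integrable M (\<lambda>t. h t * min (u t) T + B * (\<delta> * \<rho> (u t)))" using im u by auto
        fix t assume t: "t \<in> space M"
        have "h t * u t \<le> h t * (min (u t) T + \<delta> * \<rho> (u t))"
          using B[OF t] T(2)[OF u(2)[of t]] by (intro mult_left_mono) auto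
        also have "\<dots> = h t * min (u t) T + h t * (\<delta> * \<rho> (u t))" by (simp add: algebra_simps)
        also have "h t * (\<delta> * \<rho> (u t)) \<le> B * (\<delta> * \<rho> (u t))"
          using B[OF t] \<delta> nonneg by (intro mult_right_mono) auto
        finally show "h t * u t \<le> h t * min (u t) T + B * (\<delta> * \<rho> (u t))" by simp
      qed
      also have "\<dots> = (\<integral>t. h t * min (u t) T \<partial>M) + B * (\<delta> * (\<integral>t. \<rho> (u t) \<partial>M))"
        using im u(3) by simp
      also have "\<dots> \<le> (\<integral>t. h t * min (u t) T \<partial>M) + B * (\<delta> * K)"
        using B0 \<delta> u(4) by (intro add_left_mono mult_left_mono) auto
      finally show "(\<integral>t. h t * u t \<partial>M) \<le> (\<integral>t. h t * min (u t) T \<partial>M) + B * (\<delta> * K)" .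
    qed
    have "(\<lambda>n. \<integral>t. h t * min (X n t) T \<partial>M) \<longlonglongrightarrow> (\<integral>t. h t * min (Y t) T \<partial>M)"
    proof (rule integral_dominated_convergence[where w = "\<lambda>_. B * T"])
      show "AE t in M. (\<lambda>n. h t * min (X n t) T) \<longlonglongrightarrow> h t * min (Y t) T"
        using lim by eventually_elim (intro tendsto_intros)
      show "AE t in M. norm (h t * min (X n t) T) \<le> B * T" for n
        using B X T B0 by (intro AE_I2) (auto simp: abs_mult intro!: mult_mono)
    qed auto
    from LIMSEQ_D[OF this, of "e/3"] e obtain N where
      N: "\<And>n. n \<ge> N \<Longrightarrow> norm ((\<integral>t. h t * min (X n t) T \<partial>M) - (\<integral>t. h t * min (Y t) T \<partial>M)) < e / 3"
      by auto
    show "\<exists>N. \<forall>n\<ge>N. norm ((\<integral>t. h t * X n t \<partial>M) - (\<integral>t. h t * Y t \<partial>M)) < e"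
    proof (intro exI allI impI)
      fix n assume "n \<ge> N"
      then show "norm ((\<integral>t. h t * X n t \<partial>M) - (\<integral>t. h t * Y t \<partial>M)) < e"
        using N[of n] trunc[OF iXn X(2) int(1,2), of n] trunc[OF iYn Y(2) iY KY] \<delta>(2)
        unfolding real_norm_def by linarith
    qed
  qed
qed

end

text \<open>A ball for the modular rather than for a norm: it is convex whenever
  \<open>\<rho>\<close> is, and Fatou's lemma handles its limits directly.\<close>

definition orlicz_ball :: "(real \<Rightarrow> real) \<Rightarrow> real \<Rightarrow> (complex \<Rightarrow> real) set" where
  "orlicz_ball \<rho> N = {w. (\<forall>\<zeta>. 0 \<le> w \<zeta>) \<and> (\<lambda>t. w (cis t)) \<in> borel_measurable circ \<and>
      integrable circ (\<lambda>t. \<rho> (w (cis t))) \<and> (\<integral>t. \<rho> (w (cis t)) \<partial>circ) \<le> N}"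

text \<open>Dyadic convex combinations of the tails of a sequence; only midpoints are ever formed.\<close>

inductive_set tail_hull :: "(nat \<Rightarrow> complex \<Rightarrow> real) \<Rightarrow> nat \<Rightarrow> (complex \<Rightarrow> real) set"
  for w n where
    base: "i \<ge> n \<Longrightarrow> w i \<in> tail_hull w n"
  | mid: "u \<in> tail_hull w n \<Longrightarrow> v \<in> tail_hull w n \<Longrightarrow> (\<lambda>\<zeta>. (u \<zeta> + v \<zeta>) / 2) \<in> tail_hull w n"

lemma tail_hull_antimono:
  assumes "n \<le> m" "u \<in> tail_hull w m"
  shows "u \<in> tail_hull w n"
  using assms(2)
proof induction
  case (base i)
  then show ?case using assms(1) by (intro tail_hull.base) simp
next
  case (mid u v)
  then show ?case by (intro tail_hull.mid)
qed

context superlinear_convex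
begin

lemma orlicz_ball_circ_integrable:
  assumes "w \<in> orlicz_ball \<rho> N"
  shows "circ_integrable w"
  unfolding circ_integrable_iff
  by (rule integrable_of_integrable_Young[OF circ.finite_measure_axioms])
    (use assms in \<open>auto simp: orlicz_ball_def\<close>)

lemma orlicz_ball_convex:
  assumes u: "u \<in> orlicz_ball \<rho> N" and v: "v \<in> orlicz_ball \<rho> N" and s: "0 \<le> s" "s \<le> 1"
  shows "(\<lambda>\<zeta>. (1 - s) * u \<zeta> + s * v \<zeta>) \<in> orlicz_ball \<rho> N"
proof -
  have iu: "integrable circ (\<lambda>t. \<rho> (u (cis t)))" and iv: "integrable circ (\<lambda>t. \<rho> (v (cis t)))"
    and mu[measurable]: "(\<lambda>t. u (cis t)) \<in> borel_measurable circ" "(\<lambda>t. v (cis t)) \<in> borel_measurable circ"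
    using u v by (auto simp: orlicz_ball_def)
  have le: "\<rho> ((1 - s) * u \<zeta> + s * v \<zeta>) \<le> (1 - s) * \<rho> (u \<zeta>) + s * \<rho> (v \<zeta>)" for \<zeta>
    using convex_onD[OF conv s, of "u \<zeta>" "v \<zeta>"] u v by (auto simp: orlicz_ball_def)
  have i1: "integrable circ (\<lambda>t. (1 - s) * \<rho> (u (cis t)) + s * \<rho> (v (cis t)))" using iu iv by simp
  have i2: "integrable circ (\<lambda>t. \<rho> ((1 - s) * u (cis t) + s * v (cis t)))"
    by (rule Bochner_Integration.integrable_bound[OF i1]) (use le nonneg in \<open>auto intro!: AE_I2 order.trans[OF _ abs_ge_self]\<close>)
  have "(\<integral>t. \<rho> ((1 - s) * u (cis t) + s * v (cis t)) \<partial>circ) \<le> (\<integral>t. (1 - s) * \<rho> (u (cis t)) + s * \<rho> (v (cis t)) \<partial>circ)"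
    using le by (intro integral_mono i1 i2) auto
  also have "\<dots> = (1 - s) * (\<integral>t. \<rho> (u (cis t)) \<partial>circ) + s * (\<integral>t. \<rho> (v (cis t)) \<partial>circ)"
    using iu iv by simp
  also have "\<dots> \<le> (1 - s) * N + s * N"
    using u v s by (intro add_mono mult_left_mono) (auto simp: orlicz_ball_def)
  finally have "(\<integral>t. \<rho> ((1 - s) * u (cis t) + s * v (cis t)) \<partial>circ) \<le> N" by (simp add: algebra_simps)
  then show ?thesis using i2 u v s by (auto simp: orlicz_ball_def)
qed

lemma tail_hull_orlicz_ball:
  assumes "\<And>n. w n \<in> orlicz_ball \<rho> N" "u \<in> tail_hull w n"
  shows "u \<in> orlicz_ball \<rho> N"
  using assms(2)
proof induction
  case (base i)
  then show ?case using assms by simp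
next
  case (mid u v)
  then show ?case using orlicz_ball_convex[of u N v "1/2"] by (simp add: add_divide_distrib)
qed

text \<open>Near-minimisers of the strictly convex functional \<open>v \<mapsto> \<integral> exp (- v)\<close> over the tail hulls
  converge almost everywhere along a subsequence; the superlinearity of \<open>\<rho>\<close> upgrades this to
  convergence of the Poisson integrals.\<close>

proposition orlicz_ball_compact:
  assumes w: "\<And>n. w n \<in> orlicz_ball \<rho> N"
  obtains v where "v \<in> orlicz_ball \<rho> N"
    "\<And>z s. norm z < 1 \<Longrightarrow> eventually (\<lambda>n. s \<le> poisson_int (w n) z) sequentially \<Longrightarrow> s \<le> poisson_int v z"
proof -
  define E where "E = (\<lambda>v::complex \<Rightarrow> real. \<integral>t. exp (- v (cis t)) \<partial>circ)"
  define J where "J = (\<lambda>n. Inf (E ` tail_hull w n))"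
  have ball: "u \<in> orlicz_ball \<rho> N" if "u \<in> tail_hull w n" for u n
    using tail_hull_orlicz_ball[OF w that] .
  have meas: "(\<lambda>t. u (cis t)) \<in> borel_measurable circ" if "u \<in> orlicz_ball \<rho> N" for u
    using that by (simp add: orlicz_ball_def)
  have pos: "0 \<le> u \<zeta>" if "u \<in> orlicz_ball \<rho> N" for u \<zeta> using that by (simp add: orlicz_ball_def)
  have iexp: "integrable circ (\<lambda>t. exp (- u (cis t)))" if "u \<in> orlicz_ball \<rho> N" for u
    using pos[OF that] meas[OF that] by (intro circ.integrable_const_bound[where B = 1]) auto
  have E0: "0 \<le> E u" for u unfolding E_def by (intro integral_nonneg_AE) auto
  have E1: "E u \<le> 1" if "u \<in> orlicz_ball \<rho> N" for u
  proof -
    have "E u \<le> (\<integral>t. 1 \<partial>circ)" unfolding E_def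
      using pos[OF that] by (intro integral_mono iexp that) auto
    then show ?thesis by (simp add: circ.prob_space[unfolded space_circ])
  qed
  have bdd: "bdd_below (E ` tail_hull w n)" for n using E0 by (auto intro!: bdd_belowI)
  have ne: "tail_hull w n \<noteq> {}" for n using tail_hull.base[of n n w] by auto
  have J_le: "J n \<le> E u" if "u \<in> tail_hull w n" for n u
    unfolding J_def using bdd that by (intro cInf_lower) auto
  have "incseq J"
    unfolding incseq_def J_def using ne bdd tail_hull_antimono[of _ _ _ w]
    by (intro allI impI cInf_superset_mono) auto
  moreover have "J n \<le> 1" for n
    using J_le[OF tail_hull.base[of n n w]] E1[OF w[of n]] by auto
  ultimately obtain L where L: "J \<longlonglongrightarrow> L" "\<And>n. J n \<le> L"
    using incseq_convergent[of J 1] by blast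
  have "\<exists>u\<in>tail_hull w n. E u < J n + 1 / (real n + 1)" for n
    using cInf_lessD[of "E ` tail_hull w n" "J n + 1 / (real n + 1)"] ne by (auto simp: J_def)
  then obtain V where V: "\<And>n. V n \<in> tail_hull w n" "\<And>n. E (V n) < J n + 1 / (real n + 1)" by metis
  \<comment> \<open>For these square roots of \<open>exp (- V n)\<close> the expression
    \<open>(g n - g m)\<^sup>2\<close> is exactly the midpoint defect of \<open>exp (- v)\<close>,
    so near-minimality makes them Cauchy in mean square.\<close>
  define g where "g = (\<lambda>n t. exp (- V n (cis t) / 2))"
  \<comment> \<open>Bounds \<open>E (V n) + E (V m) - 2 * E mid\<close> for
    \<open>n \<le> m\<close>: the midpoint lies in the hull of the tail from \<open>n\<close>, so
    \<open>E mid \<ge> J n\<close>, while \<open>J m \<le> L\<close>.\<close>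
  define \<epsilon> where "\<epsilon> = (\<lambda>n. L - J n + 2 / (real n + 1))"
  note Vb = ball[OF V(1)]
  have mg [measurable]: "g n \<in> borel_measurable circ" for n
    using meas[OF Vb[of n]] unfolding g_def by simp
  have g01: "0 < g n t" "g n t \<le> 1" for n t using pos[OF Vb[of n]] by (auto simp: g_def)
  have igb: "integrable circ (\<lambda>t. (g n t - g m t)\<^sup>2)" for n m
  proof (rule circ.integrable_const_bound[where B = 1])
    have "\<bar>g n t - g m t\<bar> \<le> 1" for t
      using g01[of n t] g01[of m t] by linarith
    then show "AE t in circ. norm ((g n t - g m t)\<^sup>2) \<le> 1" by (simp add: abs_square_le_1)
  qed simp
  have D: "(\<integral>t. (g n t - g m t)\<^sup>2 \<partial>circ) \<le> \<epsilon> n" if "n \<le> m" for n m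
  proof -
    let ?h = "\<lambda>\<zeta>. (V n \<zeta> + V m \<zeta>) / 2"
    have h: "?h \<in> tail_hull w n"
      using V(1) tail_hull_antimono[OF that V(1)] by (intro tail_hull.mid) auto
    have "(\<integral>t. (g n t - g m t)\<^sup>2 \<partial>circ) = (\<integral>t. exp (- V n (cis t)) + exp (- V m (cis t)) - 2 * exp (- ?h (cis t)) \<partial>circ)"
    proof (rule Bochner_Integration.integral_cong[OF refl])
      fix t
      have "(g n t)\<^sup>2 = exp (- V n (cis t))" "(g m t)\<^sup>2 = exp (- V m (cis t))" "g n t * g m t = exp (- ?h (cis t))"
        by (auto simp: g_def power2_eq_square exp_add[symmetric] field_simps)
      then show "(g n t - g m t)\<^sup>2 = exp (- V n (cis t)) + exp (- V m (cis t)) - 2 * exp (- ?h (cis t))"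
        unfolding power2_diff by simp
    qed
    also have "\<dots> = E (V n) + E (V m) - 2 * E ?h"
      unfolding E_def using iexp[OF Vb] iexp[OF ball[OF h]] by simp
    also have "\<dots> \<le> (J n + 1 / (real n + 1)) + (J m + 1 / (real m + 1)) - 2 * J n"
      using V(2)[of n] V(2)[of m] J_le[OF h] by simp
    also have "\<dots> \<le> \<epsilon> n"
    proof -
      have "1 / (real m + 1) \<le> 1 / (real n + 1)" using that by (intro divide_left_mono) auto
      then show ?thesis using L(2)[of m] unfolding \<epsilon>_def by simp
    qed
    finally show ?thesis .
  qed
  have "(\<lambda>n. L - J n + 2 / (real n + 1)) \<longlonglongrightarrow> L - L + 0"
    by (intro tendsto_intros L(1)) real_asymp
  then have \<epsilon>0: "\<epsilon> \<longlonglongrightarrow> 0" by (simp add: \<epsilon>_def)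
  \<comment> \<open>The rate \<open>(1/4)^k\<close> for mean squares turns into
    \<open>2 * (1/2)^k\<close> for mean absolute differences, which is summable.\<close>
  have "\<exists>n>m. \<epsilon> n \<le> (1/4)^k" for m k
  proof -
    have "eventually (\<lambda>n. \<epsilon> n < (1/4)^k) sequentially"
      using order_tendstoD(2)[OF \<epsilon>0, of "(1/4)^k"] by simp
    then have "eventually (\<lambda>n. n > m \<and> \<epsilon> n \<le> (1/4)^k) sequentially"
      using eventually_gt_at_top[of m] by eventually_elim auto
    then show ?thesis using eventually_happens'[OF sequentially_bot] by blast
  qed
  then have "\<exists>s. \<forall>k. (\<epsilon> (s k) \<le> (1/4)^k) \<and> s k < s (Suc k)"
    by (intro dependent_nat_choice) (metis, metis)
  then obtain s where s: "\<And>k. \<epsilon> (s k) \<le> (1/4)^k" "\<And>k. s k < s (Suc k)" by blast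
  have smono: "strict_mono s" using s(2) by (simp add: strict_mono_Suc_iff)
  define d where "d = (\<lambda>k t. g (s (Suc k)) t - g (s k) t)"
  have dm [measurable]: "d k \<in> borel_measurable circ" for k unfolding d_def by simp
  have dint: "(\<integral>\<^sup>+t. ennreal \<bar>d k t\<bar> \<partial>circ) \<le> ennreal (2 * (1/2)^k)" for k
  proof -
    have i1: "integrable circ (\<lambda>t. (d k t)\<^sup>2)" unfolding d_def by (rule igb)
    have "(\<integral>\<^sup>+t. ennreal \<bar>d k t\<bar> \<partial>circ) \<le> (\<integral>\<^sup>+t. ennreal ((1/2)^k + 2^k * (d k t)\<^sup>2) \<partial>circ)"
    proof (intro nn_integral_mono ennreal_leI)
      fix t
      \<comment> \<open>Used with \<open>a = (1/2)^k\<close> in place of the Cauchy-Schwarz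
        inequality.\<close>
      have "\<bar>x\<bar> \<le> a + (1/a) * x\<^sup>2" if "a > 0" for a x :: real
      proof (cases "\<bar>x\<bar> \<le> a")
        case True then show ?thesis using that by (simp add: add_increasing2)
      next
        case False
        then have "a * \<bar>x\<bar> \<le> \<bar>x\<bar> * \<bar>x\<bar>" by (intro mult_right_mono) auto
        then show ?thesis using that by (simp add: field_simps power2_eq_square add_increasing)
      qed
      from this[of "(1/2)^k" "d k t"] show "\<bar>d k t\<bar> \<le> (1/2)^k + 2^k * (d k t)\<^sup>2"
        by (simp add: power_one_over)
    qed
    also have "\<dots> = ennreal (\<integral>t. (1/2)^k + 2^k * (d k t)\<^sup>2 \<partial>circ)"
      using i1 by (intro nn_integral_eq_integral) auto
    also have "(\<integral>t. (1/2)^k + 2^k * (d k t)\<^sup>2 \<partial>circ) = (1/2)^k + 2^k * (\<integral>t. (d k t)\<^sup>2 \<partial>circ)"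
      using i1 by (simp add: circ.prob_space[unfolded space_circ])
    also have "(\<integral>t. (d k t)\<^sup>2 \<partial>circ) \<le> (1/4)^k"
      using D[of "s k" "s (Suc k)"] s[of k] unfolding d_def by (simp add: power2_commute less_imp_le)
    then have "(1/2)^k + 2^k * (\<integral>t. (d k t)\<^sup>2 \<partial>circ) \<le> (1/2)^k + 2^k * (1/4)^k"
      by simp
    also have "\<dots> = 2 * (1/2::real)^k" by (simp add: power_mult_distrib[symmetric])
    finally show ?thesis by (simp add: ennreal_leI)
  qed
  have "(\<integral>\<^sup>+t. (\<Sum>k. ennreal \<bar>d k t\<bar>) \<partial>circ) = (\<Sum>k. \<integral>\<^sup>+t. ennreal \<bar>d k t\<bar> \<partial>circ)"
    by (rule nn_integral_suminf) simp
  also have "\<dots> \<le> (\<Sum>k. ennreal (2 * (1/2)^k))" by (intro suminf_le dint) auto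
  also have "\<dots> = ennreal (\<Sum>k. 2 * (1/2)^k)"
    by (rule suminf_ennreal2) (auto intro!: summable_mult summable_geometric)
  finally have "(\<integral>\<^sup>+t. (\<Sum>k. ennreal \<bar>d k t\<bar>) \<partial>circ) \<noteq> \<infinity>" by (auto simp: top_unique)
  then have "AE t in circ. (\<Sum>k. ennreal \<bar>d k t\<bar>) \<noteq> \<infinity>"
    by (intro nn_integral_PInf_AE) simp_all
  then have AEg: "AE t in circ. convergent (\<lambda>k. g (s k) t)"
  proof eventually_elim
    case (elim t)
    then have "summable (\<lambda>k. \<bar>d k t\<bar>)" by (intro summable_suminf_not_top) auto
    then have "summable (\<lambda>k. d k t)" by (rule summable_rabs_cancel)
    then have "convergent (\<lambda>n. \<Sum>k<n. d k t)" by (simp add: summable_iff_convergent)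
    then have "convergent (\<lambda>n. g (s n) t - g (s 0) t)"
      by (simp add: d_def sum_lessThan_telescope[of "\<lambda>k. g (s k) t"])
    then have "convergent (\<lambda>n. (g (s n) t - g (s 0) t) + g (s 0) t)"
      by (intro convergent_add convergent_const)
    then show ?case by simp
  qed
  obtain T where T: "T > 0" "\<And>t. 0 \<le> t \<Longrightarrow> t \<le> min t T + 1 * \<rho> t" using linear_bound[of 1] by auto
  \<comment> \<open>Bounded means exclude that \<open>V (s k)\<close> diverges to infinity on a set
    of positive measure, which is the case where \<open>g (s k)\<close> tends to 0.\<close>
  have Vint: "(\<integral>\<^sup>+t. ennreal (V n (cis t)) \<partial>circ) \<le> ennreal (T + N)" for n
  proof -
    have ir: "integrable circ (\<lambda>t. \<rho> (V n (cis t)))" and Nr: "(\<integral>t. \<rho> (V n (cis t)) \<partial>circ) \<le> N"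
      using Vb[of n] by (auto simp: orlicz_ball_def)
    have "(\<integral>\<^sup>+t. ennreal (V n (cis t)) \<partial>circ) \<le> (\<integral>\<^sup>+t. ennreal (T + \<rho> (V n (cis t))) \<partial>circ)"
      using T(2)[OF pos[OF Vb]] by (intro nn_integral_mono ennreal_leI) (smt (verit) min.cobounded2)
    also have "\<dots> = ennreal (\<integral>t. T + \<rho> (V n (cis t)) \<partial>circ)"
      using ir T nonneg by (intro nn_integral_eq_integral) auto
    also have "(\<integral>t. T + \<rho> (V n (cis t)) \<partial>circ) = T + (\<integral>t. \<rho> (V n (cis t)) \<partial>circ)"
      using ir by (simp add: circ.prob_space[unfolded space_circ])
    finally show ?thesis using Nr by (elim order.trans) (intro ennreal_leI, simp)
  qed
  have "(\<integral>\<^sup>+t. liminf (\<lambda>k. ennreal (V (s k) (cis t))) \<partial>circ) \<le> liminf (\<lambda>k. \<integral>\<^sup>+t. ennreal (V (s k) (cis t)) \<partial>circ)"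
    using meas[OF Vb] by (intro nn_integral_liminf) simp
  also have "\<dots> \<le> ennreal (T + N)" using Vint by (intro Liminf_le) auto
  finally have "(\<integral>\<^sup>+t. liminf (\<lambda>k. ennreal (V (s k) (cis t))) \<partial>circ) \<noteq> \<infinity>" by (auto simp: top_unique)
  then have AEV: "AE t in circ. liminf (\<lambda>k. ennreal (V (s k) (cis t))) \<noteq> \<infinity>"
    using meas[OF Vb] by (intro nn_integral_PInf_AE) simp_all
  have conv: "AE t in circ. convergent (\<lambda>k. V (s k) (cis t))"
    using AEg AEV
  proof eventually_elim
    case (elim t)
    then obtain l where l: "(\<lambda>k. g (s k) t) \<longlonglongrightarrow> l" by (auto simp: convergent_def)
    have Vg: "V n (cis t) = - 2 * ln (g n t)" for n by (simp add: g_def)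
    have "l \<ge> 0" using l g01(1) by (intro LIMSEQ_le_const[OF l]) (auto intro: less_imp_le)
    show ?case
    proof (cases "l = 0")
      case False
      then have "(\<lambda>k. - 2 * ln (g (s k) t)) \<longlonglongrightarrow> - 2 * ln l" by (intro tendsto_intros l) auto
      then show ?thesis by (auto simp: Vg convergent_def)
    next
      case True
      have "filterlim (\<lambda>k. g (s k) t) (at_right 0) sequentially"
        using l g01(1) True by (auto simp: filterlim_at intro!: always_eventually) (metis less_irrefl g01(1))
      then have "filterlim (\<lambda>k. ln (g (s k) t)) at_bot sequentially"
        by (rule filterlim_compose[OF ln_at_0])
      then have bot: "filterlim (\<lambda>k. - ln (g (s k) t)) at_top sequentially"
        by (simp add: filterlim_uminus_at_top)
      have "filterlim (\<lambda>k. 2 * - ln (g (s k) t)) at_top sequentially"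
        by (rule filterlim_tendsto_pos_mult_at_top[OF tendsto_const _ bot]) simp
      then have "filterlim (\<lambda>k. V (s k) (cis t)) at_top sequentially" by (simp add: Vg)
      then have "(\<lambda>k. ennreal (V (s k) (cis t))) \<longlonglongrightarrow> \<infinity>"
        by (simp add: ennreal_tendsto_top_eq_at_top)
      then have "liminf (\<lambda>k. ennreal (V (s k) (cis t))) = \<infinity>" by (intro lim_imp_Liminf) auto
      then show ?thesis using elim by simp
    qed
  qed
  \<comment> \<open>The maximum with 0 keeps \<open>v\<close> nonnegative also where the limit does
    not exist.\<close>
  define v where "v = (\<lambda>\<zeta>. max 0 (lim (\<lambda>k. V (s k) \<zeta>)))"
  have vlim: "AE t in circ. (\<lambda>k. V (s k) (cis t)) \<longlonglongrightarrow> v (cis t)"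
    using conv
  proof eventually_elim
    case (elim t)
    then have c: "(\<lambda>k. V (s k) (cis t)) \<longlonglongrightarrow> lim (\<lambda>k. V (s k) (cis t))" by (simp add: convergent_LIMSEQ_iff)
    then have "0 \<le> lim (\<lambda>k. V (s k) (cis t))" using pos[OF Vb] by (intro LIMSEQ_le_const[OF c]) auto
    then show ?case using c by (simp add: v_def max_absorb2)
  qed
  have mv: "(\<lambda>t. v (cis t)) \<in> borel_measurable circ"
    unfolding v_def using meas[OF Vb] by (intro borel_measurable_max borel_measurable_const borel_measurable_lim_metric) simp
  note C = convergence_of_bounded_Young[OF circ.prob_space_axioms meas[OF Vb] pos[OF Vb] mv _ vlim, of N]
  have vb: "v \<in> orlicz_ball \<rho> N"
    unfolding orlicz_ball_def using C(1,2) mv Vb by (auto simp: v_def orlicz_ball_def)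
  have Plim: "(\<lambda>k. poisson_int (V (s k)) z) \<longlonglongrightarrow> poisson_int v z" if z: "norm z < 1" for z
    unfolding poisson_int_eq using poisson_nonneg[OF z] poisson_le[OF z] z Vb
    by (intro C(3)[where B = "(1 - (norm z)\<^sup>2) / (1 - norm z)\<^sup>2"]) (auto simp: v_def orlicz_ball_def)
  show ?thesis
  proof (rule that[OF vb])
    fix z :: complex and a assume z: "norm z < 1" and ev: "eventually (\<lambda>n. a \<le> poisson_int (w n) z) sequentially"
    then obtain n0 where n0: "\<And>n. n \<ge> n0 \<Longrightarrow> a \<le> poisson_int (w n) z" by (auto simp: eventually_sequentially)
    \<comment> \<open>Lower bounds for Poisson integrals that hold along a tail are inherited by
      midpoints, hence by the whole hull of the tail.\<close>
    have hull: "a \<le> poisson_int u z" if "u \<in> tail_hull w n0" for u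
      using that
    proof induction
      case (base i) then show ?case using n0 by simp
    next
      case (mid u v)
      have "poisson_int (\<lambda>\<zeta>. (u \<zeta> + v \<zeta>) / 2) z = (poisson_int u z + poisson_int v z) / 2"
        using poisson_int_cmult[of "1/2" "\<lambda>\<zeta>. u \<zeta> + v \<zeta>" z]
          poisson_int_add[OF z orlicz_ball_circ_integrable[OF ball[OF mid.hyps(1)]] orlicz_ball_circ_integrable[OF ball[OF mid.hyps(2)]]]
        by simp
      then show ?case using mid.IH by simp
    qed
    have "eventually (\<lambda>k. a \<le> poisson_int (V (s k)) z) sequentially"
      using eventually_ge_at_top[of n0]
    proof eventually_elim
      case (elim k)
      then have "n0 \<le> s k" using seq_suble[OF smono, of k] by simp
      then show ?case by (intro hull tail_hull_antimono[OF _ V(1)])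
    qed
    then show "a \<le> poisson_int v z"
      using Plim[OF z] tendsto_lowerbound by fastforce
  qed
qed

end

section \<open>Almost everywhere differentiability of Lipschitz functions\<close>

text \<open>Vitali's argument. Were a bounded part \<open>E\<close> of the set of measure
  \<open>s > 0\<close>, cover it, within an open set of measure nearly \<open>s\<close>, by disjoint
  intervals of slope below \<open>p\<close>, and then within these by disjoint intervals of slope
  above \<open>q\<close>. The Stieltjes measure of \<open>g\<close> is at least \<open>q * s\<close>
  on the second family and at most nearly \<open>p * s\<close> on the first.\<close>

lemma negligible_oscillating_slopes:
  fixes g :: "real \<Rightarrow> real"
  assumes mono: "mono g" and cont: "continuous_on UNIV g" and pq: "p < q"
  defines "S \<equiv> {x. \<forall>d>0. (\<exists>y z. y < x \<and> x < z \<and> z - y < d \<and> g z - g y < p * (z - y)) \<and>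
                       (\<exists>y z. y < x \<and> x < z \<and> z - y < d \<and> g z - g y > q * (z - y))}"
  shows "negligible S"
proof -
  have bounded_case: "negligible (S \<inter> ball 0 R)" for R
  proof (cases "p \<ge> 0")
    case False
    \<comment> \<open>A monotone function has no negative slopes.\<close>
    have "S = {}"
    proof (rule ccontr)
      assume "S \<noteq> {}"
      then obtain x y z where "y < x" "x < z" "g z - g y < p * (z - y)" 
        unfolding S_def by (auto dest!: spec[of _ 1])
      moreover have "g y \<le> g z" using mono calculation by (auto simp: mono_def)
      moreover have "p * (z - y) < 0" using False calculation by (intro mult_neg_pos) auto
      ultimately show False by linarith
    qed
    then show ?thesis by simp
  next
    case p: True
    define U where "U = (\<lambda>n. \<Union>{{y<..<z} | y z. y < z \<and> z - y < 1 / (real n + 1) \<and> g z - g y < p * (z - y)})"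
    define V where "V = (\<lambda>n. \<Union>{{y<..<z} | y z. y < z \<and> z - y < 1 / (real n + 1) \<and> g z - g y > q * (z - y)})"
    \<comment> \<open>A countable intersection of open sets, hence Borel.\<close>
    have "S = (\<Inter>n. U n \<inter> V n)"
    proof (intro set_eqI iffI)
      fix x assume x: "x \<in> S"
      have "x \<in> U n \<inter> V n" for n
      proof -
        have "1 / (real n + 1) > 0" by simp
        then obtain y z y' z' where "y < x" "x < z" "z - y < 1 / (real n + 1)" "g z - g y < p * (z - y)"
          "y' < x" "x < z'" "z' - y' < 1 / (real n + 1)" "g z' - g y' > q * (z' - y')"
          using x unfolding S_def by blast
        moreover from this have "y < z" "y' < z'" by auto
        ultimately have "{y<..<z} \<subseteq> U n" "{y'<..<z'} \<subseteq> V n"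
          unfolding U_def V_def by (intro Union_upper CollectI; blast)+
        moreover have "x \<in> {y<..<z}" "x \<in> {y'<..<z'}" using \<open>y < x\<close> \<open>x < z\<close> \<open>y' < x\<close> \<open>x < z'\<close> by auto
        ultimately show ?thesis by blast
      qed
      then show "x \<in> (\<Inter>n. U n \<inter> V n)" by blast
    next
      fix x assume x: "x \<in> (\<Inter>n. U n \<inter> V n)"
      show "x \<in> S"
        unfolding S_def
      proof (intro CollectI allI impI)
        fix d :: real assume "d > 0"
        then obtain n where n: "1 / (real n + 1) < d"
          by (metis nat_approx_posE of_nat_Suc Suc_eq_plus1 add.commute)
        have "x \<in> U n" "x \<in> V n" using x by auto
        then obtain y z y' z' where "y < x" "x < z" "z - y < 1 / (real n + 1)" "g z - g y < p * (z - y)"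
          "y' < x" "x < z'" "z' - y' < 1 / (real n + 1)" "g z' - g y' > q * (z' - y')"
          unfolding U_def V_def by auto
        then show "(\<exists>y z. y < x \<and> x < z \<and> z - y < d \<and> g z - g y < p * (z - y)) \<and>
                       (\<exists>y z. y < x \<and> x < z \<and> z - y < d \<and> g z - g y > q * (z - y))"
          using n by (meson order.strict_trans)
      qed
    qed
    moreover have "open (U n)" "open (V n)" for n by (auto simp: U_def V_def intro!: open_Union)
    ultimately have "S \<in> sets borel" by (auto intro!: sets.countable_INT'[of UNIV])
    define E where "E = S \<inter> ball 0 R"
    have Eb: "E \<in> sets borel" using \<open>S \<in> sets borel\<close> by (simp add: E_def)
    have El: "E \<in> lmeasurable"
      by (rule bounded_set_imp_lmeasurable) (use Eb in \<open>auto simp: E_def intro: bounded_Int\<close>)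
    define s where "s = measure lebesgue E"
    have emE: "emeasure lborel E = ennreal s"
      using emeasure_eq_measure2[OF El] Eb by (simp add: s_def)
    have "s \<ge> 0" by (simp add: s_def)
    have "s = 0"
    proof (rule ccontr)
      assume "s \<noteq> 0"
      then have s: "s > 0" using \<open>s \<ge> 0\<close> by simp
      obtain \<epsilon> where \<epsilon>: "\<epsilon> > 0" "p * (s + \<epsilon>) < q * s"
      proof
        \<comment> \<open>The fraction \<open>p / (2 * (p + 1))\<close> is below 1, so
          \<open>p * ?e\<close> is less than the gap \<open>(q - p) * s\<close>; the
          \<open>p + 1\<close> allows \<open>p = 0\<close>.\<close>
        let ?e = "(q - p) * s / (2 * (p + 1))"
        show "?e > 0" using pq s p by (intro divide_pos_pos) auto
        have "p * ?e = (q - p) * s * (p / (2 * (p + 1)))" by simp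
        also have "\<dots> < (q - p) * s * 1" using pq s p by (intro mult_strict_left_mono) (auto simp: divide_simps)
        finally show "p * (s + ?e) < q * s" by (simp add: algebra_simps)
      qed
      obtain W where W: "open W" "E \<subseteq> W" "emeasure lebesgue (W - E) < ennreal \<epsilon>"
        using sets_lebesgue_outer_open[OF fmeasurableD[OF El] \<epsilon>(1)] by metis
      have emW: "emeasure lborel W \<le> ennreal (s + \<epsilon>)"
      proof -
        have "emeasure lborel W = emeasure lborel E + emeasure lborel (W - E)"
          using W(1,2) Eb by (subst plus_emeasure) (auto simp: Un_absorb1)
        also have "\<dots> \<le> ennreal s + ennreal \<epsilon>"
          using W(1,3) Eb emE by (intro add_mono) (auto simp: less_imp_le)
        finally show ?thesis using s \<epsilon> by simp
      qed
      \<comment> \<open>Continuity of \<open>g\<close> gives closed intervals exactly the increment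
        of \<open>g\<close> as measure.\<close>
      define \<mu> where "\<mu> = interval_measure g"
      have \<mu>I: "emeasure \<mu> {y..z} = ennreal (g z - g y)" if "y \<le> z" for y z
        unfolding \<mu>_def
      proof (rule emeasure_interval_measure_Icc[OF that])
        show "g x \<le> g y" if "x \<le> y" for x y using mono that by (rule monoD)
      qed (rule cont)
      have sets\<mu>: "sets \<mu> = sets borel" by (simp add: \<mu>_def)
      \<comment> \<open>The covering theorem speaks of balls, so intervals are described by midpoint
        and half-length.\<close>
      define ctr where "ctr = (\<lambda>(y::real, z). (y + z) / 2)"
      define rad where "rad = (\<lambda>(y::real, z). (z - y) / 2)"
      have cb: "cball (ctr i) (rad i) = {fst i..snd i}" for i
        by (cases i) (auto simp: ctr_def rad_def cball_eq_atLeastAtMost field_simps)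
      have iv: "\<exists>i. i \<in> {(y, z). y < z \<and> {y..z} \<subseteq> O' \<and> P y z} \<and> x \<in> cball (ctr i) (rad i) \<and> rad i < d"
        if O': "open O'" "x \<in> O'" and d: "d > 0" and ex: "\<And>d. d > 0 \<Longrightarrow> \<exists>y z. y < x \<and> x < z \<and> z - y < d \<and> P y z" for O' x d P
      proof -
        obtain e where e: "e > 0" "ball x e \<subseteq> O'" using openE[OF O'] by blast
        have "min e d > 0" using e d by simp
        from ex[OF this] obtain y z where yz: "y < x" "x < z" "z - y < min e d" "P y z" by blast
        have "{y..z} \<subseteq> ball x e" using yz by (auto simp: dist_real_def)
        then have "(y, z) \<in> {(y, z). y < z \<and> {y..z} \<subseteq> O' \<and> P y z}" using yz e by auto
        moreover have "x \<in> cball (ctr (y, z)) (rad (y, z))" using yz by (simp add: cb)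
        moreover have "rad (y, z) < d" using yz by (simp add: rad_def)
        ultimately show ?thesis by blast
      qed
      define K1 where "K1 = {(y, z). y < z \<and> {y..z} \<subseteq> W \<and> g z - g y < p * (z - y)}"
      obtain C where C: "countable C" "C \<subseteq> K1"
        "pairwise (\<lambda>i j. disjnt (cball (ctr i) (rad i)) (cball (ctr j) (rad j))) C"
        "negligible (E - (\<Union>i\<in>C. cball (ctr i) (rad i)))"
      proof (rule Vitali_covering_theorem_cballs[of K1 rad E ctr])
        show "0 < rad i" if "i \<in> K1" for i using that by (auto simp: K1_def rad_def)
        show "\<exists>i. i \<in> K1 \<and> x \<in> cball (ctr i) (rad i) \<and> rad i < d" if "x \<in> E" "0 < d" for x d
          unfolding K1_def using W that by (intro iv) (auto simp: E_def S_def)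
      qed auto
      \<comment> \<open>The second covering has to be nested in an open set; passing to open
        intervals loses only the countably many endpoints.\<close>
      define W2 where "W2 = (\<Union>i\<in>C. {fst i<..<snd i})"
      have "open W2" by (auto simp: W2_def)
      have cn: "negligible A" if "countable A" for A :: "real set"
        using countable_imp_null_set_lborel[OF that] by (simp add: negligible_iff_null_sets null_sets_completionI)
      have "negligible (E - W2)"
      proof (rule negligible_subset)
        show "negligible ((E - (\<Union>i\<in>C. cball (ctr i) (rad i))) \<union> (fst ` C \<union> snd ` C))"
          using C(1) by (intro negligible_Un C(4) cn) auto
        show "E - W2 \<subseteq> (E - (\<Union>i\<in>C. cball (ctr i) (rad i))) \<union> (fst ` C \<union> snd ` C)"
          by (auto simp: W2_def cb) (metis imageI fst_conv snd_conv order_less_le)+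
      qed
      define K2 where "K2 = {(y, z). y < z \<and> {y..z} \<subseteq> W2 \<and> g z - g y > q * (z - y)}"
      obtain C2 where C2: "countable C2" "C2 \<subseteq> K2"
        "pairwise (\<lambda>i j. disjnt (cball (ctr i) (rad i)) (cball (ctr j) (rad j))) C2"
        "negligible (E \<inter> W2 - (\<Union>i\<in>C2. cball (ctr i) (rad i)))"
      proof (rule Vitali_covering_theorem_cballs[of K2 rad "E \<inter> W2" ctr])
        show "0 < rad i" if "i \<in> K2" for i using that by (auto simp: K2_def rad_def)
        show "\<exists>i. i \<in> K2 \<and> x \<in> cball (ctr i) (rad i) \<and> rad i < d" if "x \<in> E \<inter> W2" "0 < d" for x d
          unfolding K2_def using \<open>open W2\<close> that by (intro iv) (auto simp: E_def S_def)
      qed auto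
      have dj: "disjoint_family_on (\<lambda>i. {fst i..snd i}) D"
        if "pairwise (\<lambda>i j. disjnt (cball (ctr i) (rad i)) (cball (ctr j) (rad j))) D" for D
        using that by (auto simp: disjoint_family_on_def pairwise_def cb disjnt_def)
      let ?I = "\<Union>i\<in>C. {fst i..snd i}" and ?J = "\<Union>i\<in>C2. {fst i..snd i}"
      have "negligible (E - ?J)"
        by (rule negligible_subset[OF negligible_Un[OF \<open>negligible (E - W2)\<close> C2(4)]]) (auto simp: cb)
      moreover have Jb: "?J \<in> sets borel" using C2(1) by (intro sets.countable_UN') auto
      ultimately have "emeasure lborel (E - ?J) = 0"
        using Eb by (auto simp: negligible_iff_null_sets null_sets_def)
      then have "ennreal s \<le> emeasure lborel ?J"
        using emeasure_subadditive[of ?J lborel "E - ?J"] emeasure_mono[of E "?J \<union> (E - ?J)" lborel] Eb Jb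
        unfolding emE[symmetric] by auto
      then have "ennreal (q * s) \<le> ennreal q * emeasure lborel ?J"
        using pq p s by (simp add: ennreal_mult mult_left_mono)
      also have "\<dots> = ennreal q * (\<integral>\<^sup>+i. emeasure lborel {fst i..snd i} \<partial>count_space C2)"
        using C2 by (subst emeasure_UN_countable) (auto intro!: dj)
      also have "\<dots> = (\<integral>\<^sup>+i. ennreal q * emeasure lborel {fst i..snd i} \<partial>count_space C2)"
        by (rule nn_integral_cmult[symmetric]) simp
      also have "\<dots> \<le> (\<integral>\<^sup>+i. emeasure \<mu> {fst i..snd i} \<partial>count_space C2)"
      proof (rule nn_integral_mono)
        fix i assume "i \<in> space (count_space C2)"
        then have "fst i < snd i" "q * (snd i - fst i) < g (snd i) - g (fst i)" using C2(2) by (auto simp: K2_def)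
        then show "ennreal q * emeasure lborel {fst i..snd i} \<le> emeasure \<mu> {fst i..snd i}"
          using pq p by (simp add: \<mu>I ennreal_mult[symmetric] ennreal_leI less_imp_le)
      qed
      also have "\<dots> = emeasure \<mu> ?J"
        using C2 by (subst emeasure_UN_countable) (auto intro!: dj simp: sets\<mu>)
      also have "\<dots> \<le> emeasure \<mu> ?I"
      proof (rule emeasure_mono)
        show "?J \<subseteq> ?I"
        proof safe
          fix y z x assume "(y, z) \<in> C2" "x \<in> {fst (y, z)..snd (y, z)}"
          moreover from this have "(y, z) \<in> K2" using C2(2) by blast
          then have "{y..z} \<subseteq> W2" by (simp add: K2_def)
          ultimately have "x \<in> W2" by auto
          then show "x \<in> ?I" by (force simp: W2_def)
        qed
        show "?I \<in> sets \<mu>" using C(1) by (auto simp: sets\<mu> intro!: sets.countable_UN')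
      qed
      also have "\<dots> = (\<integral>\<^sup>+i. emeasure \<mu> {fst i..snd i} \<partial>count_space C)"
        using C by (subst emeasure_UN_countable) (auto intro!: dj simp: sets\<mu>)
      also have "\<dots> \<le> (\<integral>\<^sup>+i. ennreal p * emeasure lborel {fst i..snd i} \<partial>count_space C)"
      proof (rule nn_integral_mono)
        fix i assume "i \<in> space (count_space C)"
        then have "fst i < snd i" "g (snd i) - g (fst i) < p * (snd i - fst i)" using C(2) by (auto simp: K1_def)
        then show "emeasure \<mu> {fst i..snd i} \<le> ennreal p * emeasure lborel {fst i..snd i}"
          using p by (simp add: \<mu>I ennreal_mult[symmetric] ennreal_leI less_imp_le)
      qed
      also have "\<dots> = ennreal p * (\<integral>\<^sup>+i. emeasure lborel {fst i..snd i} \<partial>count_space C)"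
        by (rule nn_integral_cmult) simp
      also have "\<dots> = ennreal p * emeasure lborel ?I"
        using C by (subst emeasure_UN_countable) (auto intro!: dj)
      also have "\<dots> \<le> ennreal p * emeasure lborel W"
      proof (intro mult_left_mono emeasure_mono)
        show "?I \<subseteq> W"
        proof (rule UN_least)
          fix i assume "i \<in> C"
          then have "i \<in> K1" using C(2) by blast
          then show "{fst i..snd i} \<subseteq> W" by (cases i) (simp add: K1_def)
        qed
      qed (use W(1) in auto)
      also have "\<dots> \<le> ennreal p * ennreal (s + \<epsilon>)" using emW by (intro mult_left_mono) auto
      also have "\<dots> = ennreal (p * (s + \<epsilon>))" using p s \<epsilon> by (simp add: ennreal_mult)
      finally have "q * s \<le> p * (s + \<epsilon>)"
        using p s \<epsilon> by (subst (asm) ennreal_le_iff) auto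
      then show False using \<epsilon> by simp
    qed
    then show ?thesis
      using El unfolding s_def E_def[symmetric] by (simp add: negligible_iff_measure0)
  qed
  have "S = (\<Union>n::nat. S \<inter> ball 0 (real n))"
  proof safe
    fix x assume "x \<in> S"
    obtain n :: nat where "\<bar>x\<bar> < real n" using reals_Archimedean2 by blast
    then show "x \<in> (\<Union>n::nat. S \<inter> ball 0 (real n))" using \<open>x \<in> S\<close> by auto
  qed
  then show ?thesis using bounded_case negligible_countable_Union[of "range (\<lambda>n::nat. S \<inter> ball 0 (real n))"] by auto
qed

text \<open>One-sided difference quotients are limits of straddling ones, by continuity: let
  \<open>y\<close> or \<open>z\<close> tend to \<open>x\<close>.\<close>

lemma DERIV_of_slope_limits:
  fixes g :: "real \<Rightarrow> real"
  assumes cont: "continuous_on UNIV g"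
    and sl: "\<And>e. e > 0 \<Longrightarrow> \<exists>d>0. \<forall>y z. y < x \<longrightarrow> x < z \<longrightarrow> z - y < d \<longrightarrow> \<bar>g z - g y - D * (z - y)\<bar> \<le> e * (z - y)"
  shows "(g has_real_derivative D) (at x)"
proof -
  have isC: "isCont g y" for y using cont by (simp add: continuous_on_eq_continuous_at)
  have "\<exists>d>0. \<forall>y. \<bar>y - x\<bar> < d \<longrightarrow> \<bar>g y - g x - D * (y - x)\<bar> \<le> e * \<bar>y - x\<bar>" if e: "e > 0" for e
  proof -
    obtain d where d: "d > 0" "\<And>y z. y < x \<Longrightarrow> x < z \<Longrightarrow> z - y < d \<Longrightarrow> \<bar>g z - g y - D * (z - y)\<bar> \<le> e * (z - y)"
      using sl[OF e] by auto
    have right: "\<bar>g z - g x - D * (z - x)\<bar> \<le> e * (z - x)" if z: "x < z" "z - x < d" for z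
    proof (rule tendsto_le[of "at_left x" "\<lambda>y. e * (z - y)" _ "\<lambda>y. \<bar>g z - g y - D * (z - y)\<bar>"])
      show "((\<lambda>y. e * (z - y)) \<longlongrightarrow> e * (z - x)) (at_left x)" by (intro tendsto_intros)
      show "((\<lambda>y. \<bar>g z - g y - D * (z - y)\<bar>) \<longlongrightarrow> \<bar>g z - g x - D * (z - x)\<bar>) (at_left x)"
        using isC[of x] by (intro tendsto_intros) (simp add: isCont_def filterlim_at_split)
      show "\<forall>\<^sub>F y in at_left x. \<bar>g z - g y - D * (z - y)\<bar> \<le> e * (z - y)"
        using eventually_at_left_real[of "z - d" x] z
        by (auto elim!: eventually_mono intro!: d(2))
    qed auto
    have left: "\<bar>g x - g y - D * (x - y)\<bar> \<le> e * (x - y)" if y: "y < x" "x - y < d" for y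
    proof (rule tendsto_le[of "at_right x" "\<lambda>z. e * (z - y)" _ "\<lambda>z. \<bar>g z - g y - D * (z - y)\<bar>"])
      show "((\<lambda>z. e * (z - y)) \<longlongrightarrow> e * (x - y)) (at_right x)" by (intro tendsto_intros)
      show "((\<lambda>z. \<bar>g z - g y - D * (z - y)\<bar>) \<longlongrightarrow> \<bar>g x - g y - D * (x - y)\<bar>) (at_right x)"
        using isC[of x] by (intro tendsto_intros) (simp add: isCont_def filterlim_at_split)
      show "\<forall>\<^sub>F z in at_right x. \<bar>g z - g y - D * (z - y)\<bar> \<le> e * (z - y)"
        using eventually_at_right_real[of x "y + d"] y
        by (auto elim!: eventually_mono intro!: d(2))
    qed auto
    show ?thesis
    proof (intro exI conjI allI impI)
      show "d > 0" by (rule d)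
      fix y assume "\<bar>y - x\<bar> < d"
      then show "\<bar>g y - g x - D * (y - x)\<bar> \<le> e * \<bar>y - x\<bar>"
        using right[of y] left[of y] by (cases x y rule: linorder_cases) (auto simp: abs_le_iff algebra_simps)
    qed
  qed
  then show ?thesis
    unfolding has_field_derivative_def has_derivative_at_alt
    by (auto simp: bounded_linear_mult_right)
qed

text \<open>Adding \<open>L * x\<close> makes the function monotone. The derivative is the supremum
  \<open>D\<close> of the slopes that are exceeded at arbitrarily small scales; oscillation at
  \<open>x\<close> would put \<open>x\<close> into one of countably many null sets indexed by pairs
  of rationals.\<close>

lemma Lipschitz_AE_differentiable:
  fixes \<gamma> :: "real \<Rightarrow> real"
  assumes L: "L-lipschitz_on UNIV \<gamma>"
  shows "AE x in lborel. \<exists>D. (\<gamma> has_real_derivative D) (at x)"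
proof -
  define g where "g = (\<lambda>x. \<gamma> x + L * x)"
  have L0: "L \<ge> 0" using L by (simp add: lipschitz_on_def)
  have lip: "\<bar>\<gamma> x - \<gamma> y\<bar> \<le> L * \<bar>x - y\<bar>" for x y
    using lipschitz_onD[OF L, of x y] by (simp add: dist_real_def)
  have gm: "mono g"
  proof (rule monoI)
    fix x y :: real assume "x \<le> y"
    then show "g x \<le> g y" using lip[of y x] by (auto simp: g_def algebra_simps abs_le_iff)
  qed
  have gc: "continuous_on UNIV g"
    unfolding g_def by (intro continuous_intros lipschitz_on_continuous_on[OF L])
  define S where "S = (\<lambda>p q. {x. \<forall>d>0. (\<exists>y z. y < x \<and> x < z \<and> z - y < d \<and> g z - g y < p * (z - y)) \<and>
                       (\<exists>y z. y < x \<and> x < z \<and> z - y < d \<and> g z - g y > q * (z - y))})"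
  define Bad where "Bad = (\<Union>(p, q)\<in>{(p, q). p \<in> \<rat> \<and> q \<in> \<rat> \<and> p < q}. S p q)"
  have "countable {(p, q). p \<in> \<rat> \<and> q \<in> \<rat> \<and> p < (q::real)}"
    by (rule countable_subset[of _ "\<rat> \<times> \<rat>"]) (auto simp: countable_rat)
  then have negB: "negligible Bad"
    unfolding Bad_def
  proof (intro negligible_countable_Union)
    fix s assume "s \<in> (\<lambda>(p, q). S p q) ` {(p, q). p \<in> \<rat> \<and> q \<in> \<rat> \<and> p < q}"
    then show "negligible s" using negligible_oscillating_slopes[OF gm gc] by (auto simp: S_def)
  qed simp
  have der: "\<exists>D. (\<gamma> has_real_derivative D) (at x)" if x: "x \<notin> Bad" for x
  proof -
    define Q where "Q = {q. \<forall>d>0. \<exists>y z. y < x \<and> x < z \<and> z - y < d \<and> g z - g y > q * (z - y)}"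
    have slope: "0 \<le> g z - g y \<and> g z - g y \<le> 2 * L * (z - y)" if "y < z" for y z
      using lip[of z y] that by (auto simp: g_def algebra_simps abs_le_iff)
    have "- 1 \<in> Q"
      unfolding Q_def
    proof (intro CollectI allI impI)
      fix d :: real assume "d > 0"
      then show "\<exists>y z. y < x \<and> x < z \<and> z - y < d \<and> g z - g y > - 1 * (z - y)"
        using slope[of "x - d/4" "x + d/4"] by (intro exI[of _ "x - d/4"] exI[of _ "x + d/4"]) auto
    qed
    have bdd: "q \<le> 2 * L" if qQ: "q \<in> Q" for q
    proof -
      obtain y z where "y < x" "x < z" "g z - g y > q * (z - y)"
        using qQ zero_less_one unfolding Q_def by blast
      then have "q * (z - y) < 2 * L * (z - y)" using slope[of y z] by linarith
      moreover have "0 \<le> z - y" using \<open>y < x\<close> \<open>x < z\<close> by simp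
      ultimately have "q < 2 * L" by (rule mult_right_less_imp_less)
      then show ?thesis by simp
    qed
    define D where "D = Sup Q"
    have bb: "bdd_above Q" by (rule bdd_aboveI[of _ "2 * L"]) (rule bdd)
    have "(g has_real_derivative D) (at x)"
    proof (rule DERIV_of_slope_limits[OF gc])
      fix e :: real assume e: "e > 0"
      obtain q1 where q1: "D < q1" "q1 < D + e" using dense[of D "D + e"] e by auto
      have "q1 \<notin> Q" using q1 cSup_upper[OF _ bb] by (force simp: D_def)
      then obtain d1 where d1: "d1 > 0" "\<And>y z. y < x \<Longrightarrow> x < z \<Longrightarrow> z - y < d1 \<Longrightarrow> g z - g y \<le> q1 * (z - y)"
        unfolding Q_def using not_less by blast
      \<comment> \<open>Two rationals below \<open>D\<close>: slopes above \<open>p2\<close> occur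
        at every scale, so \<open>x \<notin> S p1 p2\<close> excludes slopes below \<open>p1\<close>
        at some scale and all smaller ones.\<close>
      obtain p2 where p2: "p2 \<in> \<rat>" "D - e < p2" "p2 < D" using Rats_dense_in_real[of "D - e" D] e by auto
      obtain p1 where p1: "p1 \<in> \<rat>" "D - e < p1" "p1 < p2" using Rats_dense_in_real[of "D - e" p2] p2 by auto
      obtain q where q: "q \<in> Q" "p2 < q" using less_cSup_iff[of Q p2] p2(3) bb \<open>- 1 \<in> Q\<close> by (auto simp: D_def)
      have "p2 \<in> Q"
        unfolding Q_def
      proof (intro CollectI allI impI)
        fix d :: real assume "d > 0"
        then obtain y z where yz: "y < x" "x < z" "z - y < d" "g z - g y > q * (z - y)" using q(1) by (auto simp: Q_def)
        moreover have "p2 * (z - y) \<le> q * (z - y)" using yz q(2) by (intro mult_right_mono) auto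
        ultimately have "g z - g y > p2 * (z - y)" by linarith
        then show "\<exists>y z. y < x \<and> x < z \<and> z - y < d \<and> g z - g y > p2 * (z - y)" using yz by blast
      qed
      have "x \<notin> S p1 p2" using x p1 p2 by (auto simp: Bad_def)
      then obtain d2 where d2: "d2 > 0" and
        nn: "\<not> ((\<exists>y z. y < x \<and> x < z \<and> z - y < d2 \<and> g z - g y < p1 * (z - y)) \<and>
               (\<exists>y z. y < x \<and> x < z \<and> z - y < d2 \<and> g z - g y > p2 * (z - y)))"
        unfolding S_def by blast
      moreover have "\<exists>y z. y < x \<and> x < z \<and> z - y < d2 \<and> g z - g y > p2 * (z - y)"
        using \<open>p2 \<in> Q\<close> d2 unfolding Q_def by blast
      ultimately have d2': "g z - g y \<ge> p1 * (z - y)" if "y < x" "x < z" "z - y < d2" for y z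
        using that by (meson not_less)
      show "\<exists>d>0. \<forall>y z. y < x \<longrightarrow> x < z \<longrightarrow> z - y < d \<longrightarrow> \<bar>g z - g y - D * (z - y)\<bar> \<le> e * (z - y)"
      proof (intro exI[of _ "min d1 d2"] conjI allI impI)
        show "0 < min d1 d2" using d1 d2 by simp
        fix y z assume yz: "y < x" "x < z" "z - y < min d1 d2"
        have "g z - g y \<le> q1 * (z - y)" "p1 * (z - y) \<le> g z - g y" using yz d1(2)[of y z] d2'[of y z] by auto
        moreover have "q1 * (z - y) \<le> (D + e) * (z - y)" "(D - e) * (z - y) \<le> p1 * (z - y)"
          using q1 p1 yz by (auto intro!: mult_right_mono)
        ultimately show "\<bar>g z - g y - D * (z - y)\<bar> \<le> e * (z - y)" by (auto simp: abs_le_iff algebra_simps)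
      qed
    qed
    then have "((\<lambda>x. g x - L * x) has_real_derivative D - L) (at x)"
      by (auto intro!: derivative_eq_intros)
    then show ?thesis by (auto simp: g_def)
  qed
  have "AE x in lebesgue. x \<notin> Bad"
    using negB by (simp add: negligible_iff_null_sets AE_not_in)
  then have "AE x in lborel. x \<notin> Bad" by (simp add: AE_completion_iff)
  then show ?thesis by eventually_elim (rule der)
qed

section \<open>Fatou's theorem for bounded holomorphic functions\<close>

lemma has_nt_limitI:
  assumes "\<And>\<alpha> e. \<alpha> > 1 \<Longrightarrow> e > 0 \<Longrightarrow> \<exists>d>0. \<forall>z\<in>stolz \<alpha> \<zeta>. norm (z - \<zeta>) < d \<longrightarrow> norm (f z - L) \<le> e"
  shows "has_nt_limit f \<zeta> L"
  unfolding has_nt_limit_def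
proof (intro allI impI tendstoI)
  fix \<alpha> e :: real assume "\<alpha> > 1" "e > 0"
  then obtain d where d: "d > 0" "\<And>z. z \<in> stolz \<alpha> \<zeta> \<Longrightarrow> norm (z - \<zeta>) < d \<Longrightarrow> norm (f z - L) \<le> e / 2"
    using assms[of \<alpha> "e/2"] by auto
  show "\<forall>\<^sub>F z in at \<zeta> within stolz \<alpha> \<zeta>. dist (f z) L < e"
    unfolding eventually_at
  proof (intro exI conjI ballI impI)
    fix z assume "z \<in> stolz \<alpha> \<zeta>" "z \<noteq> \<zeta> \<and> dist z \<zeta> < d"
    then show "dist (f z) L < e" using d(2)[of z] \<open>e > 0\<close> by (simp add: dist_norm)
  qed (rule d(1))
qed

text \<open>The reflected term costs nothing by Cauchy's theorem and improves the decay of the Cauchy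
  kernel from \<open>dist\<^sup>2\<close> to \<open>dist\<^sup>3\<close>.\<close>

lemma reflected_Cauchy_kernel_bound:
  fixes z \<zeta> :: complex
  assumes \<zeta>: "norm \<zeta> = 1" and z: "1 / 2 \<le> norm z" "norm z < 1"
  shows "norm (1 / (\<zeta> - z)\<^sup>2 - 1 / (\<zeta> - 1 / cnj z)\<^sup>2) \<le> 4 * (1 - (norm z)\<^sup>2) / (norm (\<zeta> - z)) ^ 3"
proof -
  \<comment> \<open>The reflection of \<open>z\<close> in the unit circle; from a boundary point its
    distance is that of \<open>z\<close> divided by \<open>norm z\<close>, so the two kernels nearly
    cancel.\<close>
  define w where "w = 1 / cnj z"
  have z0: "z \<noteq> 0" using z by auto
  have nz: "norm z > 0" using z0 by simp
  have a0: "norm (\<zeta> - z) > 0" using \<zeta> z by auto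
  have "norm (\<zeta> - w) * norm z = norm (\<zeta> * cnj z - 1)"
    using z0 unfolding w_def by (subst complex_mod_cnj[of z, symmetric], subst norm_mult[symmetric]) (simp add: left_diff_distrib)
  also have "\<zeta> * cnj z - 1 = - (\<zeta> * cnj (\<zeta> - z))"
    using \<zeta> complex_norm_square[of \<zeta>] by (simp add: algebra_simps)
  also have "norm \<dots> = norm (\<zeta> - z)" using \<zeta> by (simp add: norm_mult del: complex_cnj_diff)
  finally have w1: "norm (\<zeta> - w) * norm z = norm (\<zeta> - z)" .
  have wge: "norm (\<zeta> - z) \<le> norm (\<zeta> - w)"
    using w1 z mult_left_mono[of "norm z" 1 "norm (\<zeta> - w)"] by simp
  then have b0: "norm (\<zeta> - w) > 0" using a0 by linarith
  have "z - w = of_real ((norm z)\<^sup>2 - 1) / cnj z"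
    using z0 complex_norm_square[of z] by (simp add: w_def field_simps)
  then have "norm (z - w) = (1 - (norm z)\<^sup>2) / norm z"
    using z by (simp add: norm_divide abs_if abs_square_less_1 del: of_real_diff of_real_power)
  also have "\<dots> \<le> (1 - (norm z)\<^sup>2) / (1/2)" using z by (intro divide_left_mono) (auto simp: power_le_one)
  finally have zw: "norm (z - w) \<le> 2 * (1 - (norm z)\<^sup>2)" by simp
  have "1 / (\<zeta> - z)\<^sup>2 - 1 / (\<zeta> - w)\<^sup>2 = (z - w) * ((\<zeta> - w) + (\<zeta> - z)) / ((\<zeta> - z)\<^sup>2 * (\<zeta> - w)\<^sup>2)"
    using a0 b0 by (simp add: divide_simps) (simp add: power2_eq_square algebra_simps)
  then have "norm (1 / (\<zeta> - z)\<^sup>2 - 1 / (\<zeta> - w)\<^sup>2) = norm (z - w) * norm ((\<zeta> - w) + (\<zeta> - z)) / ((norm (\<zeta> - z))\<^sup>2 * (norm (\<zeta> - w))\<^sup>2)"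
    by (simp add: norm_mult norm_divide norm_power)
  also have "\<dots> \<le> (2 * (1 - (norm z)\<^sup>2)) * (2 * norm (\<zeta> - w)) / ((norm (\<zeta> - z))\<^sup>2 * (norm (\<zeta> - w))\<^sup>2)"
    using zw wge norm_triangle_ineq[of "\<zeta> - w" "\<zeta> - z"] z
    by (intro divide_right_mono mult_mono) (auto simp: power_le_one)
  also have "\<dots> = 4 * (1 - (norm z)\<^sup>2) / ((norm (\<zeta> - z))\<^sup>2 * norm (\<zeta> - w))"
    using b0 unfolding power2_eq_square[of "norm (\<zeta> - w)"] by (simp add: divide_simps)
  also have "\<dots> \<le> 4 * (1 - (norm z)\<^sup>2) / ((norm (\<zeta> - z))\<^sup>2 * norm (\<zeta> - z))"
    using wge a0 b0 z by (intro divide_left_mono mult_left_mono mult_pos_pos) (auto simp: power_le_one)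
  finally show ?thesis by (simp add: w_def power3_eq_cube power2_eq_square)
qed

text \<open>A derivative \<open>c\<close> of \<open>G\<close> along the circle forces the
  nontangential limit \<open>c\<close> of its complex derivative \<open>f\<close>. Cauchy's formula,
  with the reflected kernel subtracted, represents \<open>f z - c\<close> by the remainder
  \<open>D\<close>. The local smallness of \<open>D\<close> is integrated against a multiple of the
  Poisson kernel, and the rest is of order \<open>1 - norm z ^ 2\<close>.\<close>

lemma nt_limit_of_boundary_derivative:
  assumes cont: "continuous_on (cball 0 1) G" and der: "\<And>z. z \<in> ball 0 1 \<Longrightarrow> (G has_field_derivative f z) (at z)"
    and \<zeta>0: "norm \<zeta>0 = 1"
    and lip: "\<And>\<zeta>. norm \<zeta> = 1 \<Longrightarrow> norm (G \<zeta> - G \<zeta>0 - c * (\<zeta> - \<zeta>0)) \<le> K * norm (\<zeta> - \<zeta>0)"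
    and loc: "\<And>e. e > 0 \<Longrightarrow> \<exists>d>0. \<forall>\<zeta>. norm \<zeta> = 1 \<longrightarrow> norm (\<zeta> - \<zeta>0) < d \<longrightarrow>
                norm (G \<zeta> - G \<zeta>0 - c * (\<zeta> - \<zeta>0)) \<le> e * norm (\<zeta> - \<zeta>0)"
  shows "has_nt_limit f \<zeta>0 c"
proof (rule has_nt_limitI)
  fix \<alpha> e0 :: real assume \<alpha>: "\<alpha> > 1" and e0: "e0 > 0"
  define D where "D = (\<lambda>u. G u - G \<zeta>0 - c * (u - \<zeta>0))"
  \<comment> \<open>Chosen so that the local part contributes
    \<open>4 * (1 + \<alpha>) * e = e0 / 2\<close>.\<close>
  define e where "e = e0 / (8 * (1 + \<alpha>))"
  have e: "e > 0" using e0 \<alpha> by (simp add: e_def)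
  obtain d where d: "d > 0" "\<And>\<zeta>. norm \<zeta> = 1 \<Longrightarrow> norm (\<zeta> - \<zeta>0) < d \<Longrightarrow> norm (D \<zeta>) \<le> e * norm (\<zeta> - \<zeta>0)"
    using loc[OF e] unfolding D_def by blast
  define C where "C = max K 0 / d\<^sup>2"
  have C: "C \<ge> 0" by (simp add: C_def)
  \<comment> \<open>The cubic term absorbs the far part of the circle; against the cubic decay of
    the kernel difference it leaves only a multiple of \<open>1 - norm z ^ 2\<close>.\<close>
  have Db: "norm (D \<zeta>) \<le> e * norm (\<zeta> - \<zeta>0) + C * (norm (\<zeta> - \<zeta>0)) ^ 3" if "norm \<zeta> = 1" for \<zeta>
  proof (cases "norm (\<zeta> - \<zeta>0) < d")
    case True
    then show ?thesis using d(2)[OF that] C by (simp add: add_increasing2)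
  next
    case False
    have "norm (D \<zeta>) \<le> max K 0 * norm (\<zeta> - \<zeta>0)"
      using lip[OF that] mult_right_mono[of K "max K 0" "norm (\<zeta> - \<zeta>0)"] by (simp add: D_def)
    also have "\<dots> = C * d\<^sup>2 * norm (\<zeta> - \<zeta>0)" using d by (simp add: C_def)
    also have "\<dots> \<le> C * (norm (\<zeta> - \<zeta>0))\<^sup>2 * norm (\<zeta> - \<zeta>0)"
      using False d C by (intro mult_right_mono mult_left_mono power_mono) auto
    also have "\<dots> = C * (norm (\<zeta> - \<zeta>0)) ^ 3" by (simp add: power2_eq_square power3_eq_cube)
    finally show ?thesis using e by (simp add: add_increasing)
  qed
  define B where "B = 4 * C * (1 + \<alpha>) ^ 3"
  have B: "B \<ge> 0" using C \<alpha> by (simp add: B_def)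
  have est: "norm (f z - c) \<le> e0 / 2 + B * (2 * norm (z - \<zeta>0))"
    if z: "z \<in> stolz \<alpha> \<zeta>0" "1/2 \<le> norm z" for z
  proof -
    have z1: "norm z < 1" and st: "norm (z - \<zeta>0) < \<alpha> * (1 - norm z)" using z by (auto simp: stolz_def)
    have zb: "z \<in> ball 0 1" using z1 by simp
    have z0: "cnj z \<noteq> 0" using z by auto
    define w where "w = 1 / cnj z"
    have w1: "norm w > 1" using z1 z0 by (simp add: w_def norm_divide field_simps)
    have contD: "continuous_on (cball 0 1) D" unfolding D_def by (intro continuous_intros cont)
    have holD: "D holomorphic_on ball 0 1"
      unfolding D_def using der
      by (intro holomorphic_intros) (auto simp: holomorphic_on_open field_differentiable_def intro!: exI)
    have "(D has_field_derivative f z - c) (at z)"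
      unfolding D_def using der[OF zb] by (auto intro!: derivative_eq_intros)
    then have dD: "deriv D z = f z - c" by (rule DERIV_imp_deriv)
    have wn: "u - w \<noteq> 0" if "norm u \<le> 1" for u using that w1 by auto
    have zn: "u - z \<noteq> 0" if "norm u = 1" for u using that z1 by auto
    have I1: "(\<integral>t. D (cis t) / (cis t - z)\<^sup>2 * cis t \<partial>circ) = f z - c"
      using circ_Cauchy_derivative[OF contD holD z1] dD by simp
    have I2: "(\<integral>t. D (cis t) / (cis t - w)\<^sup>2 * cis t \<partial>circ) = 0"
      using wn by (intro circ_Cauchy_theorem continuous_intros contD holomorphic_intros holD) auto
    have c1: "continuous_on {0..2*pi} (\<lambda>t. D (cis t) / (cis t - z)\<^sup>2 * cis t)"
      "continuous_on {0..2*pi} (\<lambda>t. D (cis t) / (cis t - w)\<^sup>2 * cis t)"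
      using zn wn by (auto intro!: continuous_intros continuous_on_compose2[OF contD])
    have eq: "f z - c = (\<integral>t. D (cis t) / (cis t - z)\<^sup>2 * cis t - D (cis t) / (cis t - w)\<^sup>2 * cis t \<partial>circ)"
      using I1 I2 c1[THEN integrable_circ_continuous] by simp
    have "norm (f z - c) \<le> (\<integral>t. norm (D (cis t) / (cis t - z)\<^sup>2 * cis t - D (cis t) / (cis t - w)\<^sup>2 * cis t) \<partial>circ)"
      unfolding eq by (rule integral_norm_bound)
    also have "\<dots> \<le> (\<integral>t. (4 * (1 + \<alpha>) * e) * poisson z (cis t) + B * (1 - (norm z)\<^sup>2) \<partial>circ)"
    proof (rule integral_mono)
      show "integrable circ (\<lambda>t. norm (D (cis t) / (cis t - z)\<^sup>2 * cis t - D (cis t) / (cis t - w)\<^sup>2 * cis t))"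
        using c1[THEN integrable_circ_continuous] by simp
      show "integrable circ (\<lambda>t. (4 * (1 + \<alpha>) * e) * poisson z (cis t) + B * (1 - (norm z)\<^sup>2))"
        using integrable_circ_continuous[OF continuous_on_poisson_cis[OF z1]] by simp
      fix t
      let ?\<zeta> = "cis t"
      define a where "a = norm (?\<zeta> - z)"
      define b where "b = norm (?\<zeta> - \<zeta>0)"
      have a0: "a > 0" using zn[of ?\<zeta>] by (simp add: a_def)
      have q: "1 - (norm z)\<^sup>2 \<ge> 0" using z1 by (simp add: power_le_one)
      \<comment> \<open>Inside the Stolz region the distance of a boundary point to
        \<open>\<zeta>0\<close> is controlled by its distance to \<open>z\<close>.\<close>
      have "b \<le> a + norm (z - \<zeta>0)" unfolding a_def b_def using norm_triangle_ineq[of "?\<zeta> - z" "z - \<zeta>0"] by simp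
      also have "\<dots> \<le> a + \<alpha> * (1 - norm z)" using st by simp
      also have "\<dots> \<le> a + \<alpha> * a" using norm_diff_sphere_ge[of ?\<zeta> z] \<alpha> by (auto simp: a_def)
      finally have ba: "b \<le> (1 + \<alpha>) * a" by (simp add: algebra_simps)
      have "D ?\<zeta> / (?\<zeta> - z)\<^sup>2 * ?\<zeta> - D ?\<zeta> / (?\<zeta> - w)\<^sup>2 * ?\<zeta> = D ?\<zeta> * ?\<zeta> * (1 / (?\<zeta> - z)\<^sup>2 - 1 / (?\<zeta> - w)\<^sup>2)"
        by (simp add: algebra_simps)
      then have "norm (D ?\<zeta> / (?\<zeta> - z)\<^sup>2 * ?\<zeta> - D ?\<zeta> / (?\<zeta> - w)\<^sup>2 * ?\<zeta>) = norm (D ?\<zeta>) * norm (1 / (?\<zeta> - z)\<^sup>2 - 1 / (?\<zeta> - w)\<^sup>2)"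
        by (simp add: norm_mult)
      also have "\<dots> \<le> (e * b + C * b ^ 3) * (4 * (1 - (norm z)\<^sup>2) / a ^ 3)"
        using Db[of ?\<zeta>] reflected_Cauchy_kernel_bound[of ?\<zeta> z] z z1 unfolding a_def b_def w_def
        by (intro mult_mono) (auto intro!: add_nonneg_nonneg mult_nonneg_nonneg simp: e[THEN less_imp_le] C)
      also have "\<dots> \<le> (e * ((1 + \<alpha>) * a) + C * ((1 + \<alpha>) * a) ^ 3) * (4 * (1 - (norm z)\<^sup>2) / a ^ 3)"
        using ba e C q a0 by (intro mult_right_mono add_mono mult_left_mono power_mono divide_nonneg_pos)
          (auto simp: b_def)
      also have "\<dots> = (4 * (1 + \<alpha>) * e) * ((1 - (norm z)\<^sup>2) / a\<^sup>2) + B * (1 - (norm z)\<^sup>2)"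
        using a0 by (simp add: B_def power_mult_distrib field_simps power2_eq_square power3_eq_cube)
      also have "(1 - (norm z)\<^sup>2) / a\<^sup>2 = poisson z ?\<zeta>" by (simp add: poisson_def a_def)
      finally show "norm (D ?\<zeta> / (?\<zeta> - z)\<^sup>2 * ?\<zeta> - D ?\<zeta> / (?\<zeta> - w)\<^sup>2 * ?\<zeta>) \<le> (4 * (1 + \<alpha>) * e) * poisson z ?\<zeta> + B * (1 - (norm z)\<^sup>2)" .
    qed
    also have "\<dots> = 4 * (1 + \<alpha>) * e + B * (1 - (norm z)\<^sup>2)"
      using integrable_circ_continuous[OF continuous_on_poisson_cis[OF z1]] poisson_mean[OF z1]
      by (simp add: circ.prob_space[unfolded space_circ])
    also have "4 * (1 + \<alpha>) * e = e0 / 2" using \<alpha> by (simp add: e_def field_simps)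
    also have "1 - (norm z)\<^sup>2 \<le> 2 * norm (z - \<zeta>0)"
    proof -
      have "1 - (norm z)\<^sup>2 = (1 + norm z) * (1 - norm z)" by (simp add: algebra_simps power2_eq_square)
      also have "\<dots> \<le> 2 * (1 - norm z)" using z1 by (intro mult_right_mono) auto
      also have "\<dots> \<le> 2 * norm (z - \<zeta>0)" using norm_diff_sphere_ge[OF \<zeta>0, of z] by (simp add: norm_minus_commute)
      finally show ?thesis .
    qed
    then have "e0 / 2 + B * (1 - (norm z)\<^sup>2) \<le> e0 / 2 + B * (2 * norm (z - \<zeta>0))"
      using B by (intro add_left_mono mult_left_mono)
    finally show ?thesis .
  qed
  \<comment> \<open>The bound 1/2 ensures \<open>norm z \<ge> 1 / 2\<close>, as the kernel estimate
    requires; the other one makes the term with \<open>B\<close> at most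
    \<open>e0 / 2\<close>.\<close>
  define d' where "d' = min (1/2) (e0 / (4 * (B + 1)))"
  show "\<exists>d>0. \<forall>z\<in>stolz \<alpha> \<zeta>0. norm (z - \<zeta>0) < d \<longrightarrow> norm (f z - c) \<le> e0"
  proof (intro exI[of _ d'] conjI ballI impI)
    show "d' > 0" using e0 B by (simp add: d'_def)
    fix z assume z: "z \<in> stolz \<alpha> \<zeta>0" "norm (z - \<zeta>0) < d'"
    have "norm z \<ge> 1/2" using norm_triangle_ineq2[of \<zeta>0 "\<zeta>0 - z"] z(2) \<zeta>0 by (auto simp: d'_def norm_minus_commute)
    from est[OF z(1) this] have "norm (f z - c) \<le> e0 / 2 + B * (2 * norm (z - \<zeta>0))" .
    also have "B * (2 * norm (z - \<zeta>0)) \<le> (B + 1) * (2 * (e0 / (4 * (B + 1))))"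
      using z(2) B e0 by (intro mult_mono) (auto simp: d'_def)
    also have "\<dots> = e0 / 2" using B by (simp add: field_simps)
    finally show "norm (f z - c) \<le> e0" by simp
  qed
qed

text \<open>Write \<open>\<zeta> = \<zeta>0 * (1 + x)\<close> on the circle: \<open>Im x\<close> is
  the angle to first order and \<open>Re x\<close> is of second order. So a derivative in the angle
  is, up to the factor \<open>\<i> * cis t0\<close>, a complex derivative along the circle.\<close>

lemma boundary_derivative_of_vector_derivative:
  fixes G :: "complex \<Rightarrow> complex"
  assumes der: "((\<lambda>t. G (cis t)) has_vector_derivative D) (at t0)" and e: "e > 0"
  shows "\<exists>d>0. \<forall>\<zeta>. norm \<zeta> = 1 \<longrightarrow> norm (\<zeta> - cis t0) < d \<longrightarrow>
           norm (G \<zeta> - G (cis t0) - D / (\<i> * cis t0) * (\<zeta> - cis t0)) \<le> e * norm (\<zeta> - cis t0)"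
proof -
  define \<zeta>0 where "\<zeta>0 = cis t0"
  have n0: "norm \<zeta>0 = 1" "\<zeta>0 \<noteq> 0" by (auto simp: \<zeta>0_def)
  \<comment> \<open>A local angle coordinate: \<open>cis (\<tau> \<zeta>) = \<zeta>\<close> on the
    circle, differentiable at \<open>\<zeta>0\<close> because \<open>Ln\<close> is so at 1.\<close>
  define \<tau> where "\<tau> = (\<lambda>\<zeta>. t0 + Im (Ln (\<zeta> / \<zeta>0)))"
  have cis\<tau>: "cis (\<tau> \<zeta>) = \<zeta>" if "norm \<zeta> = 1" for \<zeta>
  proof -
    have ne: "\<zeta> / \<zeta>0 \<noteq> 0" using that n0 by auto
    have "Re (Ln (\<zeta> / \<zeta>0)) = 0" using that n0 ne by (simp add: norm_divide)
    then have "cis (Im (Ln (\<zeta> / \<zeta>0))) = exp (Ln (\<zeta> / \<zeta>0))" by (simp add: exp_eq_polar)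
    then have "cis (Im (Ln (\<zeta> / \<zeta>0))) = \<zeta> / \<zeta>0" using ne by simp
    then show ?thesis using n0 by (simp add: \<tau>_def cis_mult[symmetric] \<zeta>0_def)
  qed
  have "((\<lambda>\<zeta>. Ln (\<zeta> / \<zeta>0)) has_field_derivative 1 / \<zeta>0) (at \<zeta>0)"
    using n0 by (auto intro!: derivative_eq_intros simp: complex_nonpos_Reals_iff)
  then have "((\<lambda>\<zeta>. Ln (\<zeta> / \<zeta>0)) has_derivative (*) (1 / \<zeta>0)) (at \<zeta>0)" by (simp add: has_field_derivative_def)
  then have \<tau>d: "(\<tau> has_derivative (\<lambda>h. Im (1 / \<zeta>0 * h))) (at \<zeta>0)"
    unfolding \<tau>_def by (auto intro!: derivative_eq_intros)
  have \<tau>0: "\<tau> \<zeta>0 = t0" using n0 by (simp add: \<tau>_def)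
  have "((\<lambda>\<zeta>. G (cis (\<tau> \<zeta>))) has_derivative (\<lambda>h. Im (1 / \<zeta>0 * h) *\<^sub>R D)) (at \<zeta>0)"
    using has_derivative_compose[OF \<tau>d, of "\<lambda>t. G (cis t)" "\<lambda>s. s *\<^sub>R D"] der \<tau>0
    by (simp add: has_vector_derivative_def)
  then have "\<exists>d>0. \<forall>y. norm (y - \<zeta>0) < d \<longrightarrow> norm (G (cis (\<tau> y)) - G (cis (\<tau> \<zeta>0)) - Im (1 / \<zeta>0 * (y - \<zeta>0)) *\<^sub>R D) \<le> (e/2) * norm (y - \<zeta>0)"
    using e unfolding has_derivative_at_alt by (meson half_gt_zero)
  then obtain d where d: "d > 0" "\<And>y. norm (y - \<zeta>0) < d \<Longrightarrow> norm (G (cis (\<tau> y)) - G (cis (\<tau> \<zeta>0)) - Im (1 / \<zeta>0 * (y - \<zeta>0)) *\<^sub>R D) \<le> (e/2) * norm (y - \<zeta>0)"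
    by blast
  show ?thesis
    unfolding \<zeta>0_def[symmetric]
  \<comment> \<open>The second bound makes the radial error \<open>norm D * norm x ^ 2 / 2\<close>
    at most half of the allowance.\<close>
  proof (intro exI[of _ "min d (e / (norm D + 1))"] conjI allI impI)
    show "0 < min d (e / (norm D + 1))" using d e by (auto intro!: divide_pos_pos add_nonneg_pos)
    fix \<zeta> assume \<zeta>: "norm \<zeta> = 1" "norm (\<zeta> - \<zeta>0) < min d (e / (norm D + 1))"
    define x where "x = (\<zeta> - \<zeta>0) / \<zeta>0"
    have nx: "norm x = norm (\<zeta> - \<zeta>0)" using n0 by (simp add: x_def norm_divide)
    have "1 + x = \<zeta> / \<zeta>0" using n0 by (simp add: x_def field_simps)
    then have "norm (1 + x) = 1" using n0 \<zeta> by (simp add: norm_divide)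
    then have "(norm (1 + x))\<^sup>2 = 1" by simp
    then have "(1 + Re x)\<^sup>2 + (Im x)\<^sup>2 = 1" by (simp add: cmod_power2)
    then have Rex: "2 * Re x = - (norm x)\<^sup>2" unfolding cmod_power2 by (simp add: power2_eq_square algebra_simps)
    have "D / (\<i> * \<zeta>0) * (\<zeta> - \<zeta>0) = D * (x / \<i>)" using n0 by (simp add: x_def field_simps)
    also have "x / \<i> = of_real (Im x) - \<i> * of_real (Re x)" by (simp add: complex_eq_iff)
    finally have eq: "D / (\<i> * \<zeta>0) * (\<zeta> - \<zeta>0) = Im x *\<^sub>R D - D * \<i> * of_real (Re x)"
      by (simp add: scaleR_conv_of_real algebra_simps)
    have "G \<zeta> - G \<zeta>0 - D / (\<i> * \<zeta>0) * (\<zeta> - \<zeta>0) = (G \<zeta> - G \<zeta>0 - Im x *\<^sub>R D) + D * \<i> * of_real (Re x)"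
      unfolding eq by simp
    also have "norm \<dots> \<le> norm (G \<zeta> - G \<zeta>0 - Im x *\<^sub>R D) + norm (D * \<i> * of_real (Re x))" by (rule norm_triangle_ineq)
    also have "norm (G \<zeta> - G \<zeta>0 - Im x *\<^sub>R D) \<le> (e/2) * norm (\<zeta> - \<zeta>0)"
      using d(2)[of \<zeta>] \<zeta> cis\<tau>[OF \<zeta>(1)] cis\<tau>[OF n0(1)] by (simp add: x_def)
    also have "norm (D * \<i> * of_real (Re x)) = norm D * (norm x)\<^sup>2 / 2"
    proof -
      have "\<bar>Re x\<bar> = (norm x)\<^sup>2 / 2" using Rex zero_le_power2[of "norm x"] by linarith
      then show ?thesis by (simp add: norm_mult)
    qed
    also have "\<dots> \<le> (e/2) * norm (\<zeta> - \<zeta>0)"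
    proof -
      have "norm D * norm (\<zeta> - \<zeta>0) \<le> (norm D + 1) * (e / (norm D + 1))" using \<zeta> e by (intro mult_mono) auto
      also have "\<dots> = e" by (simp add: add_nonneg_eq_0_iff)
      finally have "norm D * norm (\<zeta> - \<zeta>0) * norm (\<zeta> - \<zeta>0) \<le> e * norm (\<zeta> - \<zeta>0)" by (intro mult_right_mono) auto
      then show ?thesis by (simp add: nx power2_eq_square)
    qed
    finally show "norm (G \<zeta> - G \<zeta>0 - D / (\<i> * \<zeta>0) * (\<zeta> - \<zeta>0)) \<le> e * norm (\<zeta> - \<zeta>0)" by simp
  qed
qed

text \<open>A primitive of \<open>f\<close> is Lipschitz on the disc and extends to the closed disc.
  On the circle it is a Lipschitz function of the angle, hence differentiable almost everywhere, and
  each such derivative yields a nontangential limit of \<open>f\<close>.\<close>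

theorem Fatou_bounded_holomorphic:
  assumes hol: "f holomorphic_on ball 0 1" and bd: "\<And>z. z \<in> ball 0 1 \<Longrightarrow> norm (f z) \<le> M"
  shows "AE t in circ. \<exists>L. has_nt_limit f (cis t) L"
proof -
  have M0: "M \<ge> 0" using order.trans[OF norm_ge_zero bd[of 0]] by simp
  obtain G0 where G0: "\<And>z. z \<in> ball 0 1 \<Longrightarrow> (G0 has_field_derivative f z) (at z within ball 0 1)"
    using holomorphic_convex_primitive'[OF convex_ball open_ball hol] by blast
  have lip0: "M-lipschitz_on (ball 0 1) G0"
  proof (rule lipschitz_onI[OF _ M0])
    fix x y :: complex assume "x \<in> ball 0 1" "y \<in> ball 0 1"
    then show "dist (G0 x) (G0 y) \<le> M * dist x y"
      unfolding dist_norm by (intro field_differentiable_bound[OF convex_ball G0 bd]) auto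
  qed
  obtain G where G: "uniformly_continuous_on (closure (ball 0 1)) G" "\<And>x. x \<in> ball 0 1 \<Longrightarrow> G0 x = G x"
    using uniformly_continuous_on_extension_on_closure[OF lipschitz_on_uniformly_continuous[OF lip0]] by metis
  have cl: "closure (ball (0::complex) 1) = cball 0 1" by simp
  have contG: "continuous_on (cball 0 1) G" using G(1) uniformly_continuous_imp_continuous by fastforce
  have "M-lipschitz_on (ball 0 1) G" using lip0 G(2) by (auto simp: lipschitz_on_def)
  then have lipG: "M-lipschitz_on (cball 0 1) G"
    using lipschitz_on_closure[of M "ball 0 1" G] contG by simp
  have derG: "(G has_field_derivative f z) (at z)" if "z \<in> ball 0 1" for z
  proof -
    have "(G0 has_field_derivative f z) (at z)" using G0[OF that] that by (metis at_within_open open_ball)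
    then show ?thesis
      by (rule has_field_derivative_transform_within_open[OF _ open_ball that]) (rule G(2))
  qed
  have cisl: "norm (cis s - cis t) \<le> 1 * norm (s - t)" for s t
  proof (rule differentiable_bound[of UNIV cis "\<lambda>x h. h *\<^sub>R (\<i> * cis x)"])
    show "(cis has_derivative (\<lambda>h. h *\<^sub>R (\<i> * cis x))) (at x within UNIV)" for x
    proof -
      have "((\<lambda>b. \<i> * complex_of_real b) has_vector_derivative \<i>) (at x)"
        by (auto intro!: derivative_eq_intros simp: has_vector_derivative_def scaleR_conv_of_real fun_eq_iff)
      from field_vector_diff_chain_at[OF this DERIV_exp] show ?thesis
        by (simp add: has_vector_derivative_def comp_def cis_conv_exp[abs_def])
    qed
    show "onorm (\<lambda>h. h *\<^sub>R (\<i> * cis x)) \<le> 1" for x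
      by (rule onorm_le) (simp add: norm_mult)
  qed auto
  have gl: "norm (G (cis s) - G (cis t)) \<le> M * \<bar>s - t\<bar>" for s t
  proof -
    have "norm (G (cis s) - G (cis t)) \<le> M * norm (cis s - cis t)"
      using lipschitz_onD[OF lipG, of "cis s" "cis t"] by (simp add: dist_norm)
    also have "\<dots> \<le> M * \<bar>s - t\<bar>" using cisl[of s t] M0 by (intro mult_left_mono) auto
    finally show ?thesis .
  qed
  have "M-lipschitz_on UNIV (\<lambda>t. Re (G (cis t)))" "M-lipschitz_on UNIV (\<lambda>t. Im (G (cis t)))"
    using gl M0 by (auto simp: lipschitz_on_def dist_real_def intro: order.trans[OF abs_Re_le_cmod[of "_ - _", simplified]] order.trans[OF abs_Im_le_cmod[of "_ - _", simplified]])
  from this[THEN Lipschitz_AE_differentiable]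
  have "AE t in lborel. \<exists>L. has_nt_limit f (cis t) L"
  proof eventually_elim
    case (elim t)
    then obtain D1 D2 where "((\<lambda>t. Re (G (cis t))) has_real_derivative D1) (at t)" "((\<lambda>t. Im (G (cis t))) has_real_derivative D2) (at t)"
      by blast
    then have der: "((\<lambda>t. G (cis t)) has_vector_derivative Complex D1 D2) (at t)"
      unfolding has_vector_derivative_complex_iff by (simp add: has_real_derivative_iff_has_vector_derivative)
    define c where "c = Complex D1 D2 / (\<i> * cis t)"
    have "has_nt_limit f (cis t) c"
    proof (rule nt_limit_of_boundary_derivative[OF contG derG norm_cis])
      fix \<zeta> :: complex assume "norm \<zeta> = 1"
      have "norm (G \<zeta> - G (cis t) - c * (\<zeta> - cis t)) \<le> norm (G \<zeta> - G (cis t)) + norm (c * (\<zeta> - cis t))"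
        by (rule norm_triangle_ineq4)
      also have "\<dots> \<le> M * norm (\<zeta> - cis t) + norm c * norm (\<zeta> - cis t)"
        using lipschitz_onD[OF lipG, of \<zeta> "cis t"] \<open>norm \<zeta> = 1\<close> by (simp add: dist_norm norm_mult)
      finally show "norm (G \<zeta> - G (cis t) - c * (\<zeta> - cis t)) \<le> (M + norm c) * norm (\<zeta> - cis t)"
        by (simp add: distrib_right)
    next
      fix e :: real assume "e > 0"
      then show "\<exists>d>0. \<forall>\<zeta>. norm \<zeta> = 1 \<longrightarrow> norm (\<zeta> - cis t) < d \<longrightarrow> norm (G \<zeta> - G (cis t) - c * (\<zeta> - cis t)) \<le> e * norm (\<zeta> - cis t)"
        unfolding c_def by (rule boundary_derivative_of_vector_derivative[OF der])
    qed
    then show ?case by blast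
  qed
  then show ?thesis by (rule AE_circI)
qed

text \<open>Existence of a nontangential limit is a Cauchy criterion in Stolz regions. The sets
  \<open>C\<close> in it are closed, because their complements are unions of sets open in
  \<open>t\<close>. On the resulting Borel set \<open>bv\<close> is the limit along
  \<open>radius\<close>, elsewhere it is 0.\<close>

lemma bv_cis_measurable:
  assumes cont: "continuous_on (ball 0 1) f"
  shows "(\<lambda>t. bv f (cis t)) \<in> borel_measurable circ"
proof (rule borel_measurable_circI)
  define C where "C = (\<lambda>\<alpha> e d. {t. \<forall>z\<in>stolz \<alpha> (cis t). \<forall>w\<in>stolz \<alpha> (cis t).
      norm (z - cis t) < d \<longrightarrow> norm (w - cis t) < d \<longrightarrow> dist (f z) (f w) \<le> e})"
  have "closed (C \<alpha> e d)" for \<alpha> e d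
  proof -
    have "- C \<alpha> e d = (\<Union>(z, w)\<in>{(z, w). norm z < 1 \<and> norm w < 1 \<and> dist (f z) (f w) > e}.
        {t. norm (z - cis t) < \<alpha> * (1 - norm z)} \<inter> {t. norm (w - cis t) < \<alpha> * (1 - norm w)}
        \<inter> {t. norm (z - cis t) < d} \<inter> {t. norm (w - cis t) < d})"
      (is "_ = ?R")
    proof (intro set_eqI iffI)
      fix t assume "t \<in> - C \<alpha> e d"
      then obtain z w where "z \<in> stolz \<alpha> (cis t)" "w \<in> stolz \<alpha> (cis t)" "norm (z - cis t) < d" "norm (w - cis t) < d"
        "\<not> dist (f z) (f w) \<le> e" unfolding C_def by blast
      then show "t \<in> ?R" by (intro UN_I[of "(z, w)"]) (auto simp: stolz_def)
    next
      fix t assume "t \<in> ?R"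
      then obtain z w where zw: "z \<in> stolz \<alpha> (cis t)" "w \<in> stolz \<alpha> (cis t)" "norm (z - cis t) < d" "norm (w - cis t) < d"
        "dist (f z) (f w) > e" by (auto simp: stolz_def)
      show "t \<in> - C \<alpha> e d"
      proof
        assume "t \<in> C \<alpha> e d"
        then have "dist (f z) (f w) \<le> e" using zw unfolding C_def by blast
        then show False using zw by simp
      qed
    qed
    moreover have "open {t. norm (z - cis t) < c}" for z c
      by (intro open_Collect_less continuous_intros)
    ultimately have "open (- C \<alpha> e d)" by (auto intro!: open_UN open_Int)
    then show ?thesis by (simp add: closed_def)
  qed
  then have Cb: "C \<alpha> e d \<in> sets borel" for \<alpha> e d by (simp add: borel_closed)
  \<comment> \<open>Integer apertures suffice because Stolz regions grow with the aperture; starting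
    at 2 keeps them above 1.\<close>
  define A where "A = (\<Inter>n::nat. \<Inter>m::nat. \<Union>k::nat. C (real n + 2) (1 / (real m + 1)) (1 / (real k + 1)))"
  have Ab: "A \<in> sets borel" unfolding A_def using Cb by (intro sets.countable_INT' sets.countable_UN') auto
  have A_iff: "t \<in> A \<longleftrightarrow> (\<exists>L. has_nt_limit f (cis t) L)" for t
  proof
    assume "\<exists>L. has_nt_limit f (cis t) L"
    then obtain L where L: "has_nt_limit f (cis t) L" by blast
    show "t \<in> A"
      unfolding A_def
    proof (intro INT_I)
      fix n m :: nat
      define \<alpha> where "\<alpha> = real n + 2"
      define e where "e = 1 / (real m + 1)"
      have "(f \<longlongrightarrow> L) (at (cis t) within stolz \<alpha> (cis t))" using L by (simp add: has_nt_limit_def \<alpha>_def)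
      moreover have "e / 2 > 0" by (simp add: e_def)
      ultimately obtain d where d: "d > 0" "\<And>z. z \<in> stolz \<alpha> (cis t) \<Longrightarrow> z \<noteq> cis t \<and> dist z (cis t) < d \<Longrightarrow> dist (f z) L < e / 2"
        unfolding tendsto_iff eventually_at by meson
      obtain k :: nat where k: "1 / (real k + 1) < d"
        using nat_approx_posE[OF d(1)] by (metis of_nat_Suc add.commute)
      have ne: "z \<noteq> cis t" if "z \<in> stolz \<alpha> (cis t)" for z using that by (auto simp: stolz_def)
      have "t \<in> C \<alpha> e (1 / (real k + 1))"
        unfolding C_def
      proof (intro CollectI ballI impI)
        fix z w assume "z \<in> stolz \<alpha> (cis t)" "w \<in> stolz \<alpha> (cis t)" "norm (z - cis t) < 1 / (real k + 1)" "norm (w - cis t) < 1 / (real k + 1)"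
        then have "dist (f z) L < e / 2" "dist (f w) L < e / 2"
          using k d(2)[of z] d(2)[of w] ne by (auto simp: dist_norm)
        then show "dist (f z) (f w) \<le> e" using dist_triangle2[of "f z" "f w" L] by simp
      qed
      then show "t \<in> (\<Union>k::nat. C (real n + 2) (1 / (real m + 1)) (1 / (real k + 1)))"
        unfolding \<alpha>_def e_def by blast
    qed
  next
    assume t: "t \<in> A"
    \<comment> \<open>Radial points lie in all these regions, so they provide one candidate limit
      for all apertures.\<close>
    define x where "x = (\<lambda>j. of_real (radius j) * cis t)"
    have flim: "filterlim x (at (cis t) within stolz (real n + 2) (cis t)) sequentially" for n :: nat
      unfolding x_def by (rule filterlim_radial_stolz) (auto simp: radius_bounds radius_tendsto)
    have ev: "eventually (\<lambda>j. x j \<in> stolz (real n + 2) (cis t) \<and> norm (x j - cis t) < d) sequentially" if "d > 0" for n :: nat and d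
    proof -
      have "eventually (\<lambda>j. x j \<in> stolz (real n + 2) (cis t)) sequentially" "x \<longlonglongrightarrow> cis t"
        using flim[of n] by (auto simp: filterlim_at elim: eventually_mono)
      from this(1) tendstoD[OF this(2) that] show ?thesis by eventually_elim (auto simp: dist_norm)
    qed
    have cau: "\<exists>k::nat. t \<in> C (real n + 2) (1 / (real m + 1)) (1 / (real k + 1))" for n m :: nat
      using t unfolding A_def by blast
    have "Cauchy (\<lambda>j. f (x j))"
    proof (rule metric_CauchyI)
      fix e :: real assume "e > 0"
      then obtain m :: nat where m: "1 / (real m + 1) < e"
        using nat_approx_posE by (metis of_nat_Suc add.commute)
      obtain k :: nat where k: "t \<in> C (real 0 + 2) (1 / (real m + 1)) (1 / (real k + 1))" using cau by blast
      obtain N where N: "\<And>j. j \<ge> N \<Longrightarrow> x j \<in> stolz (real 0 + 2) (cis t) \<and> norm (x j - cis t) < 1 / (real k + 1)"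
        using ev[of "1 / (real k + 1)" 0] by (auto simp: eventually_sequentially)
      show "\<exists>M. \<forall>m\<ge>M. \<forall>n\<ge>M. dist (f (x m)) (f (x n)) < e"
      proof (intro exI allI impI)
        fix i j assume "N \<le> i" "N \<le> j"
        then have "dist (f (x i)) (f (x j)) \<le> 1 / (real m + 1)" using k N[of i] N[of j] unfolding C_def by blast
        then show "dist (f (x i)) (f (x j)) < e" using m by simp
      qed
    qed
    then obtain L where L: "(\<lambda>j. f (x j)) \<longlonglongrightarrow> L" using Cauchy_convergent convergent_def by blast
    have "has_nt_limit f (cis t) L"
    proof (rule has_nt_limitI)
      fix \<alpha> e :: real assume "\<alpha> > 1" "e > 0"
      obtain n :: nat where n: "\<alpha> < real n" using reals_Archimedean2 by blast
      obtain m :: nat where m: "1 / (real m + 1) < e"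
        using nat_approx_posE[OF \<open>e > 0\<close>] by (metis of_nat_Suc add.commute)
      obtain k :: nat where k: "t \<in> C (real n + 2) (1 / (real m + 1)) (1 / (real k + 1))" using cau by blast
      show "\<exists>d>0. \<forall>z\<in>stolz \<alpha> (cis t). norm (z - cis t) < d \<longrightarrow> norm (f z - L) \<le> e"
      proof (intro exI[of _ "1 / (real k + 1)"] conjI ballI impI)
        fix z assume z: "z \<in> stolz \<alpha> (cis t)" "norm (z - cis t) < 1 / (real k + 1)"
        have "\<alpha> * (1 - norm z) \<le> (real n + 2) * (1 - norm z)" using n z by (intro mult_right_mono) (auto simp: stolz_def)
        moreover have "norm (z - cis t) < \<alpha> * (1 - norm z)" using z by (simp add: stolz_def)
        ultimately have "norm (z - cis t) < (real n + 2) * (1 - norm z)" by linarith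
        then have z': "z \<in> stolz (real n + 2) (cis t)" using z by (simp add: stolz_def)
        have kp: "1 / (real k + 1) > 0" by simp
        have "eventually (\<lambda>j. norm (f z - f (x j)) \<le> e) sequentially"
          using ev[OF kp, of n]
        proof eventually_elim
          case (elim j)
          then have "dist (f z) (f (x j)) \<le> 1 / (real m + 1)" using k z' z(2) unfolding C_def by blast
          then show ?case using m by (simp add: dist_norm)
        qed
        moreover have "(\<lambda>j. norm (f z - f (x j))) \<longlonglongrightarrow> norm (f z - L)" by (intro tendsto_intros L)
        ultimately show "norm (f z - L) \<le> e" by (intro tendsto_upperbound) auto
      qed simp
    qed
    then show "\<exists>L. has_nt_limit f (cis t) L" by blast
  qed
  have eq: "bv f (cis t) = (if t \<in> A then lim (\<lambda>j. f (of_real (radius j) * cis t)) else 0)" for t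
  proof (cases "t \<in> A")
    case True
    then obtain L where L: "has_nt_limit f (cis t) L" using A_iff by blast
    have "lim (\<lambda>j. f (of_real (radius j) * cis t)) = L"
      using has_nt_limit_radial[OF L norm_cis radius_tendsto radius_bounds] by (rule limI)
    then show ?thesis using True bv_eq[OF L norm_cis] by simp
  next
    case False
    then show ?thesis using A_iff[of t] unfolding bv_def by (metis (no_types))
  qed
  have "(\<lambda>t. f (of_real (radius j) * cis t)) \<in> borel_measurable borel" for j
    using radius_bounds[of j]
    by (intro borel_measurable_continuous_onI continuous_on_compose2[OF cont] continuous_intros) (auto simp: norm_mult)
  then have "(\<lambda>t. lim (\<lambda>j. f (of_real (radius j) * cis t))) \<in> borel_measurable borel"
    by (rule borel_measurable_lim_metric)
  then show "(\<lambda>t. bv f (cis t)) \<in> borel_measurable borel"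
    unfolding eq using Ab by (intro measurable_If_set) auto
qed

section \<open>Orlicz classes under the doubling condition\<close>

locale orlicz_function =
  fixes \<phi> :: "real \<Rightarrow> real"
  assumes sc: "strongly_convex \<phi>" and D2: "Delta2 \<phi>"
begin

lemma phi_convex: "convex_on UNIV \<phi>" and phi_mono: "mono \<phi>" and phi_nonneg: "0 \<le> \<phi> t"
  using sc by (auto simp: strongly_convex_def)

sublocale superlinear_convex \<phi>
proof
  show "continuous_on UNIV \<phi>" by (rule convex_on_continuous[OF open_UNIV phi_convex])
  show "convex_on {0..} \<phi>" using phi_convex by (rule convex_on_subset) auto
qed (use sc in \<open>auto simp: strongly_convex_def\<close>)

lemma in_Lphi_iff:
  "in_Lphi \<phi> u \<longleftrightarrow> (\<lambda>t. u (cis t)) \<in> borel_measurable circ \<and> integrable circ (\<lambda>t. \<phi> \<bar>u (cis t)\<bar>)"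
  by (simp add: in_Lphi_def circ_measurable_iff circ_integrable_iff)

lemma in_Lphi_circ_integrable:
  assumes "in_Lphi \<phi> u"
  shows "circ_integrable u"
proof -
  have "integrable circ (\<lambda>t. \<bar>u (cis t)\<bar>)"
    by (rule integrable_of_integrable_Young[OF circ.finite_measure_axioms])
      (use assms in \<open>auto simp: in_Lphi_iff\<close>)
  then show ?thesis
    using assms unfolding circ_integrable_iff in_Lphi_iff by (subst (asm) integrable_abs_iff) auto
qed

lemma in_Lphi_bound:
  assumes u: "in_Lphi \<phi> u" and m: "(\<lambda>t. v (cis t)) \<in> borel_measurable circ"
    and le: "\<And>t. \<phi> \<bar>v (cis t)\<bar> \<le> a * \<phi> \<bar>u (cis t)\<bar> + b"
  shows "in_Lphi \<phi> v"
  unfolding in_Lphi_iff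
proof
  have "integrable circ (\<lambda>t. a * \<phi> \<bar>u (cis t)\<bar> + b)" using u by (simp add: in_Lphi_iff)
  then show "integrable circ (\<lambda>t. \<phi> \<bar>v (cis t)\<bar>)"
    by (rule Bochner_Integration.integrable_bound)
      (use m le phi_nonneg in \<open>auto intro!: AE_I2 order.trans[OF _ abs_ge_self]\<close>)
qed fact

lemma in_Lphi_const: "in_Lphi \<phi> (\<lambda>_. c)"
  by (simp add: in_Lphi_iff)

text \<open>This is where the doubling condition enters: it makes the Orlicz class a vector
  space.\<close>

lemma in_Lphi_add:
  assumes u: "in_Lphi \<phi> u" and v: "in_Lphi \<phi> v"
  shows "in_Lphi \<phi> (\<lambda>\<zeta>. u \<zeta> + v \<zeta>)"
proof -
  obtain c t0 where c: "c \<ge> 1" "\<And>a b. a \<ge> t0 \<Longrightarrow> b \<ge> t0 \<Longrightarrow> \<phi> (a + b) \<le> c * (\<phi> a + \<phi> b)"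
    using D2 unfolding Delta2_def by blast
  have le: "\<phi> \<bar>x + y\<bar> \<le> c * \<phi> \<bar>x\<bar> + (c * \<phi> \<bar>y\<bar> + 2 * c * \<phi> t0)" for x y
  proof -
    \<comment> \<open>Raising both arguments to at least \<open>t0\<close> brings them into the
      range of the doubling inequality, at the bounded cost \<open>\<phi> t0\<close>.\<close>
    have mx: "\<phi> (max s t0) \<le> \<phi> s + \<phi> t0" for s using phi_nonneg by (simp add: max_def)
    have "\<phi> \<bar>x + y\<bar> \<le> \<phi> (max \<bar>x\<bar> t0 + max \<bar>y\<bar> t0)" by (rule monoD[OF phi_mono]) linarith
    also have "\<dots> \<le> c * (\<phi> (max \<bar>x\<bar> t0) + \<phi> (max \<bar>y\<bar> t0))" by (rule c(2)) auto
    also have "\<dots> \<le> c * ((\<phi> \<bar>x\<bar> + \<phi> t0) + (\<phi> \<bar>y\<bar> + \<phi> t0))"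
      using c(1) mx by (intro mult_left_mono add_mono) auto
    finally show ?thesis by (simp add: algebra_simps)
  qed
  have i: "integrable circ (\<lambda>t. c * \<phi> \<bar>u (cis t)\<bar> + (c * \<phi> \<bar>v (cis t)\<bar> + 2 * c * \<phi> t0))"
    using u v by (simp add: in_Lphi_iff)
  have m: "(\<lambda>t. u (cis t) + v (cis t)) \<in> borel_measurable circ" using u v by (auto simp: in_Lphi_iff)
  have "integrable circ (\<lambda>t. \<phi> \<bar>u (cis t) + v (cis t)\<bar>)"
    by (rule Bochner_Integration.integrable_bound[OF i])
      (use m le phi_nonneg in \<open>auto intro!: AE_I2 order.trans[OF _ abs_ge_self]\<close>)
  then show ?thesis using m by (simp add: in_Lphi_iff)
qed

text \<open>Natural multiples are repeated sums; other factors follow by monotonicity of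
  \<open>\<phi>\<close>.\<close>

lemma in_Lphi_cmult:
  assumes u: "in_Lphi \<phi> u"
  shows "in_Lphi \<phi> (\<lambda>\<zeta>. c * u \<zeta>)"
proof -
  have n: "in_Lphi \<phi> (\<lambda>\<zeta>. real n * u \<zeta>)" for n
  proof (induction n)
    case 0
    show ?case using in_Lphi_const[of 0] by simp
  next
    case (Suc n)
    show ?case using in_Lphi_add[OF Suc u] by (simp add: algebra_simps)
  qed
  obtain n :: nat where "\<bar>c\<bar> \<le> real n" using real_arch_simple by blast
  then have "\<phi> \<bar>c * u \<zeta>\<bar> \<le> 1 * \<phi> \<bar>real n * u \<zeta>\<bar> + 0" for \<zeta>
    by (simp add: abs_mult) (intro monoD[OF phi_mono] mult_right_mono, auto)
  then show ?thesis using u by (intro in_Lphi_bound[OF n[of n], of _ 1 0]) (auto simp: in_Lphi_iff)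
qed

lemma phi_subgradient: "\<exists>a. \<forall>y. \<phi> x + a * (y - x) \<le> \<phi> y"
  using convex_le_Inf_differential[OF phi_convex, of x] by auto

text \<open>Jensen's inequality for the probability measure with density \<open>poisson z\<close>:
  integrate a supporting line of \<open>\<phi>\<close> at \<open>poisson_int v z\<close>.\<close>

lemma phi_poisson_int_le:
  assumes z: "norm z < 1" and v: "circ_integrable v" "circ_integrable (\<lambda>\<zeta>. \<phi> (v \<zeta>))"
  shows "\<phi> (poisson_int v z) \<le> poisson_int (\<lambda>\<zeta>. \<phi> (v \<zeta>)) z"
proof -
  define x where "x = poisson_int v z"
  obtain a where a: "\<And>y. \<phi> x + a * (y - x) \<le> \<phi> y" using phi_subgradient by blast
  have i: "circ_integrable (\<lambda>\<zeta>. a * v \<zeta>)" "circ_integrable (\<lambda>_. \<phi> x - a * x)" using v by (auto simp: circ_integrable_iff)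
  have "\<phi> x = poisson_int (\<lambda>\<zeta>. a * v \<zeta> + (\<phi> x - a * x)) z"
    using poisson_int_add[OF z i] by (simp add: poisson_int_cmult poisson_int_const[OF z] x_def)
  also have "\<dots> \<le> poisson_int (\<lambda>\<zeta>. \<phi> (v \<zeta>)) z"
  proof (rule poisson_int_mono[OF z])
    show "a * v (cis t) + (\<phi> x - a * x) \<le> \<phi> (v (cis t))" for t
      using a[of "v (cis t)"] by (simp add: right_diff_distrib)
  qed (use i v in \<open>auto simp: circ_integrable_iff\<close>)
  finally show ?thesis by (simp add: x_def)
qed

end

section \<open>Circle means of Poisson integrals and products with outer functions\<close>

lemma cis_measurable [measurable]: "cis \<in> borel_measurable circ"
  by (intro borel_measurable_circ_continuous continuous_intros)

text \<open>Fubini and the symmetry of the kernel: averaged over the circle of radius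
  \<open>r\<close> in its first argument, the Poisson kernel has mean 1.\<close>

lemma nn_integral_poisson_int_circle:
  assumes r: "0 < r" "r < 1" and h: "circ_integrable h" "\<And>t. 0 \<le> h (cis t)"
  shows "(\<integral>\<^sup>+s. ennreal (poisson_int h (of_real r * cis s)) \<partial>circ) = ennreal (\<integral>t. h (cis t) \<partial>circ)"
proof -
  interpret P: pair_sigma_finite circ circ ..
  have nr: "norm (of_real r * cis s) < 1" for s using r by (simp add: norm_mult)
  have mh [measurable]: "(\<lambda>t. h (cis t)) \<in> borel_measurable circ" using h by (auto simp: circ_integrable_iff)
  have mp [measurable]: "(\<lambda>(s, t). ennreal (poisson (of_real r * cis s) (cis t) * h (cis t))) \<in> borel_measurable (circ \<Otimes>\<^sub>M circ)"
    unfolding poisson_def by measurable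
  have "(\<integral>\<^sup>+s. ennreal (poisson_int h (of_real r * cis s)) \<partial>circ) = (\<integral>\<^sup>+s. \<integral>\<^sup>+t. ennreal (poisson (of_real r * cis s) (cis t) * h (cis t)) \<partial>circ \<partial>circ)"
    unfolding poisson_int_eq using h poisson_nonneg[OF nr] integrable_poisson_mult[OF nr h(1)]
    by (intro nn_integral_cong nn_integral_eq_integral[symmetric]) auto
  also have "\<dots> = (\<integral>\<^sup>+t. \<integral>\<^sup>+s. ennreal (poisson (of_real r * cis s) (cis t) * h (cis t)) \<partial>circ \<partial>circ)"
    using P.Fubini'[OF mp] by simp
  also have "\<dots> = (\<integral>\<^sup>+t. ennreal (h (cis t)) \<partial>circ)"
  proof (rule nn_integral_cong)
    fix t
    have "(\<integral>\<^sup>+s. ennreal (poisson (of_real r * cis s) (cis t) * h (cis t)) \<partial>circ) = (\<integral>\<^sup>+s. ennreal (poisson (of_real r * cis t) (cis s) * h (cis t)) \<partial>circ)"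
      by (simp add: poisson_symmetric[of "cis _" "cis t"])
    also have "\<dots> = ennreal (\<integral>s. poisson (of_real r * cis t) (cis s) * h (cis t) \<partial>circ)"
      using h poisson_nonneg[OF nr] integrable_circ_continuous[OF continuous_on_poisson_cis[OF nr]]
      by (intro nn_integral_eq_integral) auto
    also have "\<dots> = ennreal (h (cis t))" by (simp add: poisson_mean[OF nr])
    finally show "(\<integral>\<^sup>+s. ennreal (poisson (of_real r * cis s) (cis t) * h (cis t)) \<partial>circ) = ennreal (h (cis t))" .
  qed
  also have "\<dots> = ennreal (\<integral>t. h (cis t) \<partial>circ)"
    using h by (intro nn_integral_eq_integral) (auto simp: circ_integrable_iff)
  finally show ?thesis .
qed

text \<open>A limit 0 would force the Poisson integral of \<open>w\<close> to infinity along the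
  radius. By Fatou's lemma this happens only on a null set, since the means over circles all equal
  that of \<open>w\<close>.\<close>

lemma nt_limit_outer_nonzero:
  assumes w: "circ_integrable w" "\<And>t. 0 \<le> w (cis t)"
  shows "AE t in circ. \<not> has_nt_limit (\<lambda>z. exp (- herglotz w z)) (cis t) 0"
proof -
  define p where "p = (\<lambda>n t. poisson_int w (of_real (radius n) * cis t))"
  have nr: "norm (of_real (radius n) * cis t) < 1" for n t using radius_bounds[of n] by (simp add: norm_mult)
  have pRe: "p n t = Re (herglotz w (of_real (radius n) * cis t))" for n t
    unfolding p_def using Re_herglotz[OF nr w(1)] by simp
  have contp: "continuous_on {0..2*pi} (p n)" for n
    unfolding pRe using radius_bounds[of n]
    by (intro continuous_intros continuous_on_compose2[OF holomorphic_on_imp_continuous_on[OF herglotz_holomorphic[OF w(1)]]])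
      (auto simp: norm_mult)
  have pm [measurable]: "p n \<in> borel_measurable circ" for n by (rule borel_measurable_circ_continuous[OF contp])
  have "(\<integral>\<^sup>+t. liminf (\<lambda>n. ennreal (p n t)) \<partial>circ) \<le> liminf (\<lambda>n. \<integral>\<^sup>+t. ennreal (p n t) \<partial>circ)"
    by (rule nn_integral_liminf) simp
  also have "\<dots> = ennreal (\<integral>t. w (cis t) \<partial>circ)"
    unfolding p_def using nn_integral_poisson_int_circle[OF radius_bounds w] by (simp add: Liminf_const)
  finally have "(\<integral>\<^sup>+t. liminf (\<lambda>n. ennreal (p n t)) \<partial>circ) \<noteq> \<infinity>" by (auto simp: top_unique)
  then have "AE t in circ. liminf (\<lambda>n. ennreal (p n t)) \<noteq> \<infinity>"
    by (intro nn_integral_PInf_AE) simp_all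
  then show ?thesis
  proof eventually_elim
    case (elim t)
    show ?case
    proof
      assume "has_nt_limit (\<lambda>z. exp (- herglotz w z)) (cis t) 0"
      from has_nt_limit_radial[OF this norm_cis radius_tendsto radius_bounds]
      have "(\<lambda>n. norm (exp (- herglotz w (of_real (radius n) * cis t)))) \<longlonglongrightarrow> norm (0::complex)" by (rule tendsto_norm)
      then have lim: "(\<lambda>n. exp (- p n t)) \<longlonglongrightarrow> 0" by (simp add: pRe)
      then have "filterlim (\<lambda>n. exp (- p n t)) (at_right 0) sequentially"
        by (auto simp: filterlim_at)
      then have "filterlim (\<lambda>n. ln (exp (- p n t))) at_bot sequentially"
        by (rule filterlim_compose[OF ln_at_0])
      then have "filterlim (\<lambda>n. p n t) at_top sequentially" by (simp add: filterlim_uminus_at_top)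
      then have "(\<lambda>n. ennreal (p n t)) \<longlonglongrightarrow> \<infinity>" by (simp add: ennreal_tendsto_top_eq_at_top)
      then have "liminf (\<lambda>n. ennreal (p n t)) = \<infinity>" by (intro lim_imp_Liminf) auto
      then show False using elim by simp
    qed
  qed
qed

context orlicz_function
begin

text \<open>Boundary values exist because \<open>F = f0 / exp (- herglotz w)\<close> is a quotient
  of bounded functions whose denominator has nonzero limits almost everywhere. Jensen's inequality
  bounds \<open>\<phi>\<close> of \<open>logplus |F|\<close> on each circle by the Poisson integral
  of \<open>h\<close>, whose mean is independent of the radius. This single bound yields both the
  Smirnov convergence and integrability at the boundary.\<close>

proposition bounded_times_outer_in_hardy_orlicz:
  assumes f0: "f0 holomorphic_on ball 0 1" and A: "\<And>z. z \<in> ball 0 1 \<Longrightarrow> norm (f0 z) \<le> A" "A \<ge> 1"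
    and w: "in_Lphi \<phi> w" "\<And>t. 0 \<le> w (cis t)"
  shows "(\<lambda>z. f0 z * exp (herglotz w z)) \<in> hardy_orlicz \<phi>"
proof -
  define F where "F = (\<lambda>z. f0 z * exp (herglotz w z))"
  have wi: "circ_integrable w" by (rule in_Lphi_circ_integrable[OF w(1)])
  have holH: "herglotz w holomorphic_on ball 0 1" by (rule herglotz_holomorphic[OF wi])
  have holF: "F holomorphic_on ball 0 1" unfolding F_def by (intro holomorphic_intros f0 holH)
  have contF: "continuous_on (ball 0 1) F" by (rule holomorphic_on_imp_continuous_on[OF holF])
  note bvm [measurable] = bv_cis_measurable[OF contF]
  have "AE t in circ. \<exists>L. has_nt_limit f0 (cis t) L"
    using Fatou_bounded_holomorphic[OF f0 A(1)] .
  moreover have "AE t in circ. \<exists>L. has_nt_limit (\<lambda>z. exp (- herglotz w z)) (cis t) L"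
  proof (rule Fatou_bounded_holomorphic)
    show "(\<lambda>z. exp (- herglotz w z)) holomorphic_on ball 0 1" by (intro holomorphic_intros holH)
    show "norm (exp (- herglotz w z)) \<le> 1" if "z \<in> ball 0 1" for z
      using Re_herglotz[OF _ wi, of z] poisson_int_nonneg[of z w] w(2) that by simp
  qed
  moreover note nt_limit_outer_nonzero[OF wi w(2)]
  ultimately have ntF: "AE t in circ. \<exists>L. has_nt_limit F (cis t) L"
  proof eventually_elim
    case (elim t)
    then obtain L1 L2 where L: "has_nt_limit f0 (cis t) L1" "has_nt_limit (\<lambda>z. exp (- herglotz w z)) (cis t) L2" by blast
    then have "L2 \<noteq> 0" using elim by auto
    then have "has_nt_limit (\<lambda>z. f0 z / exp (- herglotz w z)) (cis t) (L1 / L2)"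
      using L unfolding has_nt_limit_def by (auto intro!: tendsto_divide)
    moreover have "(\<lambda>z. f0 z / exp (- herglotz w z)) = F" by (simp add: F_def exp_minus fun_eq_iff field_simps)
    ultimately show ?case by auto
  qed
  define Y where "Y = (\<lambda>t. logplus (norm (bv F (cis t))))"
  have Ym [measurable]: "Y \<in> borel_measurable circ" unfolding Y_def logplus_def by measurable
  define h where "h = (\<lambda>\<zeta>. \<phi> \<bar>ln A + w \<zeta>\<bar>)"
  have inL: "in_Lphi \<phi> (\<lambda>\<zeta>. ln A + w \<zeta>)" by (intro in_Lphi_add in_Lphi_const w)
  have hi: "circ_integrable h" using inL by (simp add: h_def in_Lphi_def)
  define K where "K = (\<integral>t. h (cis t) \<partial>circ)"
  \<comment> \<open>Stated for arbitrary radii because the limit at \<open>at_left 1\<close> is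
    tested along all sequences.\<close>
  have seq: "integrable circ (\<lambda>t. \<phi> (Y t)) \<and> (\<lambda>n. \<integral>t. logplus (norm (F (of_real (r n) * cis t))) \<partial>circ) \<longlonglongrightarrow> (\<integral>t. Y t \<partial>circ)"
    if r: "r \<longlonglongrightarrow> 1" "\<And>n. 0 < r n" "\<And>n. r n < 1" for r
  proof -
    define X where "X = (\<lambda>n t. logplus (norm (F (of_real (r n) * cis t))))"
    have nr: "norm (of_real (r n) * cis t) < 1" for n t using r(2,3)[of n] by (simp add: norm_mult)
    have contX: "continuous_on {0..2*pi} (X n)" for n
      unfolding X_def using nr[of n] by (intro continuous_intros continuous_on_compose2[OF contF]) auto
    have Xm [measurable]: "X n \<in> borel_measurable circ" for n by (rule borel_measurable_circ_continuous[OF contX])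
    have Xle: "X n t \<le> poisson_int (\<lambda>\<zeta>. ln A + w \<zeta>) (of_real (r n) * cis t)" for n t
    proof -
      let ?z = "of_real (r n) * cis t"
      have z: "norm ?z < 1" by (rule nr)
      have p0: "0 \<le> poisson_int w ?z" using poisson_int_nonneg[OF z] w(2) by blast
      have "norm (F ?z) \<le> A * exp (poisson_int w ?z)"
        unfolding F_def norm_mult using A(1)[of ?z] A(2) z Re_herglotz[OF z wi] by (intro mult_mono) auto
      then have "X n t \<le> logplus (A * exp (poisson_int w ?z))" unfolding X_def by (intro logplus_mono) auto
      also have "\<dots> \<le> logplus A + logplus (exp (poisson_int w ?z))" using A(2) by (intro logplus_mult_le) auto
      also have "\<dots> = ln A + poisson_int w ?z" using A(2) p0 by (simp add: logplus_exp) (simp add: logplus_def)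
      also have "\<dots> = poisson_int (\<lambda>\<zeta>. ln A + w \<zeta>) ?z"
        using wi by (subst poisson_int_add[OF z]) (auto simp: poisson_int_const[OF z] circ_integrable_iff)
      finally show ?thesis .
    qed
    have phiX: "\<phi> (X n t) \<le> poisson_int h (of_real (r n) * cis t)" for n t
    proof -
      let ?z = "of_real (r n) * cis t"
      have ab: "\<bar>ln A + w (cis s)\<bar> = ln A + w (cis s)" for s using w(2)[of s] A(2) by simp
      have i2: "circ_integrable (\<lambda>\<zeta>. ln A + w \<zeta>)" by (rule in_Lphi_circ_integrable[OF inL])
      have i3: "circ_integrable (\<lambda>\<zeta>. \<phi> (ln A + w \<zeta>))" using hi by (simp add: h_def circ_integrable_iff ab)
      have "\<phi> (X n t) \<le> \<phi> (poisson_int (\<lambda>\<zeta>. ln A + w \<zeta>) ?z)" by (rule monoD[OF phi_mono Xle])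
      also have "\<dots> \<le> poisson_int (\<lambda>\<zeta>. \<phi> (ln A + w \<zeta>)) ?z" by (rule phi_poisson_int_le[OF nr i2 i3])
      also have "\<dots> = poisson_int h ?z" by (simp add: poisson_int_eq h_def ab)
      finally show ?thesis .
    qed
    have phiXc: "integrable circ (\<lambda>t. \<phi> (X n t))" for n
      by (intro integrable_circ_continuous continuous_on_compose2[OF cont contX]) auto
    have XK: "(\<integral>t. \<phi> (X n t) \<partial>circ) \<le> K" for n
    proof -
      have "ennreal (\<integral>t. \<phi> (X n t) \<partial>circ) = (\<integral>\<^sup>+t. ennreal (\<phi> (X n t)) \<partial>circ)"
        using phiXc phi_nonneg by (intro nn_integral_eq_integral[symmetric]) auto
      also have "\<dots> \<le> (\<integral>\<^sup>+t. ennreal (poisson_int h (of_real (r n) * cis t)) \<partial>circ)"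
        by (intro nn_integral_mono ennreal_leI phiX)
      also have "\<dots> = ennreal K"
        unfolding K_def by (rule nn_integral_poisson_int_circle[OF r(2,3) hi]) (simp add: h_def phi_nonneg)
      finally show ?thesis
        using phi_nonneg by (subst (asm) ennreal_le_iff) (auto simp: K_def h_def intro!: integral_nonneg_AE)
    qed
    have lim: "AE t in circ. (\<lambda>n. X n t) \<longlonglongrightarrow> Y t"
      using ntF
    proof eventually_elim
      case (elim t)
      then obtain L where L: "has_nt_limit F (cis t) L" by blast
      show ?case unfolding X_def Y_def bv_eq[OF L norm_cis]
        by (intro tendsto_logplus_norm has_nt_limit_radial[OF L norm_cis] r)
    qed
    have X0: "0 \<le> X n t" and Y0: "0 \<le> Y t" for n t by (auto simp: X_def Y_def)
    note C = convergence_of_bounded_Young[OF circ.prob_space_axioms Xm X0 Ym Y0 lim phiXc XK]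
    have "(\<lambda>n. \<integral>t. 1 * X n t \<partial>circ) \<longlonglongrightarrow> (\<integral>t. 1 * Y t \<partial>circ)" by (rule C(3)[where B = 1]) auto
    then show ?thesis using C(1) by (simp add: X_def)
  qed
  have iphiY: "integrable circ (\<lambda>t. \<phi> (Y t))" using seq[OF radius_tendsto radius_bounds] by blast
  have iY: "integrable circ Y"
    by (rule integrable_of_integrable_Young[OF circ.finite_measure_axioms Ym _ iphiY]) (simp add: Y_def)
  have lim: "((\<lambda>r. circ_mean (\<lambda>\<zeta>. logplus (norm (F (of_real r * \<zeta>))))) \<longlongrightarrow> circ_mean (\<lambda>\<zeta>. logplus (norm (bv F \<zeta>)))) (at_left 1)"
  proof (rule tendsto_at_left_sequentially[of 0])
    fix r :: "nat \<Rightarrow> real" assume r: "\<And>n. r n < 1" "\<And>n. 0 < r n" "incseq r" "r \<longlonglongrightarrow> 1"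
    show "(\<lambda>n. circ_mean (\<lambda>\<zeta>. logplus (norm (F (of_real (r n) * \<zeta>))))) \<longlonglongrightarrow> circ_mean (\<lambda>\<zeta>. logplus (norm (bv F \<zeta>)))"
      using seq[OF r(4,2,1)] by (simp add: circ_mean_eq Y_def)
  qed simp
  have "integrable circ (\<lambda>t. \<phi> (ln (norm (bv F (cis t)))))"
  proof (rule Bochner_Integration.integrable_bound[OF iphiY])
    show "(\<lambda>t. \<phi> (ln (norm (bv F (cis t))))) \<in> borel_measurable circ" by measurable
    show "AE t in circ. norm (\<phi> (ln (norm (bv F (cis t))))) \<le> norm (\<phi> (Y t))"
      using phi_nonneg by (auto intro!: AE_I2 monoD[OF phi_mono] simp: Y_def ln_le_logplus)
  qed
  then show ?thesis
    using holF lim iY unfolding hardy_orlicz_def smirnov_def F_def[symmetric]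
    by (simp add: circ_integrable_iff Y_def)
qed

lemma const_one_in_hardy_orlicz: "(\<lambda>_. 1) \<in> hardy_orlicz \<phi>"
  using bounded_times_outer_in_hardy_orlicz[of "\<lambda>_. 1" 1 "\<lambda>_. 0"] in_Lphi_const[of 0]
  by (simp add: herglotz_def)

lemma in_Lphi_logplus_bv:
  assumes "f \<in> hardy_orlicz \<phi>"
  shows "in_Lphi \<phi> (\<lambda>\<zeta>. logplus (norm (bv f \<zeta>)))"
proof -
  have i: "integrable circ (\<lambda>t. \<phi> (ln (norm (bv f (cis t)))) + \<phi> 0)" and
    m: "(\<lambda>t. logplus (norm (bv f (cis t)))) \<in> borel_measurable circ"
    using assms by (auto simp: hardy_orlicz_def smirnov_def circ_integrable_iff)
  have "integrable circ (\<lambda>t. \<phi> \<bar>logplus (norm (bv f (cis t)))\<bar>)"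
  proof (rule Bochner_Integration.integrable_bound[OF i])
    show "(\<lambda>t. \<phi> \<bar>logplus (norm (bv f (cis t)))\<bar>) \<in> borel_measurable circ" using m by measurable
    \<comment> \<open>Where the logarithm is negative, \<open>logplus\<close> is 0 and contributes
      the constant \<open>\<phi> 0\<close>.\<close>
    have "\<phi> \<bar>logplus x\<bar> \<le> \<phi> (ln x) + \<phi> 0" for x
      using phi_nonneg[of 0] phi_nonneg[of "ln x"] by (simp add: logplus_def max_def)
    then show "AE t in circ. norm (\<phi> \<bar>logplus (norm (bv f (cis t)))\<bar>) \<le> norm (\<phi> (ln (norm (bv f (cis t)))) + \<phi> 0)"
      using phi_nonneg by (intro AE_I2) (simp add: abs_of_nonneg)
  qed
  then show ?thesis using m by (simp add: in_Lphi_iff)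
qed

end

section \<open>Blaschke sequences\<close>

lemma blaschke_seq_finite_away:
  assumes \<Lambda>: "blaschke_seq \<Lambda>" and d: "d > 0"
  shows "finite {\<mu> \<in> \<Lambda>. d \<le> 1 - (norm \<mu>)\<^sup>2}"
proof (rule ccontr)
  let ?A = "{\<mu> \<in> \<Lambda>. d \<le> 1 - (norm \<mu>)\<^sup>2}" and ?f = "\<lambda>\<mu>::complex. 1 - (norm \<mu>)\<^sup>2"
  assume inf: "infinite ?A"
  have nn: "0 \<le> ?f \<mu>" if "\<mu> \<in> \<Lambda>" for \<mu> using \<Lambda> that by (auto simp: blaschke_seq_def power_le_one)
  obtain n :: nat where n: "infsum ?f \<Lambda> / d < real n" using reals_Archimedean2 by blast
  obtain B where B: "finite B" "card B = n" "B \<subseteq> ?A" using infinite_arbitrarily_large[OF inf] by blast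
  have "real n * d = (\<Sum>\<mu>\<in>B. d)" using B by simp
  also have "\<dots> \<le> sum ?f B" using B by (intro sum_mono) auto
  also have "\<dots> \<le> infsum ?f \<Lambda>"
    using \<Lambda> B nn by (intro finite_sum_le_infsum) (auto simp: blaschke_seq_def)
  finally show False using n d by (simp add: field_simps)
qed

lemma blaschke_seq_countable:
  assumes "blaschke_seq \<Lambda>"
  shows "countable \<Lambda>"
proof -
  have "\<Lambda> \<subseteq> (\<Union>n::nat. {\<mu> \<in> \<Lambda>. 1 / real (Suc n) \<le> 1 - (norm \<mu>)\<^sup>2})"
  proof
    fix \<mu> assume \<mu>: "\<mu> \<in> \<Lambda>"
    then have "0 < 1 - (norm \<mu>)\<^sup>2" using assms by (auto simp: blaschke_seq_def abs_square_less_1)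
    then obtain n where "1 / real (Suc n) < 1 - (norm \<mu>)\<^sup>2" by (rule nat_approx_posE)
    then show "\<mu> \<in> (\<Union>n::nat. {\<mu> \<in> \<Lambda>. 1 / real (Suc n) \<le> 1 - (norm \<mu>)\<^sup>2})" using \<mu> by (auto intro: less_imp_le)
  qed
  moreover have "countable (\<Union>n::nat. {\<mu> \<in> \<Lambda>. 1 / real (Suc n) \<le> 1 - (norm \<mu>)\<^sup>2})"
    by (rule countable_UN) (auto intro!: countable_finite blaschke_seq_finite_away[OF assms] simp del: of_nat_Suc)
  ultimately show ?thesis by (rule countable_subset)
qed

text \<open>The constant \<open>|\<mu>| / \<mu>\<close> rotates the factor towards 1; this rate
  makes the product over a Blaschke sequence converge absolutely.\<close>

lemma one_minus_blaschke_factor_le: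
  assumes \<mu>: "norm \<mu> < 1" and z: "norm z < 1"
  shows "norm (1 - blaschke_factor \<mu> z) \<le> 2 / (1 - norm z) * (1 - (norm \<mu>)\<^sup>2)"
proof (cases "\<mu> = 0")
  case True
  have "norm (1 - z) \<le> 1 + norm z" using norm_triangle_ineq4[of 1 z] by simp
  also have "\<dots> \<le> 2 / (1 - norm z)" 
  proof -
    have "(1 + norm z) * (1 - norm z) = 1 - (norm z)\<^sup>2" by (simp add: algebra_simps power2_eq_square)
    also have "\<dots> \<le> 2" using zero_le_power2[of "norm z"] by linarith
    finally show ?thesis using z by (simp add: field_simps)
  qed
  finally show ?thesis using True by (simp add: blaschke_factor_def)
next
  case False
  have den: "1 - cnj \<mu> * z \<noteq> 0" using blaschke_denom_nonzero[of \<mu> z] assms by auto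
  have n0: "norm \<mu> > 0" using False by simp
  have mm: "\<mu> * cnj \<mu> = of_real (norm \<mu>) * of_real (norm \<mu>)"
    using complex_norm_square[of \<mu>] by (simp add: power2_eq_square)
  have "1 - blaschke_factor \<mu> z = (\<mu> * (1 - cnj \<mu> * z) - of_real (norm \<mu>) * (\<mu> - z)) / (\<mu> * (1 - cnj \<mu> * z))"
    using False den by (simp add: blaschke_factor_def divide_simps)
  also have "\<mu> * (1 - cnj \<mu> * z) - of_real (norm \<mu>) * (\<mu> - z) = of_real (1 - norm \<mu>) * (\<mu> + of_real (norm \<mu>) * z)"
  proof -
    have "\<mu> * (1 - cnj \<mu> * z) = \<mu> - (\<mu> * cnj \<mu>) * z" by (simp add: algebra_simps)
    then show ?thesis unfolding mm by (simp add: algebra_simps)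
  qed
  finally have "norm (1 - blaschke_factor \<mu> z) = (1 - norm \<mu>) * norm (\<mu> + of_real (norm \<mu>) * z) / (norm \<mu> * norm (1 - cnj \<mu> * z))"
    using \<mu> by (simp add: norm_mult norm_divide del: of_real_diff)
  also have "\<dots> \<le> (1 - norm \<mu>) * (norm \<mu> * 2) / (norm \<mu> * (1 - norm z))"
  proof (intro frac_le mult_left_mono)
    have "norm (\<mu> + of_real (norm \<mu>) * z) \<le> norm \<mu> + norm \<mu> * norm z"
      using norm_triangle_ineq[of \<mu> "of_real (norm \<mu>) * z"] by (simp add: norm_mult)
    also have "\<dots> \<le> norm \<mu> + norm \<mu> * 1" using z by (intro add_left_mono mult_left_mono) auto
    finally show "norm (\<mu> + of_real (norm \<mu>) * z) \<le> norm \<mu> * 2" by simp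
    have "norm (cnj \<mu> * z) \<le> 1 * norm z" unfolding norm_mult using \<mu> by (intro mult_right_mono) auto
    then show "1 - norm z \<le> norm (1 - cnj \<mu> * z)" using norm_triangle_ineq2[of 1 "cnj \<mu> * z"] by simp
  qed (use \<mu> z n0 in auto)
  also have "\<dots> = 2 / (1 - norm z) * (1 - norm \<mu>)" using n0 z by (simp add: divide_simps)
  also have "\<dots> \<le> 2 / (1 - norm z) * (1 - (norm \<mu>)\<^sup>2)"
    using z \<mu> power_decreasing[of 1 2 "norm \<mu>"] by (intro mult_left_mono) auto
  finally show ?thesis .
qed

text \<open>The product is the exponential of an absolutely convergent sum of logarithms: off a
  finite set each factor is within 1/2 of 1, where \<open>Ln\<close> is at most twice the distance
  to 1. In particular the product is nonzero, so the value of \<open>ln\<close> at 0 never enters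
  \<open>phi_Lambda\<close>.\<close>

lemma bk_has_sum_phi_Lambda:
  assumes \<Lambda>: "blaschke_seq \<Lambda>" and z: "z \<in> \<Lambda>"
  shows "(bk z has_sum phi_Lambda \<Lambda> z) (\<Lambda> - {z})"
proof -
  define N where "N = \<Lambda> - {z}"
  have nz: "norm z < 1" and n\<mu>: "\<And>\<mu>. \<mu> \<in> N \<Longrightarrow> norm \<mu> < 1" using \<Lambda> z by (auto simp: blaschke_seq_def N_def)
  have b0: "blaschke_factor \<mu> z \<noteq> 0" if "\<mu> \<in> N" for \<mu>
    using n\<mu>[OF that] nz that by (auto simp: blaschke_factor_eq_0_iff N_def)
  define c where "c = 2 / (1 - norm z)"
  have c: "c > 0" using nz by (simp add: c_def)
  \<comment> \<open>The finitely many factors that may be far from 1; the threshold gives distance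
    below 1/2 for all others.\<close>
  define A where "A = {\<mu> \<in> N. 1 / (2 * c) \<le> 1 - (norm \<mu>)\<^sup>2}"
  have "finite A" unfolding A_def
    by (rule finite_subset[OF _ blaschke_seq_finite_away[OF \<Lambda>, of "1 / (2 * c)"]]) (use c in \<open>auto simp: N_def\<close>)
  have s1: "(\<lambda>\<mu>. 2 * c * (1 - (norm \<mu>)\<^sup>2)) summable_on (N - A)"
  proof (intro summable_on_cmult_right)
    show "(\<lambda>\<mu>. 1 - (norm \<mu>)\<^sup>2) summable_on (N - A)"
      using \<Lambda> by (auto simp: blaschke_seq_def N_def intro: summable_on_subset_banach)
  qed
  have "(\<lambda>\<mu>. norm (Ln (blaschke_factor \<mu> z))) summable_on (N - A)"
  proof (rule Infinite_Sum.abs_summable_on_comparison_test)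
    show "(\<lambda>\<mu>. norm (2 * c * (1 - (norm \<mu>)\<^sup>2))) summable_on (N - A)"
    proof (subst summable_on_cong[of _ _ "\<lambda>\<mu>. 2 * c * (1 - (norm \<mu>)\<^sup>2)"])
      fix \<mu> assume "\<mu> \<in> N - A"
      then have "0 \<le> 1 - (norm \<mu>)\<^sup>2" using n\<mu>[of \<mu>] by (simp add: power_le_one)
      then show "norm (2 * c * (1 - (norm \<mu>)\<^sup>2)) = 2 * c * (1 - (norm \<mu>)\<^sup>2)" using c by simp
    qed (rule s1)
    fix \<mu> assume \<mu>: "\<mu> \<in> N - A"
    then have le: "norm (1 - blaschke_factor \<mu> z) \<le> c * (1 - (norm \<mu>)\<^sup>2)"
      unfolding c_def using one_minus_blaschke_factor_le[OF n\<mu> nz] by blast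
    also have "\<dots> < c * (1 / (2 * c))" using \<mu> c by (intro mult_strict_left_mono) (auto simp: A_def)
    finally have half: "norm (1 - blaschke_factor \<mu> z) < 1 / 2" using c by simp
    have "norm (Ln (1 + (blaschke_factor \<mu> z - 1))) \<le> 2 * norm (blaschke_factor \<mu> z - 1)"
      by (rule norm_Ln_le) (use half in \<open>simp add: norm_minus_commute\<close>)
    also have "\<dots> \<le> 2 * c * (1 - (norm \<mu>)\<^sup>2)" using le by (simp add: norm_minus_commute)
    finally show "norm (Ln (blaschke_factor \<mu> z)) \<le> norm (2 * c * (1 - (norm \<mu>)\<^sup>2))" by simp
  qed
  then have "(\<lambda>\<mu>. Ln (blaschke_factor \<mu> z)) summable_on (N - A)" by (rule abs_summable_summable)
  then have "(\<lambda>\<mu>. Ln (blaschke_factor \<mu> z)) summable_on ((N - A) \<union> A)"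
    using \<open>finite A\<close> by (intro summable_on_Un_disjoint) auto
  moreover have "(N - A) \<union> A = N" by (auto simp: A_def)
  ultimately obtain L where L: "((\<lambda>\<mu>. Ln (blaschke_factor \<mu> z)) has_sum L) N" by (auto simp: summable_on_def)
  have "((\<lambda>F. exp (\<Sum>\<mu>\<in>F. Ln (blaschke_factor \<mu> z))) \<longlongrightarrow> exp L) (finite_subsets_at_top N)"
    using L unfolding has_sum_def by (intro tendsto_intros)
  moreover have "\<forall>\<^sub>F F in finite_subsets_at_top N. exp (\<Sum>\<mu>\<in>F. Ln (blaschke_factor \<mu> z)) = (\<Prod>\<mu>\<in>F. blaschke_factor \<mu> z)"
  proof (rule eventually_finite_subsets_at_top_weakI)
    fix F assume "finite F" "F \<subseteq> N"
    then show "exp (\<Sum>\<mu>\<in>F. Ln (blaschke_factor \<mu> z)) = (\<Prod>\<mu>\<in>F. blaschke_factor \<mu> z)"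
      using b0 by (auto simp: exp_sum intro!: prod.cong)
  qed
  ultimately have "((\<lambda>F. \<Prod>\<mu>\<in>F. blaschke_factor \<mu> z) \<longlongrightarrow> exp L) (finite_subsets_at_top N)"
    by (rule Lim_transform_eventually)
  then have "blaschke_prod N z = exp L" unfolding blaschke_prod_def by (intro tendsto_Lim) auto
  then have pL: "phi_Lambda \<Lambda> z = - Re L"
    using z by (simp add: phi_Lambda_def N_def exp_minus[symmetric] inverse_eq_divide[symmetric])
  have "((\<lambda>\<mu>. - Re (Ln (blaschke_factor \<mu> z))) has_sum - Re L) N"
    using has_sum_Re[OF L] by (simp add: has_sum_uminus)
  moreover have "- Re (Ln (blaschke_factor \<mu> z)) = bk z \<mu>" if "\<mu> \<in> N" for \<mu>
    using b0[OF that] by (simp add: bk_def)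
  ultimately show ?thesis unfolding pL N_def[symmetric] by (subst has_sum_cong[symmetric]) auto
qed

lemma sum_bk_le_phi_Lambda:
  assumes "blaschke_seq \<Lambda>" "z \<in> \<Lambda>" "finite F" "F \<subseteq> \<Lambda> - {z}"
  shows "(\<Sum>\<mu>\<in>F. bk z \<mu>) \<le> phi_Lambda \<Lambda> z"
  using assms by (intro finite_sum_le_has_sum[OF bk_has_sum_phi_Lambda]) (auto intro!: bk_nonneg simp: blaschke_seq_def)

lemma phi_Lambda_leI:
  assumes "blaschke_seq \<Lambda>" "z \<in> \<Lambda>" "\<And>F. finite F \<Longrightarrow> F \<subseteq> \<Lambda> - {z} \<Longrightarrow> (\<Sum>\<mu>\<in>F. bk z \<mu>) \<le> c"
  shows "phi_Lambda \<Lambda> z \<le> c"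
  by (rule has_sum_le_finite_sums[OF bk_has_sum_phi_Lambda]) (use assms in auto)

lemma phi_Lambda_nonneg: "blaschke_seq \<Lambda> \<Longrightarrow> z \<in> \<Lambda> \<Longrightarrow> 0 \<le> phi_Lambda \<Lambda> z"
  using sum_bk_le_phi_Lambda[of \<Lambda> z "{}"] by simp

section \<open>Interpolation by bounded functions\<close>

text \<open>Listed by decreasing \<open>r\<close>, the terms form a lower Riemann sum of
  \<open>exp (- t)\<close> on the interval from 0 to the sum of the \<open>x i\<close>; ties only
  enlarge the tails. The induction removes an index of minimal \<open>r\<close>, whose tail is the
  whole sum.\<close>

lemma sum_exp_tail_le_1:
  fixes x :: "'a \<Rightarrow> real" and r :: "'a \<Rightarrow> real"
  assumes "finite F" "\<And>i. i \<in> F \<Longrightarrow> 0 \<le> x i"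
  shows "(\<Sum>i\<in>F. x i * exp (- (\<Sum>j\<in>{j\<in>F. r i \<le> r j}. x j))) \<le> 1 - exp (- (\<Sum>i\<in>F. x i))"
  using assms
proof (induction "card F" arbitrary: F)
  case 0
  then show ?case by simp
next
  case (Suc n)
  then have "F \<noteq> {}" by auto
  then obtain m where m: "m \<in> F" "\<And>i. i \<in> F \<Longrightarrow> r m \<le> r i"
    using ex_min_if_finite[of "r ` F"] Suc.prems(1) by (auto simp: not_less)
  define G where "G = F - {m}"
  have F: "F = insert m G" "m \<notin> G" "finite G" using m Suc.prems by (auto simp: G_def)
  have xG: "0 \<le> x i" if "i \<in> F" for i using Suc.prems that by auto
  have IH: "(\<Sum>i\<in>G. x i * exp (- (\<Sum>j\<in>{j\<in>G. r i \<le> r j}. x j))) \<le> 1 - exp (- (\<Sum>i\<in>G. x i))"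
    using Suc.hyps(1)[of G] Suc.hyps(2) F xG by auto
  have "(\<Sum>i\<in>G. x i * exp (- (\<Sum>j\<in>{j\<in>F. r i \<le> r j}. x j))) \<le> (\<Sum>i\<in>G. x i * exp (- (\<Sum>j\<in>{j\<in>G. r i \<le> r j}. x j)))"
  proof (intro sum_mono mult_left_mono)
    fix i assume "i \<in> G"
    then show "0 \<le> x i" using xG F by auto
    have "(\<Sum>j\<in>{j\<in>G. r i \<le> r j}. x j) \<le> (\<Sum>j\<in>{j\<in>F. r i \<le> r j}. x j)"
      using F xG by (intro sum_mono2) auto
    then show "exp (- (\<Sum>j\<in>{j\<in>F. r i \<le> r j}. x j)) \<le> exp (- (\<Sum>j\<in>{j\<in>G. r i \<le> r j}. x j))" by simp
  qed
  moreover have "x m * exp (- (\<Sum>j\<in>{j\<in>F. r m \<le> r j}. x j)) \<le> exp (- (\<Sum>i\<in>G. x i)) - exp (- (\<Sum>i\<in>F. x i))"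
  proof -
    have eq: "{j\<in>F. r m \<le> r j} = F" using m by auto
    have S: "(\<Sum>i\<in>F. x i) = x m + (\<Sum>i\<in>G. x i)" using F by simp
    have "x m \<le> exp (x m) - 1" using exp_ge_add_one_self[of "x m"] by linarith
    then have "x m * exp (- (\<Sum>i\<in>F. x i)) \<le> (exp (x m) - 1) * exp (- (\<Sum>i\<in>F. x i))" by (intro mult_right_mono) auto
    also have "\<dots> = exp (- (\<Sum>i\<in>G. x i)) - exp (- (\<Sum>i\<in>F. x i))"
      by (simp add: S left_diff_distrib exp_add[symmetric])
    finally show ?thesis by (simp add: eq)
  qed
  moreover have "(\<Sum>i\<in>F. x i * exp (- (\<Sum>j\<in>{j\<in>F. r i \<le> r j}. x j))) =
      x m * exp (- (\<Sum>j\<in>{j\<in>F. r m \<le> r j}. x j)) + (\<Sum>i\<in>G. x i * exp (- (\<Sum>j\<in>{j\<in>F. r i \<le> r j}. x j)))"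
    by (subst F(1), subst sum.insert[OF F(3,2)]) simp
  ultimately show ?case using IH by linarith
qed

lemma Re_Cayley: "u \<noteq> 1 \<Longrightarrow> Re ((1 + u) / (1 - u)) = (1 - (norm u)\<^sup>2) / (norm (1 - u))\<^sup>2" for u :: complex
  unfolding Re_divide cmod_power2 by (simp add: algebra_simps power2_eq_square)

text \<open>P. Jones' explicit interpolation formula. The exponential factors, ordered by decreasing modulus
  of the nodes, make the kernels \<open>(1 - |\<lambda>|\<^sup>2)\<^sup>2 / |1 - cnj \<lambda> z|\<^sup>2\<close> telescope; their values at the nodes only
  cost a fourth power of the Blaschke product.\<close>

lemma bounded_interpolation_finite:
  assumes F: "finite F" "F \<subseteq> ball 0 1"
    and a: "\<And>l. l \<in> F \<Longrightarrow> norm (a l) \<le> exp (- 5 * (\<Sum>\<mu>\<in>F - {l}. bk l \<mu>))"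
  shows "\<exists>f. f holomorphic_on ball 0 1 \<and> (\<forall>z\<in>ball 0 1. norm (f z) \<le> exp 2) \<and> (\<forall>l\<in>F. f l = a l)"
proof -
  define B where "B = (\<lambda>l z. \<Prod>\<mu>\<in>F - {l}. blaschke_factor \<mu> z)"
  define G where "G = (\<lambda>l::complex. {\<mu> \<in> F. norm l \<le> norm \<mu>})"
  define E where "E = (\<lambda>(l::complex) z. exp (- (\<Sum>\<mu>\<in>G l. of_real (1 - (norm \<mu>)\<^sup>2) * ((1 + cnj \<mu> * z) / (1 - cnj \<mu> * z)))))"
  define K where "K = (\<lambda>l z. (of_real (1 - (norm l)\<^sup>2) / (1 - cnj l * z))\<^sup>2)"
  \<comment> \<open>As \<open>K l l = 1\<close>, and \<open>B k l = 0\<close> for the other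
    \<open>k\<close> in \<open>F\<close>, this normalisation gives \<open>f l = a l\<close>.\<close>
  define c where "c = (\<lambda>l. a l / (B l l * E l l))"
  define f where "f = (\<lambda>z. \<Sum>l\<in>F. c l * (B l z * (K l z * E l z)))"
  have nF: "norm l < 1" if "l \<in> F" for l using F that by auto
  have den: "1 - cnj l * z \<noteq> 0" if "l \<in> F" "norm z < 1" for l z
    using blaschke_denom_nonzero[of l z] nF[OF that(1)] that by auto
  have qnn: "0 \<le> 1 - (norm l)\<^sup>2" if "l \<in> F" for l using nF[OF that] by (simp add: power_le_one)
  have hol: "f holomorphic_on ball 0 1"
    unfolding f_def B_def K_def E_def G_def using den nF
    by (intro holomorphic_intros blaschke_factor_holomorphic) auto
  have Bll: "B l l \<noteq> 0" if "l \<in> F" for l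
  proof -
    have "blaschke_factor \<mu> l \<noteq> 0" if "\<mu> \<in> F - {l}" for \<mu>
      using nF[of \<mu>] nF[OF \<open>l \<in> F\<close>] that by (subst blaschke_factor_eq_0_iff) auto
    then show ?thesis unfolding B_def using F(1) by (subst prod_zero_iff) auto
  qed
  have Ell: "E l z \<noteq> 0" for l z by (simp add: E_def)
  have Kll: "K l l = 1" if "l \<in> F" for l
  proof -
    have "1 - cnj l * l = of_real (1 - (norm l)\<^sup>2)"
      using complex_norm_square[of l] by (simp add: mult.commute)
    then show ?thesis using den[OF that nF[OF that]] by (simp add: K_def)
  qed
  have interp: "f l = a l" if l: "l \<in> F" for l
  proof -
    have "f l = (\<Sum>k\<in>F. if k = l then a l else 0)"
      unfolding f_def
    proof (rule sum.cong[OF refl])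
      fix k assume k: "k \<in> F"
      show "c k * (B k l * (K k l * E k l)) = (if k = l then a l else 0)"
      proof (cases "k = l")
        case True
        then show ?thesis using Bll[OF l] Ell[of l l] Kll[OF l] by (simp add: c_def)
      next
        case False
        have "B k l = 0" unfolding B_def using F(1) l False nF[OF l]
          by (intro prod_zero) (auto intro!: bexI[of _ l] simp: blaschke_factor_eq_0_iff)
        then show ?thesis using False by simp
      qed
    qed
    then show ?thesis using F(1) l by simp
  qed
  have nE: "norm (E l z) = exp (- (\<Sum>\<mu>\<in>G l. (1 - (norm \<mu>)\<^sup>2) * ((1 - (norm (cnj \<mu> * z))\<^sup>2) / (norm (1 - cnj \<mu> * z))\<^sup>2)))"
    if "norm z < 1" for l z
  proof -
    have "Re (\<Sum>\<mu>\<in>G l. of_real (1 - (norm \<mu>)\<^sup>2) * ((1 + cnj \<mu> * z) / (1 - cnj \<mu> * z)))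
      = (\<Sum>\<mu>\<in>G l. (1 - (norm \<mu>)\<^sup>2) * ((1 - (norm (cnj \<mu> * z))\<^sup>2) / (norm (1 - cnj \<mu> * z))\<^sup>2))"
      unfolding Re_sum
    proof (rule sum.cong[OF refl])
      fix \<mu> assume "\<mu> \<in> G l"
      then have "cnj \<mu> * z \<noteq> 1" using den[of \<mu> z] that by (auto simp: G_def)
      from Re_Cayley[OF this] show "Re (of_real (1 - (norm \<mu>)\<^sup>2) * ((1 + cnj \<mu> * z) / (1 - cnj \<mu> * z))) = (1 - (norm \<mu>)\<^sup>2) * ((1 - (norm (cnj \<mu> * z))\<^sup>2) / (norm (1 - cnj \<mu> * z))\<^sup>2)"
        by (simp only: times_complex.sel Re_complex_of_real Im_complex_of_real mult_zero_left diff_0_right)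
    qed
    then show ?thesis by (simp add: E_def)
  qed
  have cb: "norm (c l) \<le> exp 2" if l: "l \<in> F" for l
  proof -
    define S where "S = (\<Sum>\<mu>\<in>F - {l}. bk l \<mu>)"
    have "S = - ln (norm (B l l))"
      unfolding S_def B_def using F nF[OF l] by (intro sum_bk_eq) auto
    then have nB: "norm (B l l) = exp (- S)" using Bll[OF l] by simp
    \<comment> \<open>The nodes in \<open>G l\<close> satisfy \<open>|\<mu>| \<ge> |l|\<close>, so
      \<open>1 - |\<mu> l|^2 \<le> 2 * (1 - |l|^2)\<close>. Each term is thus at most
      \<open>2 * (1 - |b|^2)\<close> for the Blaschke factor \<open>b\<close>, hence at most
      \<open>4 * bk l \<mu>\<close> off the diagonal; the diagonal term contributes at most
      2.\<close>
    have "(\<Sum>\<mu>\<in>G l. (1 - (norm \<mu>)\<^sup>2) * ((1 - (norm (cnj \<mu> * l))\<^sup>2) / (norm (1 - cnj \<mu> * l))\<^sup>2))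
      \<le> (\<Sum>\<mu>\<in>G l. 2 * (1 - (norm (blaschke_factor \<mu> l))\<^sup>2))"
    proof (rule sum_mono)
      fix \<mu> assume "\<mu> \<in> G l"
      then have \<mu>: "\<mu> \<in> F" "norm l \<le> norm \<mu>" by (auto simp: G_def)
      have "1 - (norm (cnj \<mu> * l))\<^sup>2 = 1 - (norm \<mu>)\<^sup>2 * (norm l)\<^sup>2" by (simp add: norm_mult power_mult_distrib)
      also have "\<dots> \<le> 1 - (norm l)\<^sup>2 * (norm l)\<^sup>2" using \<mu> by (intro diff_left_mono mult_right_mono power_mono) auto
      also have "\<dots> = (1 - (norm l)\<^sup>2) * (1 + (norm l)\<^sup>2)" by (simp add: algebra_simps)
      also have "\<dots> \<le> (1 - (norm l)\<^sup>2) * 2" using qnn[OF l] by (intro mult_left_mono) auto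
      finally have "(1 - (norm \<mu>)\<^sup>2) * ((1 - (norm (cnj \<mu> * l))\<^sup>2) / (norm (1 - cnj \<mu> * l))\<^sup>2)
          \<le> (1 - (norm \<mu>)\<^sup>2) * (((1 - (norm l)\<^sup>2) * 2) / (norm (1 - cnj \<mu> * l))\<^sup>2)"
        using qnn[OF \<mu>(1)] by (intro mult_left_mono divide_right_mono) auto
      also have "\<dots> = 2 * ((1 - (norm \<mu>)\<^sup>2) * (1 - (norm l)\<^sup>2) / (norm (1 - cnj \<mu> * l))\<^sup>2)" by simp
      finally show "(1 - (norm \<mu>)\<^sup>2) * ((1 - (norm (cnj \<mu> * l))\<^sup>2) / (norm (1 - cnj \<mu> * l))\<^sup>2) \<le> 2 * (1 - (norm (blaschke_factor \<mu> l))\<^sup>2)"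
        using one_minus_norm_blaschke_sq[of \<mu> l] nF[OF \<mu>(1)] nF[OF l] by simp
    qed
    also have "\<dots> \<le> (\<Sum>\<mu>\<in>F. 2 * (1 - (norm (blaschke_factor \<mu> l))\<^sup>2))"
      using F(1) nF nF[OF l] norm_blaschke_factor_le_1 by (intro sum_mono2) (auto simp: G_def power_le_one)
    also have "\<dots> = 2 * (1 - (norm (blaschke_factor l l))\<^sup>2) + (\<Sum>\<mu>\<in>F - {l}. 2 * (1 - (norm (blaschke_factor \<mu> l))\<^sup>2))"
      using F(1) l by (simp add: sum.remove)
    also have "\<dots> \<le> 2 + (\<Sum>\<mu>\<in>F - {l}. 4 * bk l \<mu>)"
    proof (intro add_mono sum_mono)
      show "2 * (1 - (norm (blaschke_factor l l))\<^sup>2) \<le> 2" by simp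
      fix \<mu> assume \<mu>: "\<mu> \<in> F - {l}"
      define y where "y = norm (blaschke_factor \<mu> l)"
      have "y > 0" unfolding y_def using \<mu> nF[of \<mu>] nF[OF l] by (auto simp: blaschke_factor_eq_0_iff)
      then have "ln (y\<^sup>2) \<le> y\<^sup>2 - 1" by (intro ln_le_minus_one) auto
      then have "1 - y\<^sup>2 \<le> - 2 * ln y" using \<open>y > 0\<close> by (simp add: ln_realpow)
      then show "2 * (1 - (norm (blaschke_factor \<mu> l))\<^sup>2) \<le> 4 * bk l \<mu>" by (simp add: bk_def y_def)
    qed
    also have "\<dots> = 2 + 4 * S" by (simp add: S_def sum_distrib_left)
    finally have "norm (E l l) \<ge> exp (- (2 + 4 * S))" unfolding nE[OF nF[OF l]] by simp
    then have "exp (- S) * exp (- (2 + 4 * S)) \<le> norm (B l l) * norm (E l l)" unfolding nB by (intro mult_left_mono) auto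
    then have le: "exp (- (2 + 5 * S)) \<le> norm (B l l * E l l)"
      unfolding norm_mult exp_add[symmetric] by (simp add: algebra_simps)
    have "norm (c l) = norm (a l) / norm (B l l * E l l)" by (simp add: c_def norm_divide)
    also have "\<dots> \<le> exp (- 5 * S) / exp (- (2 + 5 * S))"
      using a[OF l] le by (intro frac_le) (auto simp: S_def)
    also have "\<dots> = exp 2" by (simp add: exp_diff[symmetric])
    finally show ?thesis .
  qed
  have bound: "norm (f z) \<le> exp 2" if z: "norm z < 1" for z
  proof -
    define x where "x = (\<lambda>l. (1 - (norm l)\<^sup>2)\<^sup>2 / (norm (1 - cnj l * z))\<^sup>2)"
    have "norm (f z) \<le> (\<Sum>l\<in>F. norm (c l * (B l z * (K l z * E l z))))" unfolding f_def by (rule norm_sum)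
    also have "\<dots> \<le> (\<Sum>l\<in>F. exp 2 * (x l * exp (- (\<Sum>j\<in>{j\<in>F. norm l \<le> norm j}. x j))))"
    proof (rule sum_mono)
      fix l assume l: "l \<in> F"
      have B1: "norm (B l z) \<le> 1"
        unfolding B_def prod_norm[symmetric] using nF z norm_blaschke_factor_le_1 by (intro prod_le_1) auto
      have K1: "norm (K l z) = x l"
        unfolding K_def x_def by (simp add: norm_power norm_divide power_divide del: of_real_diff)
      \<comment> \<open>Here \<open>1 - |\<mu> z|^2 \<ge> 1 - |\<mu>|^2\<close>, so the exponent of
        \<open>E\<close> dominates the sum of the kernels, which produces the tails of
        \<open>sum_exp_tail_le_1\<close>.\<close>
      have "(\<Sum>j\<in>G l. x j) \<le> (\<Sum>\<mu>\<in>G l. (1 - (norm \<mu>)\<^sup>2) * ((1 - (norm (cnj \<mu> * z))\<^sup>2) / (norm (1 - cnj \<mu> * z))\<^sup>2))"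
      proof (rule sum_mono)
        fix \<mu> assume "\<mu> \<in> G l"
        then have \<mu>: "\<mu> \<in> F" by (auto simp: G_def)
        have "(norm (cnj \<mu> * z))\<^sup>2 \<le> (norm \<mu>)\<^sup>2"
          using z by (intro power_mono) (auto simp: norm_mult mult_left_le)
        then have "(1 - (norm \<mu>)\<^sup>2) * ((1 - (norm \<mu>)\<^sup>2) / (norm (1 - cnj \<mu> * z))\<^sup>2) \<le> (1 - (norm \<mu>)\<^sup>2) * ((1 - (norm (cnj \<mu> * z))\<^sup>2) / (norm (1 - cnj \<mu> * z))\<^sup>2)"
          using qnn[OF \<mu>] by (intro mult_left_mono divide_right_mono) auto
        then show "x \<mu> \<le> (1 - (norm \<mu>)\<^sup>2) * ((1 - (norm (cnj \<mu> * z))\<^sup>2) / (norm (1 - cnj \<mu> * z))\<^sup>2)"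
          unfolding x_def by (simp add: power2_eq_square[of "1 - (norm \<mu>)\<^sup>2"])
      qed
      then have E1: "norm (E l z) \<le> exp (- (\<Sum>j\<in>G l. x j))" unfolding nE[OF z] by simp
      have "norm (c l * (B l z * (K l z * E l z))) = norm (c l) * (norm (B l z) * (x l * norm (E l z)))"
        by (simp add: norm_mult K1)
      also have "\<dots> \<le> exp 2 * (1 * (x l * exp (- (\<Sum>j\<in>G l. x j))))"
        using cb[OF l] B1 E1 by (intro mult_mono mult_nonneg_nonneg) (auto simp: x_def)
      finally show "norm (c l * (B l z * (K l z * E l z))) \<le> exp 2 * (x l * exp (- (\<Sum>j\<in>{j\<in>F. norm l \<le> norm j}. x j)))"
        by (simp add: G_def)
    qed
    also have "\<dots> = exp 2 * (\<Sum>l\<in>F. x l * exp (- (\<Sum>j\<in>{j\<in>F. norm l \<le> norm j}. x j)))" by (simp add: sum_distrib_left)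
    also have "\<dots> \<le> exp 2 * (1 - exp (- (\<Sum>l\<in>F. x l)))"
      using F(1) by (intro mult_left_mono sum_exp_tail_le_1) (auto simp: x_def)
    also have "\<dots> \<le> exp 2" by simp
    finally show ?thesis .
  qed
  show ?thesis using hol bound interp by auto
qed

text \<open>A Montel limit of solutions for finite subsets: partial sums of \<open>bk\<close> stay
  below \<open>phi_Lambda\<close>, and the bound \<open>exp 2\<close> does not depend on the
  subset.\<close>

lemma bounded_interpolation:
  assumes \<Lambda>: "blaschke_seq \<Lambda>" and a: "\<And>l. l \<in> \<Lambda> \<Longrightarrow> norm (a l) \<le> exp (- 5 * phi_Lambda \<Lambda> l)"
  shows "\<exists>f. f holomorphic_on ball 0 1 \<and> (\<forall>z\<in>ball 0 1. norm (f z) \<le> exp 2) \<and> (\<forall>l\<in>\<Lambda>. f l = a l)"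
proof (cases "\<Lambda> = {}")
  case True
  then show ?thesis by (intro exI[of _ "\<lambda>_. 0"]) auto
next
  case False
  define e where "e = from_nat_into \<Lambda>"
  have rng: "range e = \<Lambda>" unfolding e_def using False blaschke_seq_countable[OF \<Lambda>] by (rule range_from_nat_into)
  define F where "F = (\<lambda>n::nat. e ` {..n})"
  have F: "finite (F n)" "F n \<subseteq> \<Lambda>" for n using rng by (auto simp: F_def)
  have \<Lambda>b: "\<Lambda> \<subseteq> ball 0 1" using \<Lambda> by (simp add: blaschke_seq_def)
  have "\<exists>f. f holomorphic_on ball 0 1 \<and> (\<forall>z\<in>ball 0 1. norm (f z) \<le> exp 2) \<and> (\<forall>l\<in>F n. f l = a l)" for n
  proof (rule bounded_interpolation_finite)
    show "finite (F n)" "F n \<subseteq> ball 0 1" using F[of n] \<Lambda>b by auto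
    fix l assume l: "l \<in> F n"
    then have l': "l \<in> \<Lambda>" using F by auto
    have "(\<Sum>\<mu>\<in>F n - {l}. bk l \<mu>) \<le> phi_Lambda \<Lambda> l"
      using F[of n] by (intro sum_bk_le_phi_Lambda \<Lambda> l') auto
    then have "exp (- 5 * phi_Lambda \<Lambda> l) \<le> exp (- 5 * (\<Sum>\<mu>\<in>F n - {l}. bk l \<mu>))" by simp
    then show "norm (a l) \<le> exp (- 5 * (\<Sum>\<mu>\<in>F n - {l}. bk l \<mu>))" using a[OF l'] by linarith
  qed
  then obtain f where f: "\<And>n. f n holomorphic_on ball 0 1" "\<And>n z. z \<in> ball 0 1 \<Longrightarrow> norm (f n z) \<le> exp 2" "\<And>n l. l \<in> F n \<Longrightarrow> f n l = a l"
    by metis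
  obtain g r where g: "g holomorphic_on ball 0 1" "strict_mono (r::nat \<Rightarrow> nat)"
    "\<And>x. x \<in> ball 0 1 \<Longrightarrow> (\<lambda>n. f (r n) x) \<longlonglongrightarrow> g x"
    by (rule Montel[of "ball 0 1" "range f" f]) (use f(1,2) in \<open>auto intro!: exI[of _ "exp 2"] simp: subset_iff\<close>)
  have "norm (g z) \<le> exp 2" if z: "z \<in> ball 0 1" for z
    using tendsto_norm[OF g(3)[OF z]] f(2)[OF z] by (intro LIMSEQ_le_const2[OF tendsto_norm[OF g(3)[OF z]]]) auto
  moreover have "g l = a l" if l: "l \<in> \<Lambda>" for l
  proof -
    obtain m where m: "e m = l" using rng l by blast
    have "eventually (\<lambda>n. f (r n) l = a l) sequentially"
      using eventually_ge_at_top[of m]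
    proof eventually_elim
      case (elim n)
      then have "m \<le> r n" using seq_suble[OF g(2), of n] by simp
      then show ?case using m by (intro f(3)) (auto simp: F_def)
    qed
    then have "(\<lambda>n. f (r n) l) \<longlonglongrightarrow> a l" by (rule tendsto_eventually)
    then show ?thesis using g(3)[of l] l \<Lambda>b LIMSEQ_unique by blast
  qed
  ultimately show ?thesis using g(1) by blast
qed

section \<open>The trace space and bounded interpolation\<close>

context orlicz_function
begin

text \<open>The case without zeros of \<open>smirnov_zeros_bound\<close>, with the weight
  \<open>logplus |bv f|\<close>.\<close>

lemma trace_subset_l_Phi:
  assumes "\<Lambda> \<subseteq> ball 0 1"
  shows "trace_on (hardy_orlicz \<phi>) \<Lambda> \<subseteq> l_Phi \<phi> \<Lambda>"
proof
  fix a assume "a \<in> trace_on (hardy_orlicz \<phi>) \<Lambda>"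
  then obtain f where f: "f \<in> hardy_orlicz \<phi>" "a = (\<lambda>z. if z \<in> \<Lambda> then f z else 0)" by (auto simp: trace_on_def)
  define w where "w = (\<lambda>\<zeta>. logplus (norm (bv f \<zeta>)))"
  have sm: "f \<in> smirnov" using f by (simp add: hardy_orlicz_def)
  have "logplus (norm (f x)) \<le> poisson_int w x" if "x \<in> \<Lambda>" for x
  proof (cases "norm (f x) > 1")
    case True
    then have "logplus (norm (f x)) = ln (norm (f x))" by (simp add: logplus_eq max_def)
    then show ?thesis
      using smirnov_zeros_bound[OF sm, of "{}" x] True assms that by (force simp: w_def)
  next
    case False
    then have "logplus (norm (f x)) = 0" by (simp add: logplus_eq max_def)
    then show ?thesis using poisson_int_nonneg[of x w] assms that by (auto simp: w_def)
  qed
  then show "a \<in> l_Phi \<phi> \<Lambda>"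
    unfolding l_Phi_def using f(2) in_Lphi_logplus_bv[OF f(1)]
    by (auto simp: w_def intro!: exI[of _ w])
qed

text \<open>Dividing the data by \<open>exp (herglotz W)\<close> with \<open>W = w1 + 5 * w2\<close>
  prepares them for \<open>bounded_interpolation\<close>: \<open>w1\<close> removes their size and
  \<open>5 * w2\<close> supplies the factor \<open>exp (- 5 * phi_Lambda)\<close>.\<close>

lemma l_Phi_subset_trace:
  assumes \<Lambda>: "blaschke_seq \<Lambda>" and w2: "\<forall>\<zeta>\<in>sphere 0 1. 0 < w2 \<zeta>" "in_Lphi \<phi> w2"
    "\<forall>x\<in>\<Lambda>. phi_Lambda \<Lambda> x \<le> poisson_int w2 x"
  shows "l_Phi \<phi> \<Lambda> \<subseteq> trace_on (hardy_orlicz \<phi>) \<Lambda>"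
proof
  fix a assume "a \<in> l_Phi \<phi> \<Lambda>"
  then obtain w1 where w1: "\<forall>\<zeta>\<in>sphere 0 1. 0 \<le> w1 \<zeta>" "in_Lphi \<phi> w1" "\<forall>x\<in>\<Lambda>. logplus (norm (a x)) \<le> poisson_int w1 x"
    and a0: "\<And>z. z \<notin> \<Lambda> \<Longrightarrow> a z = 0" by (auto simp: l_Phi_def)
  define W where "W = (\<lambda>\<zeta>. w1 \<zeta> + 5 * w2 \<zeta>)"
  have WL: "in_Lphi \<phi> W" unfolding W_def by (intro in_Lphi_add in_Lphi_cmult w1 w2)
  have Wi: "circ_integrable W" by (rule in_Lphi_circ_integrable[OF WL])
  have W0: "0 \<le> W (cis t)" for t using w1(1) w2(1) by (simp add: W_def less_imp_le)
  have \<Lambda>b: "norm l < 1" if "l \<in> \<Lambda>" for l using \<Lambda> that by (auto simp: blaschke_seq_def)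
  have PW: "poisson_int W l = poisson_int w1 l + 5 * poisson_int w2 l" if "norm l < 1" for l
    unfolding W_def using in_Lphi_circ_integrable[OF w1(2)] in_Lphi_circ_integrable[OF in_Lphi_cmult[OF w2(2), of 5]]
    by (simp add: poisson_int_add[OF that] poisson_int_cmult)
  define b where "b = (\<lambda>l. a l / exp (herglotz W l))"
  have "norm (b l) \<le> exp (- 5 * phi_Lambda \<Lambda> l)" if l: "l \<in> \<Lambda>" for l
  proof -
    have "norm (a l) \<le> exp (logplus (norm (a l)))" by (simp add: logplus_eq)
    also have "\<dots> \<le> exp (poisson_int w1 l)" using w1(3) l by simp
    finally have "norm (b l) \<le> exp (poisson_int w1 l) / exp (poisson_int W l)"
      unfolding b_def norm_divide using Re_herglotz[OF \<Lambda>b[OF l] Wi] by (simp add: divide_right_mono)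
    also have "\<dots> = exp (- 5 * poisson_int w2 l)" by (simp add: PW[OF \<Lambda>b[OF l]] exp_diff[symmetric])
    also have "\<dots> \<le> exp (- 5 * phi_Lambda \<Lambda> l)" using w2(3) l by simp
    finally show ?thesis .
  qed
  from bounded_interpolation[OF \<Lambda> this] obtain f0 where f0: "f0 holomorphic_on ball 0 1"
    "\<And>z. z \<in> ball 0 1 \<Longrightarrow> norm (f0 z) \<le> exp 2" "\<And>l. l \<in> \<Lambda> \<Longrightarrow> f0 l = b l" by blast
  have "(\<lambda>z. f0 z * exp (herglotz W z)) \<in> hardy_orlicz \<phi>"
    by (rule bounded_times_outer_in_hardy_orlicz[OF f0(1,2) _ WL W0]) auto
  moreover have "a = (\<lambda>z. if z \<in> \<Lambda> then f0 z * exp (herglotz W z) else 0)"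
    using a0 f0(3) by (auto simp: b_def)
  ultimately show "a \<in> trace_on (hardy_orlicz \<phi>) \<Lambda>"
    unfolding trace_on_def by (intro CollectI exI[of _ "\<lambda>z. f0 z * exp (herglotz W z)"] conjI)
qed

text \<open>A multiplier bounded by \<open>M\<close> costs only the constant weight
  \<open>logplus M\<close>.\<close>

lemma ideal_on_l_Phi:
  assumes "\<Lambda> \<subseteq> ball 0 1"
  shows "ideal_on \<Lambda> (l_Phi \<phi> \<Lambda>)"
  unfolding ideal_on_def
proof (intro ballI allI impI)
  fix a and \<omega> :: "complex \<Rightarrow> complex" assume "a \<in> l_Phi \<phi> \<Lambda>" and bd: "bounded (\<omega> ` \<Lambda>)"
  then obtain w where w: "\<forall>\<zeta>\<in>sphere 0 1. 0 \<le> w \<zeta>" "in_Lphi \<phi> w" "\<forall>x\<in>\<Lambda>. logplus (norm (a x)) \<le> poisson_int w x"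
    by (auto simp: l_Phi_def)
  obtain M where M: "M > 0" "\<And>x. x \<in> \<Lambda> \<Longrightarrow> norm (\<omega> x) \<le> M" using bd by (auto simp: bounded_pos)
  have "logplus (norm (\<omega> x * a x)) \<le> poisson_int (\<lambda>\<zeta>. w \<zeta> + logplus M) x" if x: "x \<in> \<Lambda>" for x
  proof -
    have nx: "norm x < 1" using assms x by auto
    have "logplus (norm (\<omega> x * a x)) \<le> logplus (norm (\<omega> x)) + logplus (norm (a x))"
      unfolding norm_mult by (rule logplus_mult_le) auto
    also have "\<dots> \<le> logplus M + poisson_int w x" using w(3) M(2) x by (intro add_mono logplus_mono) auto
    also have "\<dots> = poisson_int (\<lambda>\<zeta>. w \<zeta> + logplus M) x"
      using in_Lphi_circ_integrable[OF w(2)] by (subst poisson_int_add[OF nx]) (auto simp: poisson_int_const[OF nx] circ_integrable_iff)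
    finally show ?thesis .
  qed
  moreover have "in_Lphi \<phi> (\<lambda>\<zeta>. w \<zeta> + logplus M)" by (intro in_Lphi_add in_Lphi_const w)
  ultimately show "(\<lambda>z. if z \<in> \<Lambda> then \<omega> z * a z else 0) \<in> l_Phi \<phi> \<Lambda>"
    unfolding l_Phi_def using w(1) by (auto intro!: exI[of _ "\<lambda>\<zeta>. w \<zeta> + logplus M"])
qed

section \<open>Necessity\<close>

lemma orlicz_ball_average:
  assumes "finite I" "I \<noteq> {}" "\<And>i. i \<in> I \<Longrightarrow> u i \<in> orlicz_ball \<phi> N"
  shows "(\<lambda>\<zeta>. (\<Sum>i\<in>I. u i \<zeta>) / real (card I)) \<in> orlicz_ball \<phi> N"
  using assms
proof (induction rule: finite_ne_induct)
  case (singleton x)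
  then show ?case by simp
next
  case (insert x I)
  define n where "n = real (card I)"
  have n: "n > 0" using insert.hyps by (simp add: n_def card_gt_0_iff)
  have "(\<lambda>\<zeta>. (1 - 1 / (n + 1)) * ((\<Sum>i\<in>I. u i \<zeta>) / n) + 1 / (n + 1) * u x \<zeta>) \<in> orlicz_ball \<phi> N"
    using insert n unfolding n_def by (intro orlicz_ball_convex) auto
  moreover have "(1 - 1 / (n + 1)) * (s / n) + 1 / (n + 1) * y = (y + s) / (1 + n)" for s y :: real
    using n by (simp add: divide_simps) (simp add: algebra_simps)
  ultimately show ?case using insert.hyps by (simp add: n_def)
qed

lemma poisson_int_average:
  assumes z: "norm z < 1" and i: "\<And>i. i \<in> I \<Longrightarrow> circ_integrable (u i)"
  shows "poisson_int (\<lambda>\<zeta>. (\<Sum>i\<in>I. u i \<zeta>) / c) z = (\<Sum>i\<in>I. poisson_int (u i) z) / c"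
proof -
  have "(\<integral>t. poisson z (cis t) * (\<Sum>i\<in>I. u i (cis t)) \<partial>circ) = (\<Sum>i\<in>I. \<integral>t. poisson z (cis t) * u i (cis t) \<partial>circ)"
    unfolding sum_distrib_left using integrable_poisson_mult[OF z i] by (intro Bochner_Integration.integral_sum) auto
  then show ?thesis by (simp add: poisson_int_eq)
qed

text \<open>Two memberships are prescribed, the remaining \<open>card G - 2\<close> are
  free.\<close>

lemma card_subsets_separating:
  assumes "finite G" "l \<in> G" "m \<in> G" "l \<noteq> m"
  shows "4 * card {T \<in> Pow G. l \<in> T \<and> m \<notin> T} = 2 ^ card G"
proof -
  have "bij_betw (insert l) (Pow (G - {l, m})) {T \<in> Pow G. l \<in> T \<and> m \<notin> T}"
    by (rule bij_betwI[where g = "\<lambda>T. T - {l}"]) (use assms in auto)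
  then have "card {T \<in> Pow G. l \<in> T \<and> m \<notin> T} = card (Pow (G - {l, m}))" by (simp add: bij_betw_same_card)
  also have "\<dots> = 2 ^ (card G - 2)" using assms by (simp add: card_Pow card_Diff_subset)
  finally have "4 * card {T \<in> Pow G. l \<in> T \<and> m \<notin> T} = 2 ^ (2 + (card G - 2))" by (simp add: power_add)
  also have "2 + (card G - 2) = card G" using card_mono[of G "{l, m}"] assms by auto
  finally show ?thesis .
qed

lemma poisson_majorant_of_free_interpolating:
  assumes \<Lambda>: "blaschke_seq \<Lambda>" and free: "free_interpolating (hardy_orlicz \<phi>) \<Lambda>"
  shows "\<exists>w. (\<forall>\<zeta>\<in>sphere 0 1. 0 < w \<zeta>) \<and> in_Lphi \<phi> w \<and> (\<forall>x\<in>\<Lambda>. phi_Lambda \<Lambda> x \<le> poisson_int w x)"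
proof (cases "\<Lambda> = {}")
  case True
  then show ?thesis using in_Lphi_const[of 1] by (intro exI[of _ "\<lambda>_. 1"]) auto
next
  case False
  define e where "e = from_nat_into \<Lambda>"
  have rng: "range e = \<Lambda>" unfolding e_def using False blaschke_seq_countable[OF \<Lambda>] by (rule range_from_nat_into)
  define Fn where "Fn = (\<lambda>n::nat. e ` {..n})"
  have Fn: "finite (Fn n)" "Fn n \<subseteq> \<Lambda>" for n using rng by (auto simp: Fn_def)
  have evF: "eventually (\<lambda>n. F \<subseteq> Fn n) sequentially" if "finite F" "F \<subseteq> \<Lambda>" for F
    using that
  proof (induction F)
    case (insert x F)
    then obtain m where m: "e m = x" using rng by blast
    have "eventually (\<lambda>n. F \<subseteq> Fn n) sequentially" using insert by auto
    with eventually_ge_at_top[of m] show ?case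
      by eventually_elim (use m in \<open>auto simp: Fn_def\<close>)
  qed simp
  have \<Lambda>b: "norm l < 1" if "l \<in> \<Lambda>" for l using \<Lambda> that by (auto simp: blaschke_seq_def)
  have bk0: "0 \<le> bk l m" if "l \<in> \<Lambda>" "m \<in> \<Lambda>" for l m using \<Lambda>b that by (intro bk_nonneg) auto
  \<comment> \<open>Finite sets \<open>F\<close> replace the infinite sum over
    \<open>\<Lambda> - S\<close>; in this form each inequality depends on finitely many
    memberships.\<close>
  define good where "good = (\<lambda>(N::nat) S. \<exists>w\<in>orlicz_ball \<phi> N. \<forall>l\<in>S. \<forall>F. finite F \<longrightarrow> F \<subseteq> \<Lambda> - S \<longrightarrow>
      (\<Sum>m\<in>F. bk l m) \<le> poisson_int w l)"
  have ex_good: "\<exists>N. good N S" if S: "S \<subseteq> \<Lambda>" for S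
  proof -
    have one: "(\<lambda>z. if z \<in> \<Lambda> then 1 else 0) \<in> trace_on (hardy_orlicz \<phi>) \<Lambda>"
      unfolding trace_on_def using const_one_in_hardy_orlicz by (intro CollectI exI[of _ "\<lambda>_. 1"]) auto
    have bd: "bounded ((\<lambda>z. if z \<in> S then 1 else 0 :: complex) ` \<Lambda>)"
      by (rule finite_imp_bounded, rule finite_subset[of _ "{0, 1}"]) auto
    have "(\<lambda>z. if z \<in> \<Lambda> then (if z \<in> S then 1 else 0) * (if z \<in> \<Lambda> then 1 else 0) else 0) \<in> trace_on (hardy_orlicz \<phi>) \<Lambda>"
      using free[unfolded free_interpolating_def ideal_on_def, rule_format, OF one bd] .
    then obtain f where f: "f \<in> hardy_orlicz \<phi>"
      "(\<lambda>z. if z \<in> \<Lambda> then (if z \<in> S then 1 else 0) * (if z \<in> \<Lambda> then 1 else 0) else 0) = (\<lambda>z. if z \<in> \<Lambda> then f z else 0)"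
      by (auto simp: trace_on_def)
    have fz: "f z = (if z \<in> S then 1 else 0)" if "z \<in> \<Lambda>" for z using fun_cong[OF f(2), of z] that by simp
    define w where "w = (\<lambda>\<zeta>. logplus (norm (bv f \<zeta>)))"
    have wL: "in_Lphi \<phi> w" unfolding w_def by (rule in_Lphi_logplus_bv[OF f(1)])
    obtain N :: nat where N: "(\<integral>t. \<phi> (w (cis t)) \<partial>circ) \<le> real N" using real_arch_simple by blast
    have "w \<in> orlicz_ball \<phi> N" using wL N by (simp add: orlicz_ball_def in_Lphi_iff w_def)
    moreover have "(\<Sum>m\<in>F. bk l m) \<le> poisson_int w l" if "l \<in> S" "finite F" "F \<subseteq> \<Lambda> - S" for l F
    proof -
      have "f \<in> smirnov" using f by (simp add: hardy_orlicz_def)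
      moreover have "F \<subseteq> ball 0 1" using that \<Lambda>b by auto
      moreover have "\<forall>m\<in>F. f m = 0" "f l = 1" "norm l < 1" using that fz S \<Lambda>b by auto
      ultimately show ?thesis using smirnov_zeros_bound[of f F l] that by (simp add: w_def)
    qed
    ultimately show ?thesis unfolding good_def by blast
  qed
  \<comment> \<open>\<open>good N\<close> is closed in the product topology of the power set: each
    single inequality holds for all late approximants, and \<open>orlicz_ball_compact\<close> passes
    it to a common weight.\<close>
  have closed: "good N S" if S: "S \<subseteq> \<Lambda>" and ap: "\<And>n. \<exists>S'. S' \<inter> Fn n = S \<inter> Fn n \<and> good N S'" for N S
  proof -
    obtain S' where S': "\<And>n. S' n \<inter> Fn n = S \<inter> Fn n" "\<And>n. good N (S' n)" using ap by metis
    obtain w where w: "\<And>n. w n \<in> orlicz_ball \<phi> N"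
      "\<And>n l F. l \<in> S' n \<Longrightarrow> finite F \<Longrightarrow> F \<subseteq> \<Lambda> - S' n \<Longrightarrow> (\<Sum>m\<in>F. bk l m) \<le> poisson_int (w n) l"
      using S'(2) unfolding good_def by metis
    obtain v where v: "v \<in> orlicz_ball \<phi> N"
      "\<And>z s. norm z < 1 \<Longrightarrow> eventually (\<lambda>n. s \<le> poisson_int (w n) z) sequentially \<Longrightarrow> s \<le> poisson_int v z"
      using orlicz_ball_compact[of w N] w(1) by blast
    have "(\<Sum>m\<in>F. bk l m) \<le> poisson_int v l" if l: "l \<in> S" "finite F" "F \<subseteq> \<Lambda> - S" for l F
    proof (rule v(2))
      show "norm l < 1" using l S \<Lambda>b by auto
      have "eventually (\<lambda>n. insert l F \<subseteq> Fn n) sequentially" using l S by (intro evF) auto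
      then show "eventually (\<lambda>n. (\<Sum>m\<in>F. bk l m) \<le> poisson_int (w n) l) sequentially"
      proof eventually_elim
        case (elim n)
        show ?case using S'(1)[of n] l elim by (intro w(2)) blast+
      qed
    qed
    then show ?thesis unfolding good_def using v(1) by blast
  qed
  \<comment> \<open>The Baire category argument by hand: otherwise nested cylinders avoiding
    \<open>good 0\<close>, \<open>good 1\<close> and so on would determine a set \<open>T\<close>
    that is in none of them.\<close>
  have cyl: "\<exists>N F0 S0. finite F0 \<and> F0 \<subseteq> \<Lambda> \<and> S0 \<subseteq> F0 \<and> (\<forall>S\<subseteq>\<Lambda>. S \<inter> F0 = S0 \<longrightarrow> good N S)"
  proof (rule ccontr)
    assume no: "\<not> ?thesis"
    have step: "\<exists>F1 S1. finite F1 \<and> F1 \<subseteq> \<Lambda> \<and> S1 \<subseteq> F1 \<and> F0 \<subseteq> F1 \<and> S1 \<inter> F0 = S0 \<and>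
        (\<forall>S\<subseteq>\<Lambda>. S \<inter> F1 = S1 \<longrightarrow> \<not> good N S)" if F0: "finite F0" "F0 \<subseteq> \<Lambda>" "S0 \<subseteq> F0" for F0 S0 N
    proof -
      obtain S where S: "S \<subseteq> \<Lambda>" "S \<inter> F0 = S0" "\<not> good N S" using no F0 by meson
      have "\<exists>n. \<forall>S'. S' \<inter> Fn n = S \<inter> Fn n \<longrightarrow> \<not> good N S'"
      proof (rule ccontr)
        assume "\<not> (\<exists>n. \<forall>S'. S' \<inter> Fn n = S \<inter> Fn n \<longrightarrow> \<not> good N S')"
        then have "\<And>n. \<exists>S'. S' \<inter> Fn n = S \<inter> Fn n \<and> good N S'" by meson
        from closed[OF S(1) this] S(3) show False by contradiction
      qed
      then obtain n where n: "\<And>S'. S' \<inter> Fn n = S \<inter> Fn n \<Longrightarrow> \<not> good N S'" by meson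
      show ?thesis
      proof (intro exI conjI allI impI)
        show "finite (F0 \<union> Fn n)" "F0 \<union> Fn n \<subseteq> \<Lambda>" using F0 Fn[of n] by auto
        show "S \<inter> (F0 \<union> Fn n) \<subseteq> F0 \<union> Fn n" "F0 \<subseteq> F0 \<union> Fn n" by auto
        show "S \<inter> (F0 \<union> Fn n) \<inter> F0 = S0" using S(2) by blast
        fix S' assume "S' \<subseteq> \<Lambda>" "S' \<inter> (F0 \<union> Fn n) = S \<inter> (F0 \<union> Fn n)"
        then have "S' \<inter> Fn n = S \<inter> Fn n" by blast
        then show "\<not> good N S'" by (rule n)
      qed
    qed
    define P where "P = (\<lambda>(_::nat) (FS :: complex set \<times> complex set). finite (fst FS) \<and> fst FS \<subseteq> \<Lambda> \<and> snd FS \<subseteq> fst FS)"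
    define Q where "Q = (\<lambda>N (FS :: complex set \<times> complex set) FS'. fst FS \<subseteq> fst FS' \<and> snd FS' \<inter> fst FS = snd FS \<and>
        (\<forall>S\<subseteq>\<Lambda>. S \<inter> fst FS' = snd FS' \<longrightarrow> \<not> good N S))"
    have "\<exists>p. \<forall>n. P n (p n) \<and> Q n (p n) (p (Suc n))"
    proof (rule dependent_nat_choice)
      show "\<exists>x. P 0 x" by (intro exI[of _ "({}, {})"]) (simp add: P_def)
      fix x n assume "P n x"
      then have "finite (fst x)" "fst x \<subseteq> \<Lambda>" "snd x \<subseteq> fst x" by (simp_all add: P_def)
      from step[OF this, of n] obtain F1 S1 where "finite F1" "F1 \<subseteq> \<Lambda>" "S1 \<subseteq> F1" "fst x \<subseteq> F1" "S1 \<inter> fst x = snd x"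
        "\<forall>S\<subseteq>\<Lambda>. S \<inter> F1 = S1 \<longrightarrow> \<not> good n S"
        by (elim exE conjE)
      then show "\<exists>y. P (Suc n) y \<and> Q n x y" by (intro exI[of _ "(F1, S1)"]) (simp add: P_def Q_def)
    qed
    then obtain p where p: "\<And>n. P n (p n)" "\<And>n. Q n (p n) (p (Suc n))" by blast
    define F where "F = (\<lambda>n. fst (p n))"
    define S where "S = (\<lambda>n. snd (p n))"
    have FS: "F n \<subseteq> \<Lambda>" "S n \<subseteq> F n" "F n \<subseteq> F (Suc n)" "S (Suc n) \<inter> F n = S n" for n
      using p(1)[of n] p(2)[of n] by (auto simp: P_def Q_def F_def S_def)
    have ng: "\<not> good n T" if "T \<subseteq> \<Lambda>" "T \<inter> F (Suc n) = S (Suc n)" for n T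
      using p(2)[of n] that by (simp add: Q_def F_def S_def)
    have mon: "F m \<subseteq> F n \<and> S n \<inter> F m = S m" if "m \<le> n" for m n
      using that
    proof (induction n)
      case 0
      then show ?case using FS(2)[of 0] by auto
    next
      case (Suc n)
      show ?case
      proof (cases "m = Suc n")
        case True
        then show ?thesis using FS(2)[of "Suc n"] by auto
      next
        case False
        then have "F m \<subseteq> F n" "S n \<inter> F m = S m" using Suc by auto
        then show ?thesis using FS(3,4)[of n] by blast
      qed
    qed
    define T where "T = (\<Union>n. S n)"
    have "T \<inter> F n = S n" for n
    proof
      show "S n \<subseteq> T \<inter> F n" using FS(2) by (auto simp: T_def)
      show "T \<inter> F n \<subseteq> S n"
      proof
        fix x assume "x \<in> T \<inter> F n"
        then obtain m where m: "x \<in> S m" "x \<in> F n" by (auto simp: T_def)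
        show "x \<in> S n"
        proof (cases "m \<le> n")
          case True then show ?thesis using mon[OF True] m by blast
        next
          case False then show ?thesis using mon[of n m] m by auto
        qed
      qed
    qed
    moreover have "T \<subseteq> \<Lambda>" using FS(1,2) by (force simp: T_def)
    ultimately show False using ex_good[of T] ng[of T] by auto
  qed
  obtain N F0 S0 where F0: "finite F0" "F0 \<subseteq> \<Lambda>" "S0 \<subseteq> F0" "\<And>S. S \<subseteq> \<Lambda> \<Longrightarrow> S \<inter> F0 = S0 \<Longrightarrow> good N S"
    using cyl by blast
  \<comment> \<open>For \<open>T \<subseteq> G\<close> the set \<open>S0 \<union> T\<close> lies in
    the cylinder. Averaging the weights over all \<open>T\<close> counts \<open>bk l m\<close> for
    the quarter of them with \<open>l \<in> T\<close> and \<open>m \<notin> T\<close>.\<close>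
  have avg: "\<exists>w\<in>orlicz_ball \<phi> N. \<forall>l\<in>G. (1/4) * (\<Sum>m\<in>G - {l}. bk l m) \<le> poisson_int w l"
    if G: "finite G" "G \<subseteq> \<Lambda> - F0" for G
  proof -
    have "\<exists>w\<in>orlicz_ball \<phi> N. \<forall>l\<in>T. (\<Sum>m\<in>G - T. bk l m) \<le> poisson_int w l" if T: "T \<subseteq> G" for T
    proof -
      have "good N (S0 \<union> T)" using F0(2,3) G T by (intro F0(4)) auto
      then obtain w where w: "w \<in> orlicz_ball \<phi> N"
        "\<forall>l\<in>S0 \<union> T. \<forall>F. finite F \<longrightarrow> F \<subseteq> \<Lambda> - (S0 \<union> T) \<longrightarrow> (\<Sum>m\<in>F. bk l m) \<le> poisson_int w l"
        unfolding good_def by (elim bexE)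
      have "G - T \<subseteq> \<Lambda> - (S0 \<union> T)" "finite (G - T)" using G F0(3) by auto
      then have "(\<Sum>m\<in>G - T. bk l m) \<le> poisson_int w l" if "l \<in> T" for l
        using w(2)[rule_format, of l "G - T"] that by auto
      then show ?thesis using w(1) by (intro bexI[of _ w] ballI)
    qed
    then obtain w where w: "\<And>T. T \<subseteq> G \<Longrightarrow> w T \<in> orlicz_ball \<phi> N"
      "\<And>T l. T \<subseteq> G \<Longrightarrow> l \<in> T \<Longrightarrow> (\<Sum>m\<in>G - T. bk l m) \<le> poisson_int (w T) l" by metis
    define W where "W = (\<lambda>\<zeta>. (\<Sum>T\<in>Pow G. w T \<zeta>) / real (card (Pow G)))"
    have WB: "W \<in> orlicz_ball \<phi> N"
      unfolding W_def using G w(1) by (intro orlicz_ball_average) auto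
    have "(1/4) * (\<Sum>m\<in>G - {l}. bk l m) \<le> poisson_int W l" if l: "l \<in> G" for l
    proof -
      have l\<Lambda>: "l \<in> \<Lambda>" using l G by auto
      have nl: "norm l < 1" using \<Lambda>b l\<Lambda> by auto
      have cP: "real (card (Pow G)) = 2 ^ card G" using G by (simp add: card_Pow)
      have "(\<Sum>T\<in>Pow G. \<Sum>m\<in>G. if l \<in> T \<and> m \<notin> T then bk l m else 0) \<le> (\<Sum>T\<in>Pow G. poisson_int (w T) l)"
      proof (rule sum_mono)
        fix T assume T: "T \<in> Pow G"
        show "(\<Sum>m\<in>G. if l \<in> T \<and> m \<notin> T then bk l m else 0) \<le> poisson_int (w T) l"
        proof (cases "l \<in> T")
          case True
          have "(\<Sum>m\<in>G. if l \<in> T \<and> m \<notin> T then bk l m else 0) = (\<Sum>m\<in>G - T. bk l m)"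
            using G(1) True by (intro sum.mono_neutral_cong_right) auto
          then show ?thesis using w(2)[of T l] T True by simp
        next
          case False
          then show ?thesis using poisson_int_nonneg[OF nl] w(1)[of T] T by (simp add: orlicz_ball_def)
        qed
      qed
      moreover have "(\<Sum>T\<in>Pow G. \<Sum>m\<in>G. if l \<in> T \<and> m \<notin> T then bk l m else 0) = (\<Sum>m\<in>G - {l}. (2 ^ card G / 4) * bk l m)"
      proof -
        have "(\<Sum>T\<in>Pow G. \<Sum>m\<in>G. if l \<in> T \<and> m \<notin> T then bk l m else 0) = (\<Sum>m\<in>G. \<Sum>T\<in>Pow G. if l \<in> T \<and> m \<notin> T then bk l m else 0)"
          by (rule sum.swap)
        also have "\<dots> = (\<Sum>m\<in>G. real (card {T \<in> Pow G. l \<in> T \<and> m \<notin> T}) * bk l m)"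
        proof (rule sum.cong[OF refl])
          fix m
          have "(\<Sum>T\<in>Pow G. if l \<in> T \<and> m \<notin> T then bk l m else 0) = (\<Sum>T\<in>{T \<in> Pow G. l \<in> T \<and> m \<notin> T}. bk l m)"
            using G(1) by (intro sum.mono_neutral_cong_right) auto
          then show "(\<Sum>T\<in>Pow G. if l \<in> T \<and> m \<notin> T then bk l m else 0) = real (card {T \<in> Pow G. l \<in> T \<and> m \<notin> T}) * bk l m" by simp
        qed
        also have "\<dots> = (\<Sum>m\<in>G - {l}. (2 ^ card G / 4) * bk l m)"
        proof (rule sum.mono_neutral_cong_right)
          show "\<forall>m\<in>G - (G - {l}). real (card {T \<in> Pow G. l \<in> T \<and> m \<notin> T}) * bk l m = 0" by auto
          fix m assume m: "m \<in> G - {l}"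
          have "4 * card {T \<in> Pow G. l \<in> T \<and> m \<notin> T} = 2 ^ card G" using G(1) l m by (intro card_subsets_separating) auto
          from arg_cong[OF this, of real] have "real (card {T \<in> Pow G. l \<in> T \<and> m \<notin> T}) = 2 ^ card G / 4" by simp
          then show "real (card {T \<in> Pow G. l \<in> T \<and> m \<notin> T}) * bk l m = (2 ^ card G / 4) * bk l m" by (rule arg_cong)
        qed (use G in auto)
        finally show ?thesis .
      qed
      ultimately have "(2 ^ card G / 4) * (\<Sum>m\<in>G - {l}. bk l m) \<le> (\<Sum>T\<in>Pow G. poisson_int (w T) l)"
        by (simp add: sum_distrib_left)
      then have "(1/4) * (\<Sum>m\<in>G - {l}. bk l m) \<le> (\<Sum>T\<in>Pow G. poisson_int (w T) l) / 2 ^ card G"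
        by (simp add: field_simps)
      also have "\<dots> = poisson_int W l"
        unfolding W_def cP using orlicz_ball_circ_integrable[OF w(1)] by (subst poisson_int_average[OF nl]) auto
      finally show ?thesis .
    qed
    then show ?thesis using WB by blast
  qed
  have "\<exists>w\<in>orlicz_ball \<phi> N. \<forall>l\<in>Fn n - F0. (1/4) * (\<Sum>m\<in>Fn n - F0 - {l}. bk l m) \<le> poisson_int w l" for n
    using Fn[of n] by (intro avg) auto
  then obtain w where w: "\<And>n. w n \<in> orlicz_ball \<phi> N"
    "\<And>n l. l \<in> Fn n - F0 \<Longrightarrow> (1/4) * (\<Sum>m\<in>Fn n - F0 - {l}. bk l m) \<le> poisson_int (w n) l" by metis
  obtain v where v: "v \<in> orlicz_ball \<phi> N"
    "\<And>z s. norm z < 1 \<Longrightarrow> eventually (\<lambda>n. s \<le> poisson_int (w n) z) sequentially \<Longrightarrow> s \<le> poisson_int v z"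
    using orlicz_ball_compact[of w N] w(1) by blast
  have far: "(1/4) * (\<Sum>m\<in>F. bk l m) \<le> poisson_int v l" if l: "l \<in> \<Lambda> - F0" "finite F" "F \<subseteq> \<Lambda> - F0 - {l}" for l F
  proof (rule v(2))
    show "norm l < 1" using l \<Lambda>b by auto
    have "eventually (\<lambda>n. insert l F \<subseteq> Fn n) sequentially" using l by (intro evF) auto
    then show "eventually (\<lambda>n. (1/4) * (\<Sum>m\<in>F. bk l m) \<le> poisson_int (w n) l) sequentially"
    proof eventually_elim
      case (elim n)
      have "(\<Sum>m\<in>F. bk l m) \<le> (\<Sum>m\<in>Fn n - F0 - {l}. bk l m)"
        using elim l Fn[of n] by (intro sum_mono2) (auto intro!: bk0)
      then show ?case using w(2)[of l n] elim l by auto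
    qed
  qed
  \<comment> \<open>The averaging does not reach pairs that involve \<open>F0\<close>. By symmetry
    of \<open>bk\<close> the terms with \<open>m\<close> in \<open>F0\<close> sum to at most
    \<open>c0\<close>, which also bounds \<open>phi_Lambda\<close> on \<open>F0\<close>.\<close>
  define c0 where "c0 = (\<Sum>m\<in>F0. phi_Lambda \<Lambda> m)"
  have phi0: "0 \<le> phi_Lambda \<Lambda> m" if "m \<in> \<Lambda>" for m using phi_Lambda_nonneg[OF \<Lambda> that] .
  have c0: "0 \<le> c0" unfolding c0_def using F0(2) phi0 by (intro sum_nonneg) auto
  define W where "W = (\<lambda>\<zeta>. 4 * v \<zeta> + (c0 + 1))"
  have vL: "in_Lphi \<phi> v" using v(1) by (simp add: orlicz_ball_def in_Lphi_iff)
  have WL: "in_Lphi \<phi> W" unfolding W_def by (intro in_Lphi_add in_Lphi_cmult in_Lphi_const vL)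
  have PW: "poisson_int W l = 4 * poisson_int v l + (c0 + 1)" if "norm l < 1" for l
    unfolding W_def using in_Lphi_circ_integrable[OF in_Lphi_cmult[OF vL, of 4]]
    by (subst poisson_int_add[OF that]) (auto simp: poisson_int_cmult poisson_int_const[OF that] circ_integrable_iff)
  have v0: "0 \<le> v \<zeta>" for \<zeta> using v(1) by (simp add: orlicz_ball_def)
  have "phi_Lambda \<Lambda> x \<le> poisson_int W x" if x: "x \<in> \<Lambda>" for x
  proof (cases "x \<in> F0")
    case True
    have "phi_Lambda \<Lambda> x \<le> c0" unfolding c0_def using F0 True phi0 by (intro member_le_sum) auto
    moreover have "0 \<le> poisson_int v x" using poisson_int_nonneg[OF \<Lambda>b[OF x]] v0 by blast
    ultimately show ?thesis using PW[OF \<Lambda>b[OF x]] by simp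
  next
    case False
    show ?thesis
    proof (rule phi_Lambda_leI[OF \<Lambda> x])
      fix F assume F: "finite F" "F \<subseteq> \<Lambda> - {x}"
      have "(\<Sum>m\<in>F. bk x m) = (\<Sum>m\<in>F - F0. bk x m) + (\<Sum>m\<in>F \<inter> F0. bk x m)"
        using sum.Int_Diff[OF F(1), of "bk x" F0] by simp
      moreover have "(\<Sum>m\<in>F - F0. bk x m) \<le> 4 * poisson_int v x"
      proof -
        have "F - F0 \<subseteq> \<Lambda> - F0 - {x}" using F(2) by blast
        then show ?thesis using far[of x "F - F0"] F(1) x False by auto
      qed
      moreover have "(\<Sum>m\<in>F \<inter> F0. bk x m) \<le> c0"
      proof -
        have "(\<Sum>m\<in>F \<inter> F0. bk x m) \<le> (\<Sum>m\<in>F \<inter> F0. phi_Lambda \<Lambda> m)"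
        proof (rule sum_mono)
          fix m assume m: "m \<in> F \<inter> F0"
          have "(\<Sum>l\<in>{x}. bk m l) \<le> phi_Lambda \<Lambda> m"
            using m F0 False x by (intro sum_bk_le_phi_Lambda[OF \<Lambda>]) auto
          then show "bk x m \<le> phi_Lambda \<Lambda> m" using bk_commute[of x m] by simp
        qed
        also have "\<dots> \<le> c0" unfolding c0_def using F0 phi0 by (intro sum_mono2) auto
        finally show ?thesis .
      qed
      ultimately show "(\<Sum>m\<in>F. bk x m) \<le> poisson_int W x" using PW[OF \<Lambda>b[OF x]] by simp
    qed
  qed
  moreover have "0 < W \<zeta>" for \<zeta> using v0[of \<zeta>] c0 by (simp add: W_def)
  ultimately show ?thesis using WL by blast
qed

end

section \<open>The dual condition\<close>

lemma infsum_ennreal_finite_support: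
  assumes "finite F" "F \<subseteq> A"
  shows "(\<Sum>\<^sub>\<infinity>x\<in>A. ennreal ((if x \<in> F then c x else 0) * h x)) = (\<Sum>x\<in>F. ennreal (c x * h x))"
proof -
  have "(\<Sum>\<^sub>\<infinity>x\<in>A. ennreal ((if x \<in> F then c x else 0) * h x)) = (\<Sum>\<^sub>\<infinity>x\<in>F. ennreal (c x * h x))"
    using assms by (intro infsum_cong_neutral) auto
  then show ?thesis using assms by simp
qed

locale orlicz_modified = orlicz_function +
  fixes \<psi> :: "real \<Rightarrow> real"
  assumes mod: "orlicz_modification \<phi> \<psi>"
begin

text \<open>\<open>\<psi>\<close> is controlled only on the half line; continuing it by
  \<open>\<psi> 0 = 0\<close> gives a function that is continuous on all reals.\<close>

definition \<rho> :: "real \<Rightarrow> real" where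
  "\<rho> t = \<psi> (max 0 t)"

lemma psi_convex: "convex_on {0..} \<psi>" and psi_0: "\<psi> 0 = 0" and psi_nonneg: "0 \<le> t \<Longrightarrow> 0 \<le> \<psi> t"
  using mod by (auto simp: orlicz_modification_def)

lemma psi_eventually: obtains t0 where "t0 \<ge> 0" "\<And>t. t \<ge> t0 \<Longrightarrow> \<psi> t = \<phi> t"
  using mod by (auto simp: orlicz_modification_def)

lemma psi_scale: "0 \<le> k \<Longrightarrow> k \<le> 1 \<Longrightarrow> 0 \<le> t \<Longrightarrow> \<psi> (k * t) \<le> k * \<psi> t"
  using convex_onD[OF psi_convex, of k 0 t] psi_0 by simp

lemma psi_mono:
  assumes "0 \<le> s" "s \<le> t"
  shows "\<psi> s \<le> \<psi> t"
proof (cases "t = 0")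
  case True
  then show ?thesis using assms by simp
next
  case False
  then have t: "t > 0" using assms by simp
  have "\<psi> (s / t * t) \<le> s / t * \<psi> t" using assms t by (intro psi_scale) auto
  also have "\<dots> \<le> 1 * \<psi> t" using assms t psi_nonneg by (intro mult_right_mono) auto
  finally show ?thesis using t by simp
qed

lemma rho_eq: "0 \<le> t \<Longrightarrow> \<rho> t = \<psi> t"
  by (simp add: \<rho>_def)

text \<open>A convex function may jump at an endpoint of its domain; at 0 this is excluded by
  \<open>\<psi> t \<le> t * \<psi> 1\<close> on the unit interval.\<close>

lemma rho_continuous: "continuous_on UNIV \<rho>"
proof -
  have pos: "isCont \<psi> x" if "x > 0" for x
  proof -
    have "continuous_on {0<..} \<psi>"
      by (rule convex_on_continuous) (auto intro: convex_on_subset[OF psi_convex])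
    then show ?thesis using that by (simp add: continuous_on_eq_continuous_at)
  qed
  have "isCont \<rho> x" for x
  proof (cases x "0::real" rule: linorder_cases)
    case less
    have "eventually (\<lambda>t. \<rho> t = 0) (nhds x)"
      using eventually_nhds_in_open[of "{..<0}" x] less by (auto elim!: eventually_mono simp: \<rho>_def psi_0)
    then have "isCont \<rho> x \<longleftrightarrow> isCont (\<lambda>_. 0::real) x" by (rule isCont_cong)
    then show ?thesis by simp
  next
    case greater
    have "eventually (\<lambda>t. \<rho> t = \<psi> t) (nhds x)"
      using eventually_nhds_in_open[of "{0<..}" x] greater by (auto elim!: eventually_mono simp: \<rho>_def)
    then have "isCont \<rho> x \<longleftrightarrow> isCont \<psi> x" by (rule isCont_cong)
    then show ?thesis using pos greater by simp
  next
    case equal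
    have "(\<rho> \<longlongrightarrow> 0) (at 0)"
    proof (rule Lim_null_comparison)
      show "\<forall>\<^sub>F t in at 0. norm (\<rho> t) \<le> max 0 t * \<psi> 1"
        unfolding eventually_at
      proof (intro exI[of _ 1] conjI ballI impI)
        fix t :: real assume t: "t \<noteq> 0 \<and> dist t 0 < 1"
        have "\<psi> (max 0 t * 1) \<le> max 0 t * \<psi> 1" using t by (intro psi_scale) auto
        then show "norm (\<rho> t) \<le> max 0 t * \<psi> 1" using psi_nonneg[of "max 0 t"] by (simp add: \<rho>_def)
      qed simp
      have "((\<lambda>t. max 0 t * \<psi> 1) \<longlongrightarrow> max 0 0 * \<psi> 1) (at (0::real))" by (intro tendsto_intros)
      then show "((\<lambda>t. max 0 t * \<psi> 1) \<longlongrightarrow> 0) (at (0::real))" by simp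
    qed
    then show ?thesis using equal by (simp add: isCont_def \<rho>_def psi_0)
  qed
  then show ?thesis by (simp add: continuous_on_eq_continuous_at)
qed

sublocale R: superlinear_convex \<rho>
proof
  show "continuous_on UNIV \<rho>" by (rule rho_continuous)
  have "convex_on {0..} \<rho> \<longleftrightarrow> convex_on {0..} \<psi>"
    unfolding convex_on_def by (auto simp: rho_eq) 
  then show "convex_on {0..} \<rho>" using psi_convex by blast
  show "0 \<le> \<rho> t" for t by (simp add: \<rho>_def psi_nonneg)
  obtain t0 where t0: "t0 \<ge> 0" "\<And>t. t \<ge> t0 \<Longrightarrow> \<psi> t = \<phi> t" by (rule psi_eventually) blast
  have "eventually (\<lambda>t. \<phi> t / t = \<rho> t / t) at_top"
    using eventually_ge_at_top[of t0] by eventually_elim (use t0 in \<open>auto simp: rho_eq\<close>)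
  then show "filterlim (\<lambda>t. \<rho> t / t) at_top at_top"
    using superlinear filterlim_cong[OF refl refl] by fast
qed

text \<open>Beyond \<open>t0\<close> the functions agree; below \<open>t0\<close> both are bounded
  by their common value there, so \<open>b = \<phi> t0\<close> works.\<close>

lemma rho_phi_comparable:
  obtains b where "\<And>t. 0 \<le> t \<Longrightarrow> \<rho> t \<le> \<phi> t + b" "\<And>t. 0 \<le> t \<Longrightarrow> \<phi> t \<le> \<rho> t + b"
proof -
  obtain t0 where t0: "t0 \<ge> 0" "\<And>t. t \<ge> t0 \<Longrightarrow> \<psi> t = \<phi> t" by (rule psi_eventually) blast
  show ?thesis
  proof
    fix t :: real assume t: "0 \<le> t"
    have "\<psi> t \<le> \<phi> t + \<phi> t0"
      using psi_mono[of t t0] t t0 phi_nonneg[of t] phi_nonneg[of t0] by (cases "t \<le> t0") auto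
    then show "\<rho> t \<le> \<phi> t + \<phi> t0" using t by (simp add: rho_eq)
    have "\<phi> t \<le> \<psi> t + \<phi> t0"
      using monoD[OF phi_mono, of t t0] t t0 psi_nonneg[OF t] phi_nonneg[of t0] by (cases "t \<le> t0") auto
    then show "\<phi> t \<le> \<rho> t + \<phi> t0" using t by (simp add: rho_eq)
  qed
qed

lemma integrable_rho_of_in_Lphi:
  assumes "in_Lphi \<phi> u"
  shows "integrable circ (\<lambda>t. \<rho> \<bar>u (cis t)\<bar>)"
proof -
  obtain b where b: "\<And>t. 0 \<le> t \<Longrightarrow> \<rho> t \<le> \<phi> t + b" "\<And>t. 0 \<le> t \<Longrightarrow> \<phi> t \<le> \<rho> t + b"
    by (rule rho_phi_comparable) blast
  have i: "integrable circ (\<lambda>t. \<phi> \<bar>u (cis t)\<bar> + b)" and m: "(\<lambda>t. u (cis t)) \<in> borel_measurable circ"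
    using assms by (auto simp: in_Lphi_iff)
  show ?thesis
  proof (rule Bochner_Integration.integrable_bound[OF i])
    show "(\<lambda>t. \<rho> \<bar>u (cis t)\<bar>) \<in> borel_measurable circ" using m by measurable
    show "AE t in circ. norm (\<rho> \<bar>u (cis t)\<bar>) \<le> norm (\<phi> \<bar>u (cis t)\<bar> + b)"
      using b(1) R.nonneg by (intro AE_I2) (smt (verit) abs_ge_zero real_norm_def)
  qed
qed

lemma in_Lphi_of_orlicz_ball:
  assumes "u \<in> orlicz_ball \<rho> N"
  shows "in_Lphi \<phi> u"
proof -
  obtain b where b: "\<And>t. 0 \<le> t \<Longrightarrow> \<rho> t \<le> \<phi> t + b" "\<And>t. 0 \<le> t \<Longrightarrow> \<phi> t \<le> \<rho> t + b"
    by (rule rho_phi_comparable) blast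
  have i: "integrable circ (\<lambda>t. \<rho> (u (cis t)) + b)" and m: "(\<lambda>t. u (cis t)) \<in> borel_measurable circ"
    and u0: "\<And>\<zeta>. 0 \<le> u \<zeta>"
    using assms by (auto simp: orlicz_ball_def)
  have "integrable circ (\<lambda>t. \<phi> \<bar>u (cis t)\<bar>)"
  proof (rule Bochner_Integration.integrable_bound[OF i])
    show "(\<lambda>t. \<phi> \<bar>u (cis t)\<bar>) \<in> borel_measurable circ" using m by measurable
    have "\<phi> \<bar>u (cis t)\<bar> \<le> \<rho> (u (cis t)) + b" for t using b(2)[of "u (cis t)"] u0[of "cis t"] by simp
    then show "AE t in circ. norm (\<phi> \<bar>u (cis t)\<bar>) \<le> norm (\<rho> (u (cis t)) + b)"
      using phi_nonneg by (auto intro!: AE_I2 order.trans[OF _ abs_ge_self])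
  qed
  then show ?thesis using m by (simp add: in_Lphi_iff)
qed

text \<open>For \<open>t \<ge> 1\<close> convexity gives \<open>\<integral> \<psi>(|u|/t) \<le> (\<integral> \<psi>(|u|)) / t\<close>, so the infimum defining the norm
  ranges over a nonempty set.\<close>

lemma orlicz_norm_witness:
  assumes u: "in_Lphi \<phi> u"
  obtains T where "T \<ge> 1" "circ_nn_mean (\<lambda>\<zeta>. ennreal (\<psi> (\<bar>u \<zeta>\<bar> / T))) \<le> 1"
proof -
  define m where "m = (\<integral>t. \<rho> \<bar>u (cis t)\<bar> \<partial>circ)"
  define T where "T = max 1 m"
  have T: "T \<ge> 1" "m \<le> T" by (auto simp: T_def)
  have i: "integrable circ (\<lambda>t. \<rho> \<bar>u (cis t)\<bar>)" by (rule integrable_rho_of_in_Lphi[OF u])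
  have um: "(\<lambda>t. u (cis t)) \<in> borel_measurable circ" using u by (simp add: in_Lphi_iff)
  have eq: "\<psi> (\<bar>x\<bar> / T) = \<rho> (\<bar>x\<bar> / T)" for x using T by (simp add: rho_eq)
  have "circ_nn_mean (\<lambda>\<zeta>. ennreal (\<psi> (\<bar>u \<zeta>\<bar> / T))) = (\<integral>\<^sup>+t. ennreal (\<psi> (\<bar>u (cis t)\<bar> / T)) \<partial>circ)"
    unfolding eq by (rule circ_nn_mean_eq) (use um in measurable)
  also have "\<dots> \<le> (\<integral>\<^sup>+t. ennreal (1 / T * \<rho> \<bar>u (cis t)\<bar>) \<partial>circ)"
  proof (intro nn_integral_mono ennreal_leI)
    fix t
    show "\<psi> (\<bar>u (cis t)\<bar> / T) \<le> 1 / T * \<rho> \<bar>u (cis t)\<bar>"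
      using psi_scale[of "1 / T" "\<bar>u (cis t)\<bar>"] T by (simp add: rho_eq)
  qed
  also have "\<dots> = ennreal (\<integral>t. 1 / T * \<rho> \<bar>u (cis t)\<bar> \<partial>circ)"
    using i T R.nonneg by (intro nn_integral_eq_integral) auto
  also have "(\<integral>t. 1 / T * \<rho> \<bar>u (cis t)\<bar> \<partial>circ) = m / T" by (simp add: m_def)
  also have "ennreal (m / T) \<le> ennreal 1" using T by (intro ennreal_leI) auto
  finally show ?thesis using T(1) by (intro that[of T]) auto
qed

text \<open>Test the dual norm with \<open>w / T\<close>, where \<open>T\<close> is large enough for
  its norm to be at most 1. Integrating the sum of the \<open>c x * poisson x\<close> against
  \<open>w\<close> produces the \<open>c x * poisson_int w x\<close>, and
  \<open>C = T\<close>.\<close>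

lemma dual_condition_of_majorant:
  assumes w: "\<forall>\<zeta>\<in>sphere 0 1. 0 < w \<zeta>" "in_Lphi \<phi> w" "\<forall>x\<in>\<Lambda>. phi_Lambda \<Lambda> x \<le> poisson_int w x"
    and \<Lambda>: "\<Lambda> \<subseteq> ball 0 1"
  shows "\<exists>C>0. \<forall>c::complex \<Rightarrow> real. (\<forall>x\<in>\<Lambda>. 0 \<le> c x) \<longrightarrow>
      (\<Sum>\<^sub>\<infinity>x\<in>\<Lambda>. ennreal (c x * phi_Lambda \<Lambda> x))
        \<le> ennreal C * dual_norm_pos \<phi> \<psi> (\<lambda>\<zeta>. \<Sum>\<^sub>\<infinity>x\<in>\<Lambda>. ennreal (c x * poisson x \<zeta>))"
proof -
  obtain T where T: "T \<ge> 1" "circ_nn_mean (\<lambda>\<zeta>. ennreal (\<psi> (\<bar>w \<zeta>\<bar> / T))) \<le> 1"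
    using orlicz_norm_witness[OF w(2)] by blast
  define u where "u = (\<lambda>\<zeta>. 1 / T * w \<zeta>)"
  have uL: "in_Lphi \<phi> u" unfolding u_def by (rule in_Lphi_cmult[OF w(2)])
  have au: "\<bar>u \<zeta>\<bar> = \<bar>w \<zeta>\<bar> / T" for \<zeta> using T by (simp add: u_def abs_mult)
  have "orlicz_norm \<psi> u \<le> 1"
    unfolding orlicz_norm_def
  proof (rule cInf_lower)
    show "1 \<in> {t. 0 < t \<and> circ_nn_mean (\<lambda>\<zeta>. ennreal (\<psi> (\<bar>u \<zeta>\<bar> / t))) \<le> ennreal t}" using T by (simp add: au)
    show "bdd_below {t. 0 < t \<and> circ_nn_mean (\<lambda>\<zeta>. ennreal (\<psi> (\<bar>u \<zeta>\<bar> / t))) \<le> ennreal t}"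
      by (rule bdd_belowI[of _ 0]) auto
  qed
  then have dual: "circ_nn_mean (\<lambda>\<zeta>. g \<zeta> * ennreal \<bar>u \<zeta>\<bar>) \<le> dual_norm_pos \<phi> \<psi> g" for g
    unfolding dual_norm_pos_def using uL by (intro SUP_upper) auto
  have wi: "circ_integrable w" by (rule in_Lphi_circ_integrable[OF w(2)])
  have w0: "0 < w (cis t)" for t using w(1) by simp
  have wm: "(\<lambda>t. w (cis t)) \<in> borel_measurable circ" using w(2) by (simp add: in_Lphi_iff)
  have "(\<Sum>\<^sub>\<infinity>x\<in>\<Lambda>. ennreal (c x * phi_Lambda \<Lambda> x))
        \<le> ennreal T * dual_norm_pos \<phi> \<psi> (\<lambda>\<zeta>. \<Sum>\<^sub>\<infinity>x\<in>\<Lambda>. ennreal (c x * poisson x \<zeta>))"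
    if c: "\<forall>x\<in>\<Lambda>. 0 \<le> c x" for c :: "complex \<Rightarrow> real"
  proof -
    define g where "g = (\<lambda>\<zeta>. \<Sum>\<^sub>\<infinity>x\<in>\<Lambda>. ennreal (c x * poisson x \<zeta>))"
    \<comment> \<open>Sums of nonnegative terms are suprema of finite partial sums, so finite
      \<open>F\<close> suffice.\<close>
    have "(\<Sum>x\<in>F. ennreal (c x * phi_Lambda \<Lambda> x)) \<le> ennreal T * dual_norm_pos \<phi> \<psi> g" if F: "finite F" "F \<subseteq> \<Lambda>" for F
    proof -
      have nx: "norm x < 1" if "x \<in> F" for x using that F \<Lambda> by auto
      have cx: "0 \<le> c x" if "x \<in> F" for x using that F c by auto
      have "(\<Sum>x\<in>F. ennreal (c x * phi_Lambda \<Lambda> x)) \<le> (\<Sum>x\<in>F. ennreal (c x * poisson_int w x))"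
        using F w(3) cx by (intro sum_mono ennreal_leI mult_left_mono) auto
      also have "\<dots> = (\<Sum>x\<in>F. \<integral>\<^sup>+t. ennreal (c x * (poisson x (cis t) * w (cis t))) \<partial>circ)"
      proof (rule sum.cong[OF refl])
        fix x assume x: "x \<in> F"
        have "(\<integral>\<^sup>+t. ennreal (c x * (poisson x (cis t) * w (cis t))) \<partial>circ) = ennreal (\<integral>t. c x * (poisson x (cis t) * w (cis t)) \<partial>circ)"
          using integrable_poisson_mult[OF nx[OF x] wi] poisson_nonneg[OF nx[OF x]] cx[OF x] w0
          by (intro nn_integral_eq_integral) (auto simp: less_imp_le)
        then show "ennreal (c x * poisson_int w x) = (\<integral>\<^sup>+t. ennreal (c x * (poisson x (cis t) * w (cis t))) \<partial>circ)"
          by (simp add: poisson_int_eq)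
      qed
      also have "\<dots> = (\<integral>\<^sup>+t. (\<Sum>x\<in>F. ennreal (c x * (poisson x (cis t) * w (cis t)))) \<partial>circ)"
        using nx wm by (intro nn_integral_sum[symmetric]) auto
      also have "\<dots> = (\<integral>\<^sup>+t. ennreal T * ((\<Sum>x\<in>F. ennreal (c x * poisson x (cis t))) * ennreal \<bar>u (cis t)\<bar>) \<partial>circ)"
      proof (rule nn_integral_cong)
        fix t
        have "ennreal T * ((\<Sum>x\<in>F. ennreal (c x * poisson x (cis t))) * ennreal \<bar>u (cis t)\<bar>) = (\<Sum>x\<in>F. ennreal T * (ennreal (c x * poisson x (cis t)) * ennreal \<bar>u (cis t)\<bar>))"
          by (simp add: sum_distrib_left sum_distrib_right)
        also have "\<dots> = (\<Sum>x\<in>F. ennreal (c x * (poisson x (cis t) * w (cis t))))"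
        proof (rule sum.cong[OF refl])
          fix x assume x: "x \<in> F"
          have "ennreal T * (ennreal (c x * poisson x (cis t)) * ennreal \<bar>u (cis t)\<bar>) = ennreal (T * ((c x * poisson x (cis t)) * \<bar>u (cis t)\<bar>))"
            using T cx[OF x] poisson_nonneg[OF nx[OF x]] by (simp add: ennreal_mult)
          also have "T * ((c x * poisson x (cis t)) * \<bar>u (cis t)\<bar>) = c x * (poisson x (cis t) * w (cis t))"
            using T w0[of t] by (simp add: au)
          finally show "ennreal T * (ennreal (c x * poisson x (cis t)) * ennreal \<bar>u (cis t)\<bar>) = ennreal (c x * (poisson x (cis t) * w (cis t)))" .
        qed
        finally show "(\<Sum>x\<in>F. ennreal (c x * (poisson x (cis t) * w (cis t)))) = ennreal T * ((\<Sum>x\<in>F. ennreal (c x * poisson x (cis t))) * ennreal \<bar>u (cis t)\<bar>)" by simp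
      qed
      also have "\<dots> = ennreal T * (\<integral>\<^sup>+t. (\<Sum>x\<in>F. ennreal (c x * poisson x (cis t))) * ennreal \<bar>u (cis t)\<bar> \<partial>circ)"
        using nx wm by (intro nn_integral_cmult) (auto simp: u_def)
      also have "(\<integral>\<^sup>+t. (\<Sum>x\<in>F. ennreal (c x * poisson x (cis t))) * ennreal \<bar>u (cis t)\<bar> \<partial>circ)
          = circ_nn_mean (\<lambda>\<zeta>. (\<Sum>x\<in>F. ennreal (c x * poisson x \<zeta>)) * ennreal \<bar>u \<zeta>\<bar>)"
        using nx wm by (intro circ_nn_mean_eq[symmetric]) (auto simp: u_def)
      also have "\<dots> \<le> circ_nn_mean (\<lambda>\<zeta>. g \<zeta> * ennreal \<bar>u \<zeta>\<bar>)"
      proof -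
        have "(\<Sum>x\<in>F. ennreal (c x * poisson x \<zeta>)) \<le> g \<zeta>" for \<zeta>
          unfolding g_def using F by (subst nonneg_infsum_complete) (auto intro!: SUP_upper2[of F])
        then show ?thesis unfolding circ_nn_mean_def
          by (intro mult_left_mono nn_integral_mono mult_right_mono) auto
      qed
      also have "\<dots> \<le> dual_norm_pos \<phi> \<psi> g" by (rule dual)
      finally show ?thesis by (simp add: mult_left_mono)
    qed
    then show ?thesis unfolding g_def[symmetric]
      by (subst nonneg_infsum_complete) (auto intro!: SUP_least)
  qed
  then show ?thesis using T by (intro exI[of _ T]) auto
qed

text \<open>The norm is an infimum that need not be attained, so norm at most 1 is used only to
  obtain some \<open>t < 2\<close> in the defining set; halving \<open>u\<close> turns this into a
  modular bound. Nonemptiness of the set is essential, as the infimum of the empty set carries no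
  information.\<close>

lemma orlicz_unit_ball_half:
  assumes u: "in_Lphi \<phi> u" "orlicz_norm \<psi> u \<le> 1"
  shows "(\<lambda>\<zeta>. \<bar>u \<zeta>\<bar> / 2) \<in> orlicz_ball \<rho> 2"
proof -
  define A where "A = {t. 0 < t \<and> circ_nn_mean (\<lambda>\<zeta>. ennreal (\<psi> (\<bar>u \<zeta>\<bar> / t))) \<le> ennreal t}"
  obtain T where "T \<ge> 1" "circ_nn_mean (\<lambda>\<zeta>. ennreal (\<psi> (\<bar>u \<zeta>\<bar> / T))) \<le> 1"
    using orlicz_norm_witness[OF u(1)] by blast
  moreover from this have "1 \<le> ennreal T" by simp
  ultimately have "T \<in> A" unfolding A_def by (auto intro: order.trans)
  moreover have "Inf A < 2" using u(2) by (simp add: orlicz_norm_def A_def)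
  ultimately obtain t where t: "t \<in> A" "t < 2" using cInf_lessD[of A 2] by auto
  then have t0: "t > 0" and tm: "circ_nn_mean (\<lambda>\<zeta>. ennreal (\<psi> (\<bar>u \<zeta>\<bar> / t))) \<le> ennreal t" by (auto simp: A_def)
  have um: "(\<lambda>t. u (cis t)) \<in> borel_measurable circ" using u by (simp add: in_Lphi_iff)
  have eq: "\<psi> (\<bar>x\<bar> / t) = \<rho> (\<bar>x\<bar> / t)" for x using t0 by (simp add: rho_eq)
  have "(\<integral>\<^sup>+s. ennreal (\<rho> (\<bar>u (cis s)\<bar> / 2)) \<partial>circ) \<le> (\<integral>\<^sup>+s. ennreal (\<psi> (\<bar>u (cis s)\<bar> / t)) \<partial>circ)"
    using t t0 by (intro nn_integral_mono ennreal_leI) (auto simp: rho_eq intro!: psi_mono divide_left_mono)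
  also have "\<dots> = circ_nn_mean (\<lambda>\<zeta>. ennreal (\<psi> (\<bar>u \<zeta>\<bar> / t)))"
    unfolding eq by (rule circ_nn_mean_eq[symmetric]) (use um in measurable)
  also have "\<dots> \<le> ennreal t" by (rule tm)
  also have "\<dots> \<le> ennreal 2" using t by (intro ennreal_leI) auto
  finally have fin: "(\<integral>\<^sup>+s. ennreal (\<rho> (\<bar>u (cis s)\<bar> / 2)) \<partial>circ) \<le> ennreal 2" .
  have m: "(\<lambda>s. \<rho> (\<bar>u (cis s)\<bar> / 2)) \<in> borel_measurable circ" using um by measurable
  have i: "integrable circ (\<lambda>s. \<rho> (\<bar>u (cis s)\<bar> / 2))"
    by (rule integrableI_nonneg[OF m]) (use fin R.nonneg in \<open>auto intro: order_le_less_trans\<close>)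
  have "ennreal (\<integral>s. \<rho> (\<bar>u (cis s)\<bar> / 2) \<partial>circ) \<le> ennreal 2"
    using fin by (subst (asm) nn_integral_eq_integral[OF i]) (auto simp: R.nonneg)
  then have "(\<integral>s. \<rho> (\<bar>u (cis s)\<bar> / 2) \<partial>circ) \<le> 2" by (subst (asm) ennreal_le_iff) auto
  then show ?thesis using i um unfolding orlicz_ball_def by auto
qed

text \<open>Approximate minimisers of the squared defect over the Orlicz ball satisfy a first-order condition
  whose multipliers, inserted into the dual inequality, force the defect to vanish.\<close>

lemma approximate_majorant_of_dual_condition:
  assumes C: "C > 0" and dual: "\<And>c::complex \<Rightarrow> real. (\<forall>x\<in>\<Lambda>. 0 \<le> c x) \<Longrightarrow>
      (\<Sum>\<^sub>\<infinity>x\<in>\<Lambda>. ennreal (c x * h x)) \<le> ennreal C * dual_norm_pos \<phi> \<psi> (\<lambda>\<zeta>. \<Sum>\<^sub>\<infinity>x\<in>\<Lambda>. ennreal (c x * poisson x \<zeta>))"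
    and \<Lambda>: "\<Lambda> \<subseteq> ball 0 1" and h0: "\<And>x. x \<in> \<Lambda> \<Longrightarrow> 0 \<le> h x"
    and F: "finite F" "F \<subseteq> \<Lambda>" and e: "e > 0"
  shows "\<exists>w\<in>orlicz_ball \<rho> 2. \<forall>l\<in>F. h l - 2 * C * poisson_int w l \<le> e"
proof -
  let ?K = "orlicz_ball \<rho> 2"
  \<comment> \<open>The factor 2 compensates for the halving by which the unit ball of the norm is
    mapped into \<open>?K\<close>.\<close>
  define A where "A = 2 * C"
  have A: "A > 0" using C by (simp add: A_def)
  have nF: "norm l < 1" if "l \<in> F" for l using that F \<Lambda> by auto
  have h0F: "0 \<le> h l" if "l \<in> F" for l using that F h0 by auto
  have Ki: "circ_integrable w" if "w \<in> ?K" for w using R.orlicz_ball_circ_integrable[OF that] .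
  have K0: "(\<lambda>_. 0) \<in> ?K" by (simp add: orlicz_ball_def rho_eq psi_0)
  have P0: "0 \<le> poisson_int w l" if "w \<in> ?K" "l \<in> F" for w l
    using poisson_int_nonneg[OF nF[OF that(2)]] that(1) by (auto simp: orlicz_ball_def)
  obtain T where T: "T > 0" "\<And>t. 0 \<le> t \<Longrightarrow> t \<le> min t T + 1 * \<rho> t" using R.linear_bound[of 1] by auto
  define B where "B = (\<lambda>l::complex. (1 - (norm l)\<^sup>2) / (1 - norm l)\<^sup>2)"
  have B0: "0 \<le> B l" if "l \<in> F" for l unfolding B_def using nF[OF that] by (auto simp: power_le_one)
  define R where "R = (\<Sum>l\<in>F. B l) * (T + 2)"
  have PR: "poisson_int w l \<le> R" if w: "w \<in> ?K" and l: "l \<in> F" for w l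
  proof -
    have ir: "integrable circ (\<lambda>t. \<rho> (w (cis t)))" and w2: "(\<integral>t. \<rho> (w (cis t)) \<partial>circ) \<le> 2" and w0: "\<And>\<zeta>. 0 \<le> w \<zeta>"
      using w by (auto simp: orlicz_ball_def)
    have "poisson_int w l \<le> (\<integral>t. B l * (T + \<rho> (w (cis t))) \<partial>circ)"
      unfolding poisson_int_eq
    proof (rule integral_mono)
      show "integrable circ (\<lambda>t. poisson l (cis t) * w (cis t))" by (rule integrable_poisson_mult[OF nF[OF l] Ki[OF w]])
      show "integrable circ (\<lambda>t. B l * (T + \<rho> (w (cis t))))" using ir by simp
      fix t
      have "w (cis t) \<le> T + \<rho> (w (cis t))" using T(2)[OF w0[of "cis t"]] by linarith
      then show "poisson l (cis t) * w (cis t) \<le> B l * (T + \<rho> (w (cis t)))"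
        using poisson_le[OF nF[OF l], of "cis t"] poisson_nonneg[OF nF[OF l]] w0 B0[OF l] unfolding B_def by (intro mult_mono) auto
    qed
    also have "\<dots> = B l * (T + (\<integral>t. \<rho> (w (cis t)) \<partial>circ))"
      using ir by (simp add: circ.prob_space[unfolded space_circ])
    also have "\<dots> \<le> (\<Sum>l\<in>F. B l) * (T + 2)"
      using w2 T(1) B0 F(1) l by (intro mult_mono member_le_sum add_left_mono sum_nonneg) (auto intro!: add_nonneg_nonneg integral_nonneg_AE simp: R.nonneg)
    finally show ?thesis by (simp add: R_def)
  qed
  define d where "d = (\<lambda>w l. max 0 (h l - A * poisson_int w l))"
  define J where "J = (\<lambda>w. \<Sum>l\<in>F. (d w l)\<^sup>2)"
  \<comment> \<open>\<open>R\<close> bounds all Poisson integrals of elements of \<open>?K\<close>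
    on \<open>F\<close>, so \<open>M\<close> bounds the quadratic term of any variation within
    \<open>?K\<close>.\<close>
  define M where "M = (\<Sum>l\<in>F. (A * R)\<^sup>2)"
  have J0: "0 \<le> J w" for w unfolding J_def by (intro sum_nonneg) auto
  have M0: "0 \<le> M" unfolding M_def by (intro sum_nonneg) auto
  \<comment> \<open>Step length of the variation and, squared, the tolerance for the near-minimiser.
    Division by \<open>2 * \<delta>\<close> leaves the error \<open>\<delta> * (1 + M) / 2\<close>,
    which is at most \<open>e\<^sup>2\<close>.\<close>
  define \<delta> where "\<delta> = min 1 (e\<^sup>2 / (1 + M))"
  have \<delta>: "0 < \<delta>" "\<delta> \<le> 1" using e M0 by (auto simp: \<delta>_def)
  have \<delta>e: "\<delta> * (1 + M) / 2 \<le> e\<^sup>2"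
  proof -
    have "\<delta> * (1 + M) \<le> e\<^sup>2 / (1 + M) * (1 + M)" using M0 by (intro mult_right_mono) (auto simp: \<delta>_def)
    also have "\<dots> = e\<^sup>2" using M0 by simp
    finally show ?thesis using zero_le_power2[of e] by linarith
  qed
  define j where "j = Inf (J ` ?K)"
  have bb: "bdd_below (J ` ?K)" using J0 by (auto intro!: bdd_belowI[of _ 0])
  have "j < j + \<delta>\<^sup>2" using \<delta> by simp
  then obtain w0 where w0: "w0 \<in> ?K" "J w0 < j + \<delta>\<^sup>2"
    unfolding j_def using cInf_lessD[of "J ` ?K" "Inf (J ` ?K) + \<delta>\<^sup>2"] K0 by auto
  have jle: "j \<le> J w" if "w \<in> ?K" for w unfolding j_def using bb that by (intro cInf_lower) auto
  \<comment> \<open>A squared defect has derivative twice the defect, so the defects at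
    \<open>w0\<close> serve as multipliers.\<close>
  define c where "c = d w0"
  have c0: "0 \<le> c l" for l by (simp add: c_def d_def)
  define Z where "Z = (\<Sum>l\<in>F. c l * h l) - J w0 + \<delta> * (1 + M) / 2"
  have first: "A * (\<Sum>l\<in>F. c l * poisson_int u l) \<le> Z" if u: "u \<in> ?K" for u
  proof -
    define v where "v = (\<lambda>\<zeta>. (1 - \<delta>) * w0 \<zeta> + \<delta> * u \<zeta>)"
    have v: "v \<in> ?K" unfolding v_def using w0(1) u \<delta> by (intro R.orlicz_ball_convex) auto
    define y where "y = (\<lambda>l. A * (poisson_int u l - poisson_int w0 l))"
    have Pv: "A * poisson_int v l = A * poisson_int w0 l + \<delta> * y l" if "l \<in> F" for l
    proof -
      have eq: "poisson_int v l = (1 - \<delta>) * poisson_int w0 l + \<delta> * poisson_int u l"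
        unfolding v_def using Ki[OF w0(1)] Ki[OF u]
        by (subst poisson_int_add[OF nF[OF that]]) (auto simp: poisson_int_cmult circ_integrable_iff)
      show ?thesis unfolding eq y_def by (simp add: algebra_simps)
    qed
    \<comment> \<open>One-sided Taylor bound: the squared positive part has derivative
      \<open>2 * max 0 a\<close> and remainder at most \<open>b^2\<close>.\<close>
    have sq: "(max 0 (a - b))\<^sup>2 \<le> (max 0 a)\<^sup>2 - 2 * max 0 a * b + b\<^sup>2" for a b :: real
    proof -
      have "max 0 (a - b) \<le> \<bar>max 0 a - b\<bar>" by (simp add: max_def)
      then have "(max 0 (a - b))\<^sup>2 \<le> \<bar>max 0 a - b\<bar>\<^sup>2" by (intro power_mono) auto
      then show ?thesis by (simp add: power2_diff)
    qed
    have ysq: "(y l)\<^sup>2 \<le> (A * R)\<^sup>2" if "l \<in> F" for l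
    proof -
      have "\<bar>poisson_int u l - poisson_int w0 l\<bar> \<le> R"
        using PR[OF u that] PR[OF w0(1) that] P0[OF u that] P0[OF w0(1) that] by linarith
      then have "\<bar>y l\<bar> \<le> \<bar>A * R\<bar>" using A by (auto simp: y_def abs_mult)
      then show ?thesis by (rule abs_le_square_iff[THEN iffD1])
    qed
    have "J v \<le> (\<Sum>l\<in>F. (c l)\<^sup>2 - 2 * c l * (\<delta> * y l) + (\<delta> * y l)\<^sup>2)"
      unfolding J_def
    proof (rule sum_mono)
      fix l assume l: "l \<in> F"
      have "d v l = max 0 ((h l - A * poisson_int w0 l) - \<delta> * y l)" by (simp add: d_def Pv[OF l] algebra_simps)
      then show "(d v l)\<^sup>2 \<le> (c l)\<^sup>2 - 2 * c l * (\<delta> * y l) + (\<delta> * y l)\<^sup>2"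
        using sq[of "h l - A * poisson_int w0 l" "\<delta> * y l"] by (simp add: c_def d_def)
    qed
    also have "\<dots> = J w0 - 2 * \<delta> * (\<Sum>l\<in>F. c l * y l) + \<delta>\<^sup>2 * (\<Sum>l\<in>F. (y l)\<^sup>2)"
      by (simp add: J_def c_def sum.distrib sum_subtractf sum_distrib_left power_mult_distrib mult_ac)
    also have "\<dots> \<le> J w0 - 2 * \<delta> * (\<Sum>l\<in>F. c l * y l) + \<delta>\<^sup>2 * M"
      unfolding M_def using ysq by (intro add_left_mono mult_left_mono sum_mono) auto
    finally have "j \<le> J w0 - 2 * \<delta> * (\<Sum>l\<in>F. c l * y l) + \<delta>\<^sup>2 * M" using jle[OF v] by simp
    then have "2 * \<delta> * (\<Sum>l\<in>F. c l * y l) \<le> \<delta>\<^sup>2 * (1 + M)" using w0(2) by (simp add: algebra_simps)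
    then have "\<delta> * (2 * (\<Sum>l\<in>F. c l * y l)) \<le> \<delta> * (\<delta> * (1 + M))" by (simp add: power2_eq_square mult_ac)
    then have "2 * (\<Sum>l\<in>F. c l * y l) \<le> \<delta> * (1 + M)" using \<delta>(1) by (rule mult_left_le_imp_le)
    moreover have "(\<Sum>l\<in>F. c l * y l) = A * (\<Sum>l\<in>F. c l * poisson_int u l) - (\<Sum>l\<in>F. c l * (A * poisson_int w0 l))"
      by (simp add: y_def sum_distrib_left sum_subtractf[symmetric] algebra_simps)
    moreover have "(\<Sum>l\<in>F. c l * (A * poisson_int w0 l)) = (\<Sum>l\<in>F. c l * h l) - J w0"
    proof -
      have "c l * (A * poisson_int w0 l) = c l * h l - (d w0 l)\<^sup>2" for l
        unfolding c_def d_def by (simp add: max_def power2_eq_square algebra_simps)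
      then show ?thesis by (simp add: J_def sum_subtractf)
    qed
    ultimately show ?thesis unfolding Z_def by linarith
  qed
  have Z0: "0 \<le> Z" using first[OF K0] by (simp add: poisson_int_eq)
  define cF where "cF = (\<lambda>x. if x \<in> F then c x else 0)"
  have "ennreal (\<Sum>l\<in>F. c l * h l) = (\<Sum>l\<in>F. ennreal (c l * h l))"
    using c0 h0F by (intro sum_ennreal[symmetric]) auto
  also have "\<dots> = (\<Sum>\<^sub>\<infinity>x\<in>\<Lambda>. ennreal (cF x * h x))"
    unfolding cF_def using infsum_ennreal_finite_support[OF F] by simp
  also have "\<dots> \<le> ennreal C * dual_norm_pos \<phi> \<psi> (\<lambda>\<zeta>. \<Sum>\<^sub>\<infinity>x\<in>\<Lambda>. ennreal (cF x * poisson x \<zeta>))"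
    by (rule dual) (simp add: cF_def c0)
  also have "(\<lambda>\<zeta>. \<Sum>\<^sub>\<infinity>x\<in>\<Lambda>. ennreal (cF x * poisson x \<zeta>)) = (\<lambda>\<zeta>. \<Sum>x\<in>F. ennreal (c x * poisson x \<zeta>))"
    unfolding cF_def using infsum_ennreal_finite_support[OF F] by simp
  also have "dual_norm_pos \<phi> \<psi> (\<lambda>\<zeta>. \<Sum>x\<in>F. ennreal (c x * poisson x \<zeta>)) \<le> ennreal (2 / A * Z)"
    unfolding dual_norm_pos_def
  proof (rule SUP_least)
    fix u assume "u \<in> {u. in_Lphi \<phi> u \<and> orlicz_norm \<psi> u \<le> 1}"
    then have uL: "in_Lphi \<phi> u" and un: "orlicz_norm \<psi> u \<le> 1" by auto
    have half: "(\<lambda>\<zeta>. \<bar>u \<zeta>\<bar> / 2) \<in> ?K" by (rule orlicz_unit_ball_half[OF uL un])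
    have um: "(\<lambda>t. u (cis t)) \<in> borel_measurable circ" using uL by (simp add: in_Lphi_iff)
    have ui: "circ_integrable (\<lambda>\<zeta>. \<bar>u \<zeta>\<bar>)" using in_Lphi_circ_integrable[OF uL] by (simp add: circ_integrable_iff)
    have i1: "integrable circ (\<lambda>t. c x * (poisson x (cis t) * \<bar>u (cis t)\<bar>))" if "x \<in> F" for x
      using integrable_poisson_mult[OF nF[OF that] ui] by simp
    have "circ_nn_mean (\<lambda>\<zeta>. (\<Sum>x\<in>F. ennreal (c x * poisson x \<zeta>)) * ennreal \<bar>u \<zeta>\<bar>)
        = (\<integral>\<^sup>+t. (\<Sum>x\<in>F. ennreal (c x * poisson x (cis t))) * ennreal \<bar>u (cis t)\<bar> \<partial>circ)"
      using nF um by (intro circ_nn_mean_eq) auto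
    also have "\<dots> = (\<integral>\<^sup>+t. ennreal (\<Sum>x\<in>F. c x * (poisson x (cis t) * \<bar>u (cis t)\<bar>)) \<partial>circ)"
    proof (rule nn_integral_cong)
      fix t
      have "(\<Sum>x\<in>F. ennreal (c x * poisson x (cis t))) = ennreal (\<Sum>x\<in>F. c x * poisson x (cis t))"
        using c0 poisson_nonneg[OF nF] by (intro sum_ennreal) auto
      moreover have "0 \<le> (\<Sum>x\<in>F. c x * poisson x (cis t))" using c0 poisson_nonneg[OF nF] by (intro sum_nonneg) auto
      ultimately show "(\<Sum>x\<in>F. ennreal (c x * poisson x (cis t))) * ennreal \<bar>u (cis t)\<bar> = ennreal (\<Sum>x\<in>F. c x * (poisson x (cis t) * \<bar>u (cis t)\<bar>))"
        by (simp add: ennreal_mult[symmetric] sum_distrib_right mult.assoc)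
    qed
    also have "\<dots> = ennreal (\<integral>t. (\<Sum>x\<in>F. c x * (poisson x (cis t) * \<bar>u (cis t)\<bar>)) \<partial>circ)"
      using i1 c0 poisson_nonneg[OF nF] by (intro nn_integral_eq_integral Bochner_Integration.integrable_sum AE_I2 sum_nonneg) auto
    also have "(\<integral>t. (\<Sum>x\<in>F. c x * (poisson x (cis t) * \<bar>u (cis t)\<bar>)) \<partial>circ) = (\<Sum>x\<in>F. c x * poisson_int (\<lambda>\<zeta>. \<bar>u \<zeta>\<bar>) x)"
      using i1 by (subst Bochner_Integration.integral_sum) (auto simp: poisson_int_eq)
    also have "\<dots> = 2 / A * (A * (\<Sum>x\<in>F. c x * poisson_int (\<lambda>\<zeta>. \<bar>u \<zeta>\<bar> / 2) x))"
    proof -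
      have "poisson_int (\<lambda>\<zeta>. \<bar>u \<zeta>\<bar>) x = 2 * poisson_int (\<lambda>\<zeta>. \<bar>u \<zeta>\<bar> / 2) x" for x
        using poisson_int_cmult[of "1/2" "\<lambda>\<zeta>. \<bar>u \<zeta>\<bar>" x] by simp
      then show ?thesis using A by (simp add: sum_distrib_left mult_ac)
    qed
    also have "ennreal \<dots> \<le> ennreal (2 / A * Z)"
      using A by (intro ennreal_leI mult_left_mono first[OF half]) auto
    finally show "circ_nn_mean (\<lambda>\<zeta>. (\<Sum>x\<in>F. ennreal (c x * poisson x \<zeta>)) * ennreal \<bar>u \<zeta>\<bar>) \<le> ennreal (2 / A * Z)" .
  qed
  finally have "ennreal (\<Sum>l\<in>F. c l * h l) \<le> ennreal C * ennreal (2 / A * Z)"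
    by (simp add: mult_left_mono)
  \<comment> \<open>Here \<open>C * (2 / A) = 1\<close>. In the resulting inequality the sum of the
    \<open>c l * h l\<close> cancels against the one in \<open>Z\<close>, which leaves
    \<open>J w0 \<le> \<delta> * (1 + M) / 2\<close>.\<close>
  also have "\<dots> = ennreal Z" using C Z0 by (simp add: ennreal_mult[symmetric] A_def)
  finally have "(\<Sum>l\<in>F. c l * h l) \<le> Z" using Z0 by simp
  then have Je: "J w0 \<le> e\<^sup>2" using \<delta>e by (simp add: Z_def)
  have "h l - 2 * C * poisson_int w0 l \<le> e" if l: "l \<in> F" for l
  proof -
    have "(d w0 l)\<^sup>2 \<le> J w0" unfolding J_def using F(1) l by (intro member_le_sum) auto
    then have "(d w0 l)\<^sup>2 \<le> e\<^sup>2" using Je by simp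
    then have "d w0 l \<le> e" by (rule power2_le_imp_le) (use e in simp)
    then show ?thesis by (simp add: d_def A_def)
  qed
  then show ?thesis using w0(1) by blast
qed

text \<open>The near-majorants on growing finite sets, with defects at most
  \<open>1 / Suc n\<close>, all lie in one modular ball, so compactness provides a limit weight;
  adding 1 makes the weight strictly positive.\<close>

lemma majorant_of_dual_condition:
  assumes \<Lambda>: "blaschke_seq \<Lambda>" and C: "C > 0"
    and dual: "\<And>c::complex \<Rightarrow> real. (\<forall>x\<in>\<Lambda>. 0 \<le> c x) \<Longrightarrow>
      (\<Sum>\<^sub>\<infinity>x\<in>\<Lambda>. ennreal (c x * phi_Lambda \<Lambda> x))
        \<le> ennreal C * dual_norm_pos \<phi> \<psi> (\<lambda>\<zeta>. \<Sum>\<^sub>\<infinity>x\<in>\<Lambda>. ennreal (c x * poisson x \<zeta>))"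
  shows "\<exists>w. (\<forall>\<zeta>\<in>sphere 0 1. 0 < w \<zeta>) \<and> in_Lphi \<phi> w \<and> (\<forall>x\<in>\<Lambda>. phi_Lambda \<Lambda> x \<le> poisson_int w x)"
proof (cases "\<Lambda> = {}")
  case True
  then show ?thesis using in_Lphi_const[of 1] by (intro exI[of _ "\<lambda>_. 1"]) auto
next
  case False
  define en where "en = from_nat_into \<Lambda>"
  have rng: "range en = \<Lambda>" unfolding en_def using False blaschke_seq_countable[OF \<Lambda>] by (rule range_from_nat_into)
  have \<Lambda>b: "\<Lambda> \<subseteq> ball 0 1" using \<Lambda> by (simp add: blaschke_seq_def)
  have "\<exists>w\<in>orlicz_ball \<rho> 2. \<forall>l\<in>en ` {..n}. phi_Lambda \<Lambda> l - 2 * C * poisson_int w l \<le> 1 / real (Suc n)" for n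
    using rng by (intro approximate_majorant_of_dual_condition[OF C dual \<Lambda>b phi_Lambda_nonneg[OF \<Lambda>]]) auto
  then obtain w where w: "\<And>n. w n \<in> orlicz_ball \<rho> 2"
    "\<And>n l. l \<in> en ` {..n} \<Longrightarrow> phi_Lambda \<Lambda> l - 2 * C * poisson_int (w n) l \<le> 1 / real (Suc n)" by metis
  obtain v where v: "v \<in> orlicz_ball \<rho> 2"
    "\<And>z s. norm z < 1 \<Longrightarrow> eventually (\<lambda>n. s \<le> poisson_int (w n) z) sequentially \<Longrightarrow> s \<le> poisson_int v z"
    using R.orlicz_ball_compact[of w 2] w(1) by blast
  have le: "phi_Lambda \<Lambda> l \<le> 2 * C * poisson_int v l" if l: "l \<in> \<Lambda>" for l
  proof (rule field_le_epsilon)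
    fix e :: real assume e: "e > 0"
    obtain m where m: "en m = l" using rng l by blast
    obtain k :: nat where k: "1 / real (Suc k) < e" using nat_approx_posE[OF e] by blast
    have "(phi_Lambda \<Lambda> l - e) / (2 * C) \<le> poisson_int v l"
    proof (rule v(2))
      show "norm l < 1" using l \<Lambda>b by auto
      show "\<forall>\<^sub>F n in sequentially. (phi_Lambda \<Lambda> l - e) / (2 * C) \<le> poisson_int (w n) l"
        using eventually_ge_at_top[of "max m k"]
      proof eventually_elim
        case (elim n)
        have "1 / real (Suc n) \<le> 1 / real (Suc k)" using elim by (intro divide_left_mono) auto
        moreover have "phi_Lambda \<Lambda> l - 2 * C * poisson_int (w n) l \<le> 1 / real (Suc n)" using m elim by (intro w(2)) auto
        ultimately have "phi_Lambda \<Lambda> l - e \<le> 2 * C * poisson_int (w n) l" using k by linarith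
        then show ?case using C by (simp add: pos_divide_le_eq mult.commute)
      qed
    qed
    then show "phi_Lambda \<Lambda> l \<le> 2 * C * poisson_int v l + e" using C by (simp add: pos_divide_le_eq mult.commute)
  qed
  define W where "W = (\<lambda>\<zeta>. 2 * C * v \<zeta> + 1)"
  have vL: "in_Lphi \<phi> v" by (rule in_Lphi_of_orlicz_ball[OF v(1)])
  have "in_Lphi \<phi> W" unfolding W_def by (intro in_Lphi_add in_Lphi_cmult in_Lphi_const vL)
  moreover have "phi_Lambda \<Lambda> x \<le> poisson_int W x" if x: "x \<in> \<Lambda>" for x
  proof -
    have nx: "norm x < 1" using x \<Lambda>b by auto
    have "poisson_int W x = 2 * C * poisson_int v x + 1"
      unfolding W_def using in_Lphi_circ_integrable[OF in_Lphi_cmult[OF vL, of "2 * C"]]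
      by (subst poisson_int_add[OF nx]) (auto simp: poisson_int_cmult[of "2 * C"] poisson_int_const[OF nx] circ_integrable_iff)
    then show ?thesis using le[OF x] by simp
  qed
  moreover have "0 < W \<zeta>" for \<zeta>
  proof -
    have "0 \<le> v \<zeta>" using v(1) by (simp add: orlicz_ball_def)
    then show ?thesis using C by (simp add: W_def add_nonneg_pos)
  qed
  ultimately show ?thesis by blast
qed

end

theorem theorem1p1:
  fixes \<phi> :: "real \<Rightarrow> real" and \<Lambda> :: "complex set"
  assumes "strongly_convex \<phi>" and "Delta2 \<phi>" and "blaschke_seq \<Lambda>"
  shows "(free_interpolating (hardy_orlicz \<phi>) \<Lambda> \<longleftrightarrow>
            (\<exists>w. (\<forall>\<zeta>\<in>sphere 0 1. 0 < w \<zeta>) \<and> in_Lphi \<phi> w \<and>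
                 (\<forall>x\<in>\<Lambda>. phi_Lambda \<Lambda> x \<le> poisson_int w x)))
       \<and> (free_interpolating (hardy_orlicz \<phi>) \<Lambda> \<longleftrightarrow>
            trace_on (hardy_orlicz \<phi>) \<Lambda> = l_Phi \<phi> \<Lambda>)
       \<and> (Nabla2 \<phi> \<longrightarrow> (\<forall>\<psi>. orlicz_modification \<phi> \<psi> \<longrightarrow>
            (free_interpolating (hardy_orlicz \<phi>) \<Lambda> \<longleftrightarrow>
              (\<exists>C>0. \<forall>c::complex \<Rightarrow> real. (\<forall>x\<in>\<Lambda>. 0 \<le> c x) \<longrightarrow>
                 (\<Sum>\<^sub>\<infinity>x\<in>\<Lambda>. ennreal (c x * phi_Lambda \<Lambda> x))
                   \<le> ennreal C * dual_norm_pos \<phi> \<psi> (\<lambda>\<zeta>. \<Sum>\<^sub>\<infinity>x\<in>\<Lambda>. ennreal (c x * poisson x \<zeta>))))))"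
    (is "(?a \<longleftrightarrow> ?b) \<and> (?a \<longleftrightarrow> ?c) \<and> (_ \<longrightarrow> (\<forall>\<psi>. _ \<longrightarrow> (?a \<longleftrightarrow> ?d \<psi>)))")
proof -
  interpret orlicz_function \<phi> using assms by unfold_locales
  have \<Lambda>: "blaschke_seq \<Lambda>" and \<Lambda>b: "\<Lambda> \<subseteq> ball 0 1" using assms(3) by (auto simp: blaschke_seq_def)
  have ab: "?b" if "?a" using poisson_majorant_of_free_interpolating[OF \<Lambda> that] .
  have bc: "?c" if "?b"
  proof -
    from that obtain w where "\<forall>\<zeta>\<in>sphere 0 1. 0 < w \<zeta>" "in_Lphi \<phi> w" "\<forall>x\<in>\<Lambda>. phi_Lambda \<Lambda> x \<le> poisson_int w x" by blast
    from l_Phi_subset_trace[OF \<Lambda> this] trace_subset_l_Phi[OF \<Lambda>b] show ?thesis by blast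
  qed
  have ca: "?a" if "?c"
    unfolding free_interpolating_def that by (rule ideal_on_l_Phi[OF \<Lambda>b])
  have bd: "?b \<longleftrightarrow> ?d \<psi>" if mod: "orlicz_modification \<phi> \<psi>" for \<psi>
  proof -
    interpret orlicz_modified \<phi> \<psi> using mod by unfold_locales
    show ?thesis
    proof
      assume ?b
      then obtain w where w: "\<forall>\<zeta>\<in>sphere 0 1. 0 < w \<zeta>" "in_Lphi \<phi> w" "\<forall>x\<in>\<Lambda>. phi_Lambda \<Lambda> x \<le> poisson_int w x" by blast
      show "?d \<psi>" by (rule dual_condition_of_majorant[OF w \<Lambda>b])
    next
      assume "?d \<psi>"
      then obtain C where C: "C > 0" "\<And>c::complex \<Rightarrow> real. (\<forall>x\<in>\<Lambda>. 0 \<le> c x) \<Longrightarrow>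
                 (\<Sum>\<^sub>\<infinity>x\<in>\<Lambda>. ennreal (c x * phi_Lambda \<Lambda> x))
                   \<le> ennreal C * dual_norm_pos \<phi> \<psi> (\<lambda>\<zeta>. \<Sum>\<^sub>\<infinity>x\<in>\<Lambda>. ennreal (c x * poisson x \<zeta>))" by blast
      show ?b by (rule majorant_of_dual_condition[OF \<Lambda> C])
    qed
  qed
  have iff_b: "?a \<longleftrightarrow> ?b" using ab bc ca by blast
  moreover have "?a \<longleftrightarrow> ?c" using ab bc ca by blast
  moreover have "\<forall>\<psi>. orlicz_modification \<phi> \<psi> \<longrightarrow> (?a \<longleftrightarrow> ?d \<psi>)"
    unfolding iff_b using bd by blast
  ultimately show ?thesis by blast
qed

end
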